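(* The asymptotic mapping class group $\mathcal{T}$ (Thompson's group $\mathcal{T}$) acts on the asymptotic pants complex $\mathcal{C}$ by automorphisms via $v\mapsto f\cdot v$, and this action is transitive on the vertices of $\mathcal{C}$. Furthermore, the resulting map $\Psi:\mathcal{T}\to\mathrm{Aut}(\mathcal{C})$ is injective.
   Context: Thompson's group $\mathcal{T}$: the group of orientation-preserving piecewise linear homeomorphisms of the circle $S^1=[0,1]/(0\sim 1)=\mathbb{R}/\mathbb{Z}$ with finitely many points of non-differentiability, all of which are dyadic rationals, whose derivatives (where defined) are powers of $2$, and which send the set of dyadic rationals to itself. It is identified with the asymptotic mapping class group of the surface $\Sigma'=\mathbb{D}^2\cup\{\text{dyadic points of }\partial\mathbb{D}^2\}$ through the action on the dyadic points, and the action on $\mathcal{C}$ is defined through this identification. The complex $\mathcal{C}$: Let $\mathbb{D}^2$ be the hyperbolic disc with boundary circle $\partial\mathbb{D}^2$ parametrized by $\mathbb{R}/\mathbb{Z}$. A dyadic point is an element of $\mathbb{Z}[1/2]/\mathbb{Z}\subset\partial\mathbb{D}^2$. An arc is a bi-infinite geodesic of $\mathbb{D}^2$ joining two distinct dyadic points. For $n\ge 1$ and $0\le a\le 2^n-1$ let $I_a^n$ be the arc joining $a/2^n$ and $(a+1)/2^n$ (so $I_0^1=I_1^1$). The set $E$ of all $I_a^n$ is a triangulation of $\mathbb{D}^2$ into ideal triangles. In general, a triangulation is a set of pairwise non-crossing arcs cutting $\mathbb{D}^2$ into ideal triangles with dyadic vertices. The vertices of $\mathcal{C}$ are the triangulations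 which differ from $E$ only in finitely many triangles. If $v$ is such a triangulation and $a$ is an arc of $v$, the two triangles of $v$ having $a$ as a side form an ideal quadrilateral; flipping $a$ means replacing $a$ by the other diagonal of this quadrilateral. Two vertices of $\mathcal{C}$ are joined by an edge iff one is obtained from the other by flipping one arc. The 2-cells: let $a\neq b$ be two arcs of a vertex $v$. If no triangle of $v$ has both $a$ and $b$ as sides, the flips of $a$ and $b$ commute and define a 4-cycle in the 1-skeleton, filled by a square 2-cell. If some triangle of $v$ has both $a$ and $b$ as sides, the three triangles of $v$ having $a$ or $b$ as a side form an ideal pentagon, and the five triangulations obtained by triangulating this pentagon and keeping the rest of $v$ form a 5-cycle, filled by a pentagonal 2-cell. There is one 2-cell for each such cycle. $\mathrm{Aut}(\mathcal{C})$ is the group of cellular automorphisms of $\mathcal{C}$, i.e. automorphisms of the 1-skeleton graph which, together with their inverses, send boundary cycles of 2-cells to boundary cycles of 2-cells. The action: for $f\in\mathcal{T}$ and a vertex $v$ of $\mathcal{C}$, $f\cdot v$ is the set of arcs such that the arc joining the dyadic points $p,q$ belongs to $f\cdot v$ iff the arc joining $f^{-1}(p)$ and $f^{-1}(q)$ belongs to $v$. $\Psi(f)$ denotes the automorphism of $\mathcal{C}$ given on vertices by $v\mapsto f\cdot v$. *)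

theory Defs
  imports "HOL-Analysis.Analysis" "HOL-Algebra.Group_Action"
begin

section \<open>Circle and disc\<close>

text \<open>
  The circle $\mathbb{R}/\mathbb{Z}$ is realised as the unit circle in the complex plane, the
  class of a real number t being the point \<open>circ t\<close>.
\<close>

abbreviation S1 :: "complex set" where
  "S1 \<equiv> sphere 0 1"

definition circ :: "real \<Rightarrow> complex" where
  "circ t = cis (2 * pi * t)"

definition dyadic :: "real set" where
  "dyadic = {real_of_int m / 2 ^ n | (m::int) (n::nat). True}"

definition dyadic_points :: "complex set" where
  "dyadic_points = circ ` dyadic"


section \<open>Thompson's group T\<close>

text \<open>
  An orientation-preserving homeomorphism \<open>f\<close> of the circle is one that has a strictly increasing
  continuous lift \<open>F\<close> to the real line. It is piecewise linear with derivatives powers of two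
  (integer exponents) if, away from the lifts of a finite set \<open>B\<close> of points, \<open>F\<close> is locally affine
  with such a slope; here \<open>B\<close> consists of dyadic points.
  Members are taken extensional on the circle, so that equality of members is equality of maps of
  the circle.
\<close>

definition thompson_maps :: "(complex \<Rightarrow> complex) set" where
  "thompson_maps =
    {f \<in> extensional S1.
       (\<exists>g. homeomorphism S1 S1 f g) \<and>
       f ` dyadic_points = dyadic_points \<and>
       (\<exists>F :: real \<Rightarrow> real.
          continuous_on UNIV F \<and> strict_mono F \<and> (\<forall>x. f (circ x) = circ (F x)) \<and>
          (\<exists>B \<subseteq> dyadic_points. finite B \<and>
             (\<forall>x. circ x \<notin> B \<longrightarrow>
                (\<exists>(k::int) c. \<forall>\<^sub>F y in nhds x. F y = 2 powi k * y + c))))}"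

definition thompson_T :: "(complex \<Rightarrow> complex) monoid" where
  "thompson_T = (BijGroup S1)\<lparr>carrier := thompson_maps\<rparr>"


section \<open>Arcs and triangulations\<close>

text \<open>
  The hyperbolic disc is taken in the Klein model: it is the open unit disc, and the bi-infinite
  geodesic between two points of the circle is the open chord between them. The open ideal triangle
  with given vertices on the circle is then the interior of their convex hull.
\<close>

abbreviation disc :: "complex set" where
  "disc \<equiv> ball 0 1"

abbreviation geodesic :: "complex \<Rightarrow> complex \<Rightarrow> complex set" where
  "geodesic p q \<equiv> open_segment p q"

definition arcs :: "complex set set" where
  "arcs = {geodesic p q | p q. p \<in> dyadic_points \<and> q \<in> dyadic_points \<and> p \<noteq> q}"

definition ideal_triangle :: "complex \<Rightarrow> complex \<Rightarrow> complex \<Rightarrow> complex set" where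
  "ideal_triangle p q r = interior (convex hull {p, q, r})"

definition regions :: "complex set set \<Rightarrow> complex set set" where
  "regions v = components (disc - \<Union>v)"

text \<open>Distinct geodesics cross iff they meet inside the disc; common ideal endpoints are allowed.\<close>

definition triangulation :: "complex set set \<Rightarrow> bool" where
  "triangulation v \<longleftrightarrow>
     v \<subseteq> arcs \<and> pairwise disjnt v \<and>
     (\<forall>c \<in> regions v. \<exists>p q r. {p, q, r} \<subseteq> dyadic_points \<and> distinct [p, q, r] \<and>
        c = ideal_triangle p q r)"

definition base_arc :: "nat \<Rightarrow> nat \<Rightarrow> complex set" where
  "base_arc n a = geodesic (circ (real a / 2 ^ n)) (circ ((real a + 1) / 2 ^ n))"

definition base_triangulation :: "complex set set" where
  "base_triangulation = {base_arc n a | n a. 1 \<le> n \<and> a \<le> 2 ^ n - 1}"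


section \<open>The complex C\<close>

definition C_vertices :: "complex set set set" where
  "C_vertices =
     {v. triangulation v \<and>
         finite ((regions v - regions base_triangulation) \<union>
                 (regions base_triangulation - regions v))}"

text \<open>
  The two triangles of \<open>v\<close> with side \<open>a = geodesic p q\<close> have third vertices \<open>r\<close> and \<open>s\<close>, so the
  set added below consists of one arc, the other diagonal of the quadrilateral \<open>p r q s\<close>.
\<close>

definition flip :: "complex set set \<Rightarrow> complex set \<Rightarrow> complex set set" where
  "flip v a = (v - {a}) \<union>
     {geodesic r s | r s. \<exists>p q. {p, q, r, s} \<subseteq> dyadic_points \<and> distinct [p, q, r, s] \<and>
        a = geodesic p q \<and> ideal_triangle p q r \<in> regions v \<and> ideal_triangle p q s \<in> regions v}"

definition C_edges :: "complex set set set set" where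
  "C_edges = {{v, w} | v w. v \<in> C_vertices \<and> w \<in> C_vertices \<and> (\<exists>a \<in> v. w = flip v a)}"

definition common_triangle :: "complex set set \<Rightarrow> complex set \<Rightarrow> complex set \<Rightarrow> bool" where
  "common_triangle v a b \<longleftrightarrow>
     (\<exists>p q r. {p, q, r} \<subseteq> dyadic_points \<and> distinct [p, q, r] \<and>
        ideal_triangle p q r \<in> regions v \<and> a = geodesic p q \<and> b = geodesic p r)"

text \<open>Boundary cycles of 2-cells are represented by their sets of edges.\<close>

definition square_cycle ::
  "complex set set \<Rightarrow> complex set \<Rightarrow> complex set \<Rightarrow> complex set set set set" where
  "square_cycle v a b =
     {{v, flip v a}, {flip v a, flip (flip v a) b},
      {flip (flip v a) b, flip v b}, {flip v b, v}}"

definition C_squares :: "complex set set set set set" where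
  "C_squares = {square_cycle v a b | v a b.
     v \<in> C_vertices \<and> a \<in> v \<and> b \<in> v \<and> a \<noteq> b \<and> \<not> common_triangle v a b}"

text \<open>
  In \<open>C_pentagons\<close> the two arcs are \<open>a = geodesic p q\<close> and \<open>b = geodesic p r\<close>, sides of the
  triangle \<open>p q r\<close>; the triangles on their other sides are \<open>p q s\<close> and \<open>p r t\<close>. The pentagon has
  vertices \<open>p, s, q, r, t\<close> in cyclic order, hence diagonals \<open>pq, pr, rs, st, tq\<close>, listed so that
  cyclically consecutive ones share an endpoint. The five triangulations of the pentagon are the
  five pairs of consecutive diagonals, and consecutive pairs differ by a flip.
\<close>

definition pentagon_cycle ::
  "complex set set \<Rightarrow> complex \<Rightarrow> complex \<Rightarrow> complex \<Rightarrow> complex \<Rightarrow> complex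
     \<Rightarrow> complex set set set set" where
  "pentagon_cycle v p q r s t =
     (let R = v - {geodesic p q, geodesic p r};
          w0 = R \<union> {geodesic p q, geodesic p r};
          w1 = R \<union> {geodesic p r, geodesic r s};
          w2 = R \<union> {geodesic r s, geodesic s t};
          w3 = R \<union> {geodesic s t, geodesic t q};
          w4 = R \<union> {geodesic t q, geodesic q p}
      in {{w0, w1}, {w1, w2}, {w2, w3}, {w3, w4}, {w4, w0}})"

definition C_pentagons :: "complex set set set set set" where
  "C_pentagons = {pentagon_cycle v p q r s t | v p q r s t.
     v \<in> C_vertices \<and> {p, q, r, s, t} \<subseteq> dyadic_points \<and> distinct [p, q, r, s, t] \<and>
     geodesic p q \<in> v \<and> geodesic p r \<in> v \<and>
     ideal_triangle p q r \<in> regions v \<and>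
     ideal_triangle p q s \<in> regions v \<and>
     ideal_triangle p r t \<in> regions v}"

definition C_cells :: "complex set set set set set" where
  "C_cells = C_squares \<union> C_pentagons"


section \<open>Automorphisms and the action\<close>

definition cellular :: "(complex set set \<Rightarrow> complex set set) \<Rightarrow> bool" where
  "cellular \<phi> \<longleftrightarrow>
     (\<forall>e \<in> C_edges. \<phi> ` e \<in> C_edges) \<and>
     (\<forall>c \<in> C_cells. (\<lambda>e. \<phi> ` e) ` c \<in> C_cells)"

definition Aut_C :: "(complex set set \<Rightarrow> complex set set) monoid" where
  "Aut_C = (BijGroup C_vertices)
     \<lparr>carrier := {\<phi> \<in> Bij C_vertices. cellular \<phi> \<and> cellular (inv_into C_vertices \<phi>)}\<rparr>"

definition act :: "(complex \<Rightarrow> complex) \<Rightarrow> complex set set \<Rightarrow> complex set set" where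
  "act f v = {geodesic p q | p q. p \<in> dyadic_points \<and> q \<in> dyadic_points \<and> p \<noteq> q \<and>
     geodesic (inv_into S1 f p) (inv_into S1 f q) \<in> v}"

definition Psi :: "(complex \<Rightarrow> complex) \<Rightarrow> complex set set \<Rightarrow> complex set set" where
  "Psi f = restrict (act f) C_vertices"

end

theory Submission
  imports Defs
begin

text \<open>
  The complex is an infinite object made of subsets of the disc, and Thompson maps act on boundary
  points only. The proof first replaces the topology of the disc by combinatorics of endpoints.
  Whether two geodesics cross is a sign condition on the orientation of triples of endpoints
  (\<open>geodesic_cross_iff\<close>), and an ideal triangle is a region of a family of pairwise non-crossing
  arcs iff its three sides belong to the family (\<open>triangle_region_iff\<close>). This gives the key
  characterisation \<open>C_vertices_eq\<close>: the vertices of the complex are exactly the maximal families of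
  pairwise non-crossing arcs that contain all standard arcs (the arcs of the base triangulation, over
  the intervals between neighbouring multiples of \<open>1 / 2 ^ n\<close>) of high level \<open>n\<close>. In such a family every
  arc is a diagonal of a quadrilateral, and exchanging it for the other diagonal gives a family of
  the same kind (\<open>exchange_arc_system\<close>); flips, squares and pentagons all come from this exchange.

  A Thompson map preserves the cyclic order of the circle, hence crossings and maximality. It is
  affine, with slope a power of two and dyadic offset, on each interval of some level, so it sends
  standard arcs of high level to standard arcs of high level (\<open>thompson_std_arc\<close>). Therefore it
  permutes the vertices, and it respects flips, common triangles and pentagons since these are now
  expressed by arcs alone. The inverse map does the same, so the action is by automorphisms.

  For transitivity it suffices to move an arbitrary vertex \<open>v\<close> to the base triangulation
  (\<open>transport_to_base\<close>). Past some level \<open>M\<close> the family \<open>v\<close> contains all standard arcs, and inside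
  the polygon whose vertices are the multiples of \<open>1 / 2 ^ M\<close> it is a triangulation with finitely many
  triangles. Its dual tree is a pattern of successive subdivisions: cutting off a triangle
  corresponds to halving a dyadic interval (\<open>polygon_subdivision\<close>). Interpolating linearly between
  these multiples and the break points of the resulting dyadic subdivision gives a Thompson
  map that carries every arc of \<open>v\<close> to a standard arc, and maximality turns the inclusion into an
  equality.

  For injectivity, a vertex and its flip at an arc \<open>a\<close> differ, on the side of the vertex, in \<open>a\<close>
  only. So two Thompson maps with the same action have the same effect on each arc of the base
  triangulation. Every dyadic point is the only common endpoint of two such arcs, so both maps agree
  on the dyadic points, which are dense.
\<close>

section \<open>Order and orientation on the circle\<close>

lemma circ_in_S1 [simp]: "circ x \<in> S1"
  by (simp add: circ_def)

lemma norm_circ [simp]: "cmod (circ x) = 1"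
  by (simp add: circ_def)

lemma circ_add_int [simp]: "circ (x + of_int k) = circ x"
proof -
  have "circ (x + of_int k) = cis (2 * pi * x) * cis (2 * pi * of_int k)"
    by (simp add: circ_def cis_mult algebra_simps)
  then show ?thesis
    by (simp add: circ_def cis_multiple_2pi)
qed

lemma circ_diff_int [simp]: "circ (x - of_int k) = circ x"
  using circ_add_int [of x "-k"] by simp

lemma circ_add_1 [simp]: "circ (x + 1) = circ x"
  using circ_add_int [of x 1] by simp

lemma circ_eq_iff: "circ x = circ y \<longleftrightarrow> (\<exists>k::int. x = y + of_int k)"
proof
  assume "circ x = circ y"
  then have "cos (2 * pi * x) = cos (2 * pi * y)" "sin (2 * pi * x) = sin (2 * pi * y)"
    by (auto simp: circ_def complex_eq_iff)
  then obtain n :: int where "2 * pi * x = 2 * pi * y + 2 * pi * real_of_int n"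
    using sin_cos_eq_iff [of "2 * pi * x" "2 * pi * y"] by auto
  then have "2 * pi * x = 2 * pi * (y + of_int n)"
    by (simp add: algebra_simps)
  then show "\<exists>k::int. x = y + of_int k"
    by auto
qed auto

lemma circ_inj: "\<lbrakk>circ x = circ y; x < y + 1; y < x + 1\<rbrakk> \<Longrightarrow> x = y"
  by (auto simp: circ_eq_iff)

lemma circ_neq: "\<lbrakk>x < y; y < x + 1\<rbrakk> \<Longrightarrow> circ x \<noteq> circ y"
  using circ_inj by force

lemma circ_lift:
  assumes "p \<in> S1"
  obtains x where "a \<le> x" "x < a + 1" "p = circ x"
proof -
  obtain t where t: "p = circ t"
  proof
    show "p = circ (Arg p / (2 * pi))"
      using assms cis_Arg [of p] by (cases "p = 0") (auto simp: circ_def sgn_div_norm)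
  qed
  show thesis
  proof
    show "a \<le> t - of_int \<lfloor>t - a\<rfloor>" "t - of_int \<lfloor>t - a\<rfloor> < a + 1"
      by linarith+
    show "p = circ (t - of_int \<lfloor>t - a\<rfloor>)"
      using t by simp
  qed
qed

text \<open>Twice the signed area of the triangle \<open>p q z\<close>: positive iff \<open>z\<close> lies to the left of the oriented
  line from \<open>p\<close> to \<open>q\<close>.\<close>

definition orient :: "complex \<Rightarrow> complex \<Rightarrow> complex \<Rightarrow> real" where
  "orient p q z = Im (cnj (q - p) * (z - p))"

lemma orient_cycle: "orient q r p = orient p q r"
  by (simp add: orient_def algebra_simps)

lemma orient_swap: "orient q p r = - orient p q r"
  by (simp add: orient_def algebra_simps)

lemma orient_refl [simp]: "orient p p z = 0" "orient p q p = 0" "orient p q q = 0"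
  by (simp_all add: orient_def algebra_simps)

lemma orient_affine:
  "orient p q ((1 - u) *\<^sub>R x + u *\<^sub>R y) = (1 - u) * orient p q x + u * orient p q y"
  by (simp add: orient_def algebra_simps)

lemma continuous_on_orient [continuous_intros]: "continuous_on A (orient p q)"
  unfolding orient_def [abs_def] by (intro continuous_intros)

text \<open>With respect to the midpoint of the boundary arc from \<open>s\<close> to \<open>t\<close>, the chord is a level line of the
  coordinate in the direction of that midpoint. This form yields both the sign on the circle and
  the distance estimate \<open>norm_ge_cos_of_outer\<close>.\<close>

lemma orient_circ_chord:
  "orient (circ s) (circ t) z
     = 2 * sin (pi * (t - s)) * (cos (pi * (t - s)) - Re (cnj (circ ((s + t) / 2)) * z))"
proof -
  define m d where "m = 2 * pi * ((s + t) / 2)" and "d = pi * (t - s)"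
  have s: "2 * pi * s = m - d" and t: "2 * pi * t = m + d"
    by (simp_all add: m_def d_def algebra_simps)
  have e: "(cos d)\<^sup>2 = 1 - (sin d)\<^sup>2" "(cos m)\<^sup>2 = 1 - (sin m)\<^sup>2"
    by (simp_all add: cos_squared_eq)
  have 1: "cos (m + d) - cos (m - d) = - 2 * sin m * sin d"
    and 2: "sin (m + d) - sin (m - d) = 2 * cos m * sin d"
    by (simp_all add: cos_add cos_diff sin_add sin_diff)
  have "orient (circ s) (circ t) z
      = (cos (m + d) - cos (m - d)) * (Im z - sin (m - d))
        - (sin (m + d) - sin (m - d)) * (Re z - cos (m - d))"
    unfolding orient_def circ_def s t by (simp add: algebra_simps)
  also have "\<dots> = 2 * sin d * (sin m * sin (m - d) + cos m * cos (m - d)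
       - (cos m * Re z + sin m * Im z))"
    unfolding 1 2 by (simp add: algebra_simps)
  also have "sin m * sin (m - d) + cos m * cos (m - d) = cos d"
    using cos_diff [of m "m - d"] by simp
  finally show ?thesis
    by (simp add: m_def d_def circ_def mult_ac)
qed

lemma orient_circ:
  "orient (circ s) (circ t) (circ u)
     = 4 * sin (pi * (t - s)) * sin (pi * (u - s)) * sin (pi * (u - t))"
proof -
  have "Re (cnj (circ ((s + t) / 2)) * circ u) = cos (2 * pi * u - pi * (s + t))"
    by (simp add: circ_def cos_diff)
  also have "cos (pi * (t - s)) - \<dots>
      = 2 * sin (pi * (u - s)) * sin (pi * (u - t))"
    by (simp add: cos_diff_cos) (simp add: algebra_simps diff_divide_distrib)
  finally show ?thesis
    by (simp add: orient_circ_chord)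
qed

lemma sin_pi_pos: "\<lbrakk>0 < x; x < 1\<rbrakk> \<Longrightarrow> 0 < sin (pi * x)"
  by (rule sin_gt_zero) (auto simp: mult_less_cancel_left1)

text \<open>Three points in counterclockwise order have positive orientation. Cyclic order is always expressed
  by lifts \<open>s < t < u < s + 1\<close> to the real line, where linear arithmetic decides it.\<close>

lemma orient_circ_pos: "\<lbrakk>s < t; t < u; u < s + 1\<rbrakk> \<Longrightarrow> 0 < orient (circ s) (circ t) (circ u)"
  unfolding orient_circ by (intro mult_pos_pos sin_pi_pos) auto

lemma orient_circ_neg: "\<lbrakk>s < u; u < t; t < s + 1\<rbrakk> \<Longrightarrow> orient (circ s) (circ t) (circ u) < 0"
  using orient_circ_pos [of s u t] orient_swap [of "circ t" "circ s" "circ u"]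
    orient_cycle [of "circ s" "circ u" "circ t"] orient_cycle [of "circ t" "circ s" "circ u"]
  by linarith

lemma orient_pos_lifts:
  assumes "p = circ a" "q \<in> S1" "r \<in> S1" "0 < orient p q r"
  obtains b c where "q = circ b" "r = circ c" "a < b" "b < c" "c < a + 1"
proof -
  obtain b where b: "a \<le> b" "b < a + 1" "q = circ b"
    using assms(2) by (rule circ_lift)
  obtain c where c: "a \<le> c" "c < a + 1" "r = circ c"
    using assms(3) by (rule circ_lift)
  have "b \<noteq> a" "c \<noteq> a" "c \<noteq> b"
    using assms b c by auto
  moreover have "\<not> c < b"
    using orient_circ_neg [of a c b] assms b c \<open>c \<noteq> a\<close> by force
  ultimately show thesis
    using that b c by force
qed

lemma orient_eq_0:
  assumes "p \<in> S1" "q \<in> S1" "r \<in> S1" "orient p q r = 0"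
  shows "p = q \<or> r = p \<or> r = q"
proof (rule ccontr)
  assume neg: "\<not> ?thesis"
  obtain a where a: "p = circ a"
    using assms(1) by (rule circ_lift)
  obtain b where b: "a \<le> b" "b < a + 1" "q = circ b"
    using assms(2) by (rule circ_lift)
  obtain c where c: "a \<le> c" "c < a + 1" "r = circ c"
    using assms(3) by (rule circ_lift)
  have "a < b" "a < c" "b < c \<or> c < b"
    using neg a b c by fastforce+
  then show False
    using orient_circ_neg [of a c b] orient_circ_pos [of a b c] a b c assms(4) by auto
qed


section \<open>Geodesics and ideal triangles in terms of orientation\<close>

lemma geodesic_norm_less:
  assumes "z \<in> geodesic p q" "p \<in> S1" "q \<in> S1"
  shows "cmod z < 1"
  using dist_decreases_open_segment [OF assms(1), of 0] assms(2,3) by auto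

lemma orient_on_geodesic: "z \<in> geodesic p q \<Longrightarrow> orient p q z = 0"
  by (auto simp: in_segment orient_affine)

text \<open>The power of a point with respect to the unit circle: points of a chord have norm below 1, points
  of the line outside the chord do not.\<close>

lemma cmod_affine_circle:
  assumes "p \<in> S1" "q \<in> S1"
  shows "(cmod ((1 - u) *\<^sub>R p + u *\<^sub>R q))\<^sup>2 = 1 - u * (1 - u) * (cmod (q - p))\<^sup>2"
proof -
  have e: "(Re p)\<^sup>2 + (Im p)\<^sup>2 = 1" "(Re q)\<^sup>2 + (Im q)\<^sup>2 = 1"
    using assms by (simp_all flip: cmod_power2)
  define c where "c = Re p * Re q + Im p * Im q"
  have "(cmod ((1 - u) *\<^sub>R p + u *\<^sub>R q))\<^sup>2
     = (1 - u)\<^sup>2 * ((Re p)\<^sup>2 + (Im p)\<^sup>2) + u\<^sup>2 * ((Re q)\<^sup>2 + (Im q)\<^sup>2) + 2 * u * (1 - u) * c"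
    by (simp only: cmod_power2) (simp add: c_def power2_eq_square algebra_simps)
  moreover have "(cmod (q - p))\<^sup>2
     = ((Re p)\<^sup>2 + (Im p)\<^sup>2) + ((Re q)\<^sup>2 + (Im q)\<^sup>2) - 2 * c"
    by (simp only: cmod_power2) (simp add: c_def power2_eq_square algebra_simps)
  ultimately have "(cmod ((1 - u) *\<^sub>R p + u *\<^sub>R q))\<^sup>2 = (1 - u)\<^sup>2 + u\<^sup>2 + 2 * u * (1 - u) * c"
    "(cmod (q - p))\<^sup>2 = 2 - 2 * c"
    by (simp_all only: e)
  then show ?thesis
    by algebra
qed

lemma mem_geodesicI:
  assumes "p \<in> S1" "q \<in> S1" "p \<noteq> q" "cmod z < 1" "orient p q z = 0"
  shows "z \<in> geodesic p q"
proof -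
  have nz: "q - p \<noteq> 0" using assms by auto
  define u where "u = Re ((z - p) / (q - p))"
  have "Im ((z - p) / (q - p)) = 0"
    using assms(5) by (simp add: Im_divide orient_def algebra_simps)
  then have "(z - p) / (q - p) = of_real u"
    by (simp add: u_def complex_eq_iff)
  then have "z - p = of_real u * (q - p)"
    using nz by (simp add: divide_simps)
  then have z: "z = (1 - u) *\<^sub>R p + u *\<^sub>R q"
    by (simp add: scaleR_conv_of_real algebra_simps)
  have "(cmod z)\<^sup>2 < 1"
    using assms(4) by (simp add: power_less_one_iff)
  then have "0 < u * (1 - u) * (cmod (q - p))\<^sup>2"
    using z cmod_affine_circle [OF assms(1,2), of u] by simp
  then have "0 < u * (1 - u)"
    using nz by (simp add: zero_less_mult_iff)
  then have "0 < u" "u < 1"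
    by (auto simp: zero_less_mult_iff)
  then show ?thesis
    using z assms(3) by (auto simp: in_segment)
qed

text \<open>Two geodesics cross iff the endpoints of one lie strictly on different sides of the other. If they
  do, the point dividing the second chord in the ratio of the two orientations lies on both.
  If they meet, the vanishing of the orientation at the meeting point forces opposite
  signs, or makes both endpoints of the second lie on the first line.\<close>

lemma geodesic_cross_iff:
  assumes "p \<in> S1" "q \<in> S1" "p \<noteq> q" "r \<in> S1" "s \<in> S1" "r \<noteq> s"
  shows "(geodesic p q = geodesic r s \<or> disjnt (geodesic p q) (geodesic r s))
     \<longleftrightarrow> 0 \<le> orient p q r * orient p q s" (is "?compat \<longleftrightarrow> _")
proof
  assume ?compat
  then show "0 \<le> orient p q r * orient p q s"
  proof
    assume eq: "geodesic p q = geodesic r s"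
    then have "r = p \<or> r = q"
      using assms by (auto simp: doubleton_eq_iff)
    then show ?thesis by auto
  next
    assume dis: "disjnt (geodesic p q) (geodesic r s)"
    show ?thesis
    proof (rule ccontr)
      define x y where "x = orient p q r" and "y = orient p q s"
      assume "\<not> 0 \<le> orient p q r * orient p q s"
      then have xy: "x * y < 0" by (simp add: x_def y_def)
      then have "x \<noteq> y" by (auto simp: not_less)
      define u where "u = x / (x - y)"
      have u: "0 < u" "u < 1"
        using xy by (auto simp: u_def field_simps mult_less_0_iff)
      define z where "z = (1 - u) *\<^sub>R r + u *\<^sub>R s"
      have zrs: "z \<in> geodesic r s"
        using u assms by (auto simp: z_def in_segment)
      have "orient p q z = (1 - u) * x + u * y"
        by (simp add: z_def orient_affine x_def y_def)
      also have "\<dots> = 0"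
        using \<open>x \<noteq> y\<close> by (simp add: u_def field_simps)
      finally have "z \<in> geodesic p q"
        using geodesic_norm_less [OF zrs] assms by (intro mem_geodesicI) auto
      then show False
        using zrs dis by (auto simp: disjnt_iff)
    qed
  qed
next
  assume nn: "0 \<le> orient p q r * orient p q s"
  show ?compat
  proof (rule ccontr)
    assume neg: "\<not> ?compat"
    then obtain z where z: "z \<in> geodesic p q" "z \<in> geodesic r s"
      by (auto simp: disjnt_iff)
    obtain u where u: "0 < u" "u < 1" "z = (1 - u) *\<^sub>R r + u *\<^sub>R s"
      using z(2) by (auto simp: in_segment)
    have "(1 - u) * orient p q r + u * orient p q s = 0"
      using orient_on_geodesic [OF z(1)] u orient_affine by metis
    then have eq: "(1 - u) * orient p q r = - u * orient p q s"
      by simp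
    have "(1 - u) * (orient p q r * orient p q r) = - u * (orient p q r * orient p q s)"
      using eq by algebra
    also have "\<dots> \<le> 0"
      using u nn by simp
    finally have "orient p q r = 0"
      using u by (auto simp: mult_le_0_iff)
    moreover from this eq have "orient p q s = 0"
      using u by simp
    ultimately have "{r, s} = {p, q}"
      using orient_eq_0 assms by blast
    then show False
      using neg by (auto simp: doubleton_eq_iff open_segment_commute)
  qed
qed


text \<open>Equality is included because this is the relation that holds between any two members of a
  triangulation, so that maximality can be stated as closure under \<open>compat\<close>.\<close>

definition compat :: "complex set \<Rightarrow> complex set \<Rightarrow> bool" where
  "compat a b \<longleftrightarrow> a = b \<or> disjnt a b"

lemma compat_sym: "compat a b \<longleftrightarrow> compat b a"
  by (auto simp: compat_def disjnt_sym)

lemma compat_refl [simp]: "compat a a"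
  by (simp add: compat_def)

lemma compat_iff_orient:
  "\<lbrakk>p \<in> S1; q \<in> S1; p \<noteq> q; r \<in> S1; s \<in> S1; r \<noteq> s\<rbrakk>
    \<Longrightarrow> compat (geodesic p q) (geodesic r s) \<longleftrightarrow> 0 \<le> orient p q r * orient p q s"
  unfolding compat_def by (rule geodesic_cross_iff)

lemma geodesic_eqD:
  "\<lbrakk>geodesic p q = geodesic r s; p \<noteq> q\<rbrakk> \<Longrightarrow> p = r \<and> q = s \<or> p = s \<and> q = r"
  by (auto simp: doubleton_eq_iff)

text \<open>The three orientations are the barycentric coordinates multiplied by \<open>orient p q r\<close>.\<close>

lemma ideal_triangle_orient:
  assumes "0 < orient p q r"
  shows "ideal_triangle p q r
       = {z. 0 < orient p q z \<and> 0 < orient q r z \<and> 0 < orient r p z}" (is "_ = ?R")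
proof -
  define D where "D = orient p q r"
  have D: "D > 0" using assms by (simp add: D_def)
  have nc: "\<not> collinear {p, q, r}"
  proof
    assume "collinear {p, q, r}"
    then consider "p = r" | u where "q = u *\<^sub>R p + (1 - u) *\<^sub>R r"
      by (auto simp: collinear_3_expand)
    then show False
      using assms by cases (auto simp: orient_def algebra_simps)
  qed
  have bary: "orient q r z + orient r p z + orient p q z = D"
    "D *\<^sub>R z = orient q r z *\<^sub>R p + orient r p z *\<^sub>R q + orient p q z *\<^sub>R r" for z
    by (simp_all add: complex_eq_iff orient_def D_def algebra_simps)
  have comb: "orient p q z = c * D" "orient q r z = a * D" "orient r p z = b * D"
    if "a + b + c = 1" "z = a *\<^sub>R p + b *\<^sub>R q + c *\<^sub>R r" for a b c z
  proof -
    have a: "a = 1 - b - c" using that by simp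
    show "orient p q z = c * D" "orient q r z = a * D" "orient r p z = b * D"
      unfolding that(2) a by (simp_all add: orient_def D_def algebra_simps)
  qed
  have "ideal_triangle p q r = {v. \<exists>x y z. 0 < x \<and> 0 < y \<and> 0 < z \<and> x + y + z = 1
          \<and> x *\<^sub>R p + y *\<^sub>R q + z *\<^sub>R r = v}"
    unfolding ideal_triangle_def by (rule interior_convex_hull_3_minimal [OF nc]) simp
  also have "\<dots> = ?R"
  proof (intro equalityI subsetI)
    fix v assume "v \<in> ?R"
    then have *: "0 < orient p q v" "0 < orient q r v" "0 < orient r p v" by auto
    have "v = (1 / D) *\<^sub>R (D *\<^sub>R v)" using D by simp
    also have "\<dots> = (orient q r v / D) *\<^sub>R p + (orient r p v / D) *\<^sub>R q + (orient p q v / D) *\<^sub>R r"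
      unfolding bary(2) by (simp add: scaleR_add_right divide_inverse mult.commute)
    finally have "(orient q r v / D) *\<^sub>R p + (orient r p v / D) *\<^sub>R q + (orient p q v / D) *\<^sub>R r = v" ..
    moreover have "orient q r v / D + orient r p v / D + orient p q v / D = 1"
      using bary(1) [of v] D by (simp flip: add_divide_distrib)
    ultimately show "v \<in> {v. \<exists>x y z. 0 < x \<and> 0 < y \<and> 0 < z \<and> x + y + z = 1
          \<and> x *\<^sub>R p + y *\<^sub>R q + z *\<^sub>R r = v}"
      using * D by (blast intro: divide_pos_pos)
  qed (use comb D in auto)
  finally show ?thesis .
qed

lemma ideal_triangle_perm:
  "ideal_triangle q r p = ideal_triangle p q r" "ideal_triangle q p r = ideal_triangle p q r"
  by (simp_all add: ideal_triangle_def insert_commute)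

lemma open_ideal_triangle: "open (ideal_triangle p q r)"
  by (simp add: ideal_triangle_def)

lemma convex_ideal_triangle: "convex (ideal_triangle p q r)"
  by (simp add: ideal_triangle_def convex_interior)

lemma ideal_triangle_nonempty:
  assumes "0 < orient p q r"
  shows "ideal_triangle p q r \<noteq> {}"
proof -
  define z where "z = (p + q + r) /\<^sub>R 3"
  have "orient p q z = orient p q r / 3" "orient q r z = orient p q r / 3"
      "orient r p z = orient p q r / 3"
    by (simp_all add: z_def orient_def field_simps)
  then have "z \<in> ideal_triangle p q r"
    using assms by (simp add: ideal_triangle_orient)
  then show ?thesis by auto
qed

lemma ideal_triangle_subset_disc:
  assumes "p \<in> S1" "q \<in> S1" "r \<in> S1"
  shows "ideal_triangle p q r \<subseteq> disc"
proof -
  have "convex hull {p, q, r} \<subseteq> cball 0 1"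
    using assms by (intro hull_minimal) auto
  from interior_mono [OF this] show ?thesis
    by (simp add: ideal_triangle_def)
qed

lemma closure_ideal_triangle_orient:
  assumes "0 < orient p q r" "z \<in> closure (ideal_triangle p q r)"
  shows "0 \<le> orient p q z" "0 \<le> orient q r z" "0 \<le> orient r p z"
proof -
  let ?C = "{z. 0 \<le> orient p q z \<and> 0 \<le> orient q r z \<and> 0 \<le> orient r p z}"
  have "closed ?C"
    by (intro closed_Collect_conj closed_Collect_le continuous_intros)
  moreover have "ideal_triangle p q r \<subseteq> ?C"
    using assms(1) by (auto simp: ideal_triangle_orient)
  ultimately have "closure (ideal_triangle p q r) \<subseteq> ?C"
    by (rule closure_minimal [rotated])
  then show "0 \<le> orient p q z" "0 \<le> orient q r z" "0 \<le> orient r p z"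
    using assms(2) by auto
qed

lemma side_subset_closure:
  assumes "0 < orient p q r"
  shows "geodesic p q \<subseteq> closure (ideal_triangle p q r)"
proof -
  have "interior (convex hull {p, q, r}) \<noteq> {}"
    using ideal_triangle_nonempty [OF assms] by (simp add: ideal_triangle_def)
  then have "closure (ideal_triangle p q r) = closure (convex hull {p, q, r})"
    unfolding ideal_triangle_def
    by (intro convex_closure_interior) auto
  also have "\<dots> = convex hull {p, q, r}"
    by (simp add: finite_imp_compact_convex_hull)
  finally have "closure (ideal_triangle p q r) = convex hull {p, q, r}" .
  moreover have "closed_segment p q \<subseteq> convex hull {p, q, r}"
    unfolding segment_convex_hull by (intro hull_mono) auto
  ultimately show ?thesis
    using segment_open_subset_closed by blast
qed


section \<open>Regions of a family of arcs\<close>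

lemma dyadic_points_S1: "p \<in> dyadic_points \<Longrightarrow> p \<in> S1"
  unfolding dyadic_points_def using circ_in_S1 by blast

lemma arcsE:
  assumes "a \<in> arcs"
  obtains p q where "a = geodesic p q" "p \<in> dyadic_points" "q \<in> dyadic_points" "p \<noteq> q"
  using assms by (auto simp: arcs_def)

lemma arcs_S1E:
  assumes "a \<in> arcs"
  obtains p q where "a = geodesic p q" "p \<in> S1" "q \<in> S1" "p \<noteq> q"
  using assms arcsE dyadic_points_S1 by blast

lemma arcsI: "\<lbrakk>p \<in> dyadic_points; q \<in> dyadic_points; p \<noteq> q\<rbrakk> \<Longrightarrow> geodesic p q \<in> arcs"
  by (auto simp: arcs_def)

text \<open>A geodesic that crosses no side of a triangle does not enter it. If it met the triangle, both of
  its endpoints would lie on the closed inner side of all three sides. The only such points of the circle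
  are the vertices, so the geodesic would be a side.\<close>

lemma geodesic_disjnt_ideal_triangle:
  assumes or: "0 < orient p q r" and S1: "p \<in> S1" "q \<in> S1" "r \<in> S1" "u \<in> S1" "t \<in> S1" "u \<noteq> t"
    and c: "compat (geodesic u t) (geodesic p q)" "compat (geodesic u t) (geodesic q r)"
      "compat (geodesic u t) (geodesic r p)"
  shows "geodesic u t \<inter> ideal_triangle p q r = {}"
proof (rule ccontr)
  assume "\<not> ?thesis"
  then obtain z where z: "z \<in> geodesic u t" "z \<in> ideal_triangle p q r" by auto
  then obtain l where l: "0 < l" "l < 1" "z = (1 - l) *\<^sub>R u + l *\<^sub>R t"
    by (auto simp: in_segment)
  have pqr: "p \<noteq> q" "q \<noteq> r" "r \<noteq> p"
    using or by auto
  have nn: "0 \<le> x \<and> 0 \<le> y" if "0 \<le> x * y" "0 < (1 - l) * x + l * y" for x y :: real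
  proof (rule ccontr)
    assume "\<not> (0 \<le> x \<and> 0 \<le> y)"
    then have "x \<le> 0" "y \<le> 0"
      using that(1) by (auto simp: zero_le_mult_iff)
    then have "(1 - l) * x \<le> 0" "l * y \<le> 0"
      using l by (simp_all add: mult_nonneg_nonpos)
    then show False using that(2) by linarith
  qed
  have side: "0 \<le> orient a b u \<and> 0 \<le> orient a b t"
    if "compat (geodesic u t) (geodesic a b)" "0 < orient a b z" "a \<in> S1" "b \<in> S1" "a \<noteq> b" for a b
  proof (rule nn)
    show "0 \<le> orient a b u * orient a b t"
      using that S1 by (simp add: compat_sym [of "geodesic u t"] compat_iff_orient)
    show "0 < (1 - l) * orient a b u + l * orient a b t"
      using that(2) by (simp add: l orient_affine)
  qed
  have z3: "0 < orient p q z" "0 < orient q r z" "0 < orient r p z"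
    using z(2) by (simp_all add: ideal_triangle_orient [OF or])
  have vertex: "x \<in> {p, q, r}"
    if x: "x \<in> S1" "0 \<le> orient p q x" "0 \<le> orient q r x" "0 \<le> orient r p x" for x
  proof (rule ccontr)
    assume "x \<notin> {p, q, r}"
    then have x3: "0 < orient p q x" "0 < orient q r x" "0 < orient r p x"
      using x orient_eq_0 S1 pqr
      by (metis insertCI less_eq_real_def)+
    obtain a where a: "p = circ a"
      using S1(1) by (rule circ_lift)
    obtain b c where bc: "q = circ b" "r = circ c" "a < b" "b < c" "c < a + 1"
      using orient_pos_lifts [OF a S1(2,3) or] by metis
    obtain d where d: "a \<le> d" "d < a + 1" "x = circ d"
      using x(1) by (rule circ_lift)
    have "d \<noteq> a" "d \<noteq> b" "d \<noteq> c"
      using \<open>x \<notin> {p, q, r}\<close> a bc d by auto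
    then consider "a < d" "d < b" | "b < d" "d < c" | "c < d" "d < a + 1"
      using d by linarith
    then show False
    proof cases
      case 1
      then show False
        using orient_circ_neg [of a d b] x3 a bc d by simp
    next
      case 2
      then show False
        using orient_circ_neg [of b d c] x3 a bc d by simp
    next
      case 3
      then show False
        using orient_circ_neg [of c d "a + 1"] x3 a bc d by simp
    qed
  qed
  have "u \<in> {p, q, r}" "t \<in> {p, q, r}"
    using vertex S1 side [OF c(1) z3(1)] side [OF c(2) z3(2)] side [OF c(3) z3(3)] pqr by auto
  then have "orient p q z = 0 \<or> orient q r z = 0 \<or> orient r p z = 0"
    using orient_on_geodesic [OF z(1)] S1(6) orient_swap [of p q z] orient_swap [of q r z]
      orient_swap [of r p z]
    by auto
  then show False
    using z3 by auto
qed

text \<open>A geodesic that crosses a side enters the triangle immediately next to the crossing point.\<close>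

lemma compat_side_of_disjoint_triangle:
  assumes or: "0 < orient p q r" and S1: "p \<in> S1" "q \<in> S1" "r \<in> S1" "u \<in> S1" "t \<in> S1" "u \<noteq> t"
    and dis: "geodesic u t \<inter> ideal_triangle p q r = {}"
  shows "compat (geodesic u t) (geodesic p q)"
proof (rule ccontr)
  assume nc: "\<not> compat (geodesic u t) (geodesic p q)"
  have pq: "p \<noteq> q" using or by auto
  have main: False
    if S1: "u \<in> S1" "t \<in> S1" "u \<noteq> t" and nc: "\<not> compat (geodesic u t) (geodesic p q)"
      and dis: "geodesic u t \<inter> ideal_triangle p q r = {}"
      and pos: "0 < orient p q t" for u t
  proof -
    obtain z where z: "z \<in> geodesic u t" "z \<in> geodesic p q"
      using nc by (auto simp: compat_def disjnt_iff)
    obtain l where l: "0 < l" "l < 1" "z = (1 - l) *\<^sub>R p + l *\<^sub>R q"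
      using z(2) by (auto simp: in_segment)
    have "orient q r z = (1 - l) * orient p q r" "orient r p z = l * orient p q r"
      using orient_cycle [of q r p] orient_cycle [of p q r]
      by (simp_all add: l orient_affine)
    then have z3: "0 < orient q r z" "0 < orient r p z" "orient p q z = 0"
      using l or orient_on_geodesic [OF z(2)] by simp_all
    define U where "U = {x. 0 < orient q r x \<and> 0 < orient r p x}"
    have "open U"
      unfolding U_def by (intro open_Collect_conj open_Collect_less continuous_intros)
    have "z \<in> U" using z3 by (simp add: U_def)
    have "((\<lambda>e. (1 - e) *\<^sub>R z + e *\<^sub>R t) \<longlongrightarrow> (1 - 0) *\<^sub>R z + 0 *\<^sub>R t) (at_right (0::real))"
      by (intro tendsto_intros)
    then have "\<forall>\<^sub>F e in at_right 0. (1 - e) *\<^sub>R z + e *\<^sub>R t \<in> U"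
      using \<open>open U\<close> \<open>z \<in> U\<close> by (auto dest!: topological_tendstoD)
    moreover have "\<forall>\<^sub>F e in at_right (0::real). 0 < e \<and> e < 1"
      by (auto simp: eventually_at_right_field intro!: exI[of _ 1])
    ultimately have "\<forall>\<^sub>F e in at_right 0. (1 - e) *\<^sub>R z + e *\<^sub>R t \<in> U \<and> 0 < e \<and> e < 1"
      by eventually_elim auto
    then obtain e where e: "(1 - e) *\<^sub>R z + e *\<^sub>R t \<in> U" "0 < e" "e < 1"
      using eventually_happens' [OF trivial_limit_at_right_real] by blast
    let ?y = "(1 - e) *\<^sub>R z + e *\<^sub>R t"
    have "0 < orient p q ?y"
      using z3 e pos by (simp add: orient_affine)
    then have "?y \<in> ideal_triangle p q r"
      using e by (simp add: ideal_triangle_orient [OF or] U_def)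
    moreover have "?y \<in> geodesic u t"
    proof -
      obtain m where m: "0 < m" "m < 1" "z = (1 - m) *\<^sub>R u + m *\<^sub>R t"
        using z(1) by (auto simp: in_segment)
      have "?y = (1 - (m + e * (1 - m))) *\<^sub>R u + (m + e * (1 - m)) *\<^sub>R t"
        by (simp add: m algebra_simps)
      moreover have "0 < m + e * (1 - m)"
        using m e by (simp add: add_pos_pos)
      moreover have "0 < (1 - m) * (1 - e)"
        using m e by simp
      then have "m + e * (1 - m) < 1"
        by (simp add: algebra_simps)
      ultimately show ?thesis
        using S1 by (auto simp only: in_segment)
    qed
    ultimately show False
      using dis by blast
  qed
  have "orient p q u * orient p q t < 0"
    using nc S1 pq by (simp add: compat_sym [of "geodesic u t"] compat_iff_orient)
  then have "0 < orient p q t \<or> 0 < orient p q u"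
    by (auto simp: mult_less_0_iff)
  then show False
    using main [of u t] main [of t u] nc dis S1 by (auto simp: open_segment_commute)
qed

text \<open>An ideal triangle avoiding \<open>\<Union>w\<close> is a component of the complement as soon as its three sides are
  covered by \<open>\<Union>w\<close>, because it is then open and closed in every connected set between it and the
  complement. Conversely a component is closed in the complement, so a point of a side outside
  \<open>\<Union>w\<close> would have to belong to the open triangle.\<close>

lemma triangle_component_iff:
  assumes or: "0 < orient p q r" and S1: "p \<in> S1" "q \<in> S1" "r \<in> S1"
  shows "ideal_triangle p q r \<in> regions w \<longleftrightarrow>
     geodesic p q \<subseteq> \<Union>w \<and> geodesic q r \<subseteq> \<Union>w \<and> geodesic r p \<subseteq> \<Union>w \<and>
     ideal_triangle p q r \<inter> \<Union>w = {}" (is "?L \<longleftrightarrow> ?R")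
proof
  let ?T = "ideal_triangle p q r" and ?S = "disc - \<Union>w"
  have rot: "0 < orient q r p" "0 < orient r p q"
    using or orient_cycle [of q r p] orient_cycle [of p q r] by simp_all
  have rotT: "ideal_triangle q r p = ?T" "ideal_triangle r p q = ?T"
    using ideal_triangle_perm(1) [of p q r] ideal_triangle_perm(1) [of q r p] by simp_all
  { assume L: ?L
    then have comp: "?T \<in> components ?S" by (simp add: regions_def)
    then have sub: "?T \<subseteq> ?S" by (rule in_components_subset)
    obtain K where K: "closed K" "?T = ?S \<inter> K"
      using closedin_component [OF comp] unfolding closedin_closed by blast
    then have "closure ?T \<subseteq> K"
      by (intro closure_minimal) blast+
    then have cl: "closure ?T \<inter> ?S \<subseteq> ?T"
      using K(2) by blast
    have T: "z \<in> ?T \<longleftrightarrow> 0 < orient p q z \<and> 0 < orient q r z \<and> 0 < orient r p z" for z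
      by (simp add: ideal_triangle_orient [OF or])
    have side: "geodesic a b \<subseteq> \<Union>w"
      if ab: "a \<in> S1" "b \<in> S1" "geodesic a b \<subseteq> closure ?T"
        "\<And>z. z \<in> ?T \<Longrightarrow> 0 < orient a b z" for a b
    proof (rule subsetI, rule ccontr)
      fix z assume z: "z \<in> geodesic a b" "z \<notin> \<Union>w"
      then have "z \<in> closure ?T \<inter> ?S"
        using ab(3) geodesic_norm_less [OF z(1) ab(1,2)] by (simp add: subset_iff)
      then have "z \<in> ?T"
        using cl by (rule rev_subsetD)
      then show False
        using ab(4) orient_on_geodesic [OF z(1)] by force
    qed
    have "geodesic p q \<subseteq> \<Union>w"
      by (rule side) (use side_subset_closure [OF or] S1 T in simp_all)
    moreover have "geodesic q r \<subseteq> \<Union>w"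
      by (rule side) (use side_subset_closure [OF rot(1), unfolded rotT] S1 T in simp_all)
    moreover have "geodesic r p \<subseteq> \<Union>w"
      by (rule side) (use side_subset_closure [OF rot(2), unfolded rotT] S1 T in simp_all)
    ultimately show ?R
      using sub by auto
  next
    assume R: ?R
    have sub: "?T \<subseteq> ?S"
      using R ideal_triangle_subset_disc [OF S1] by auto
    have "d = ?T" if d: "?T \<subseteq> d" "d \<subseteq> ?S" "connected d" for d
    proof -
      have "closure ?T \<inter> d \<subseteq> ?T"
      proof
        fix z assume z: "z \<in> closure ?T \<inter> d"
        then have nn: "0 \<le> orient p q z" "0 \<le> orient q r z" "0 \<le> orient r p z"
          using closure_ideal_triangle_orient [OF or] by auto
        have "z \<notin> \<Union>w" "cmod z < 1"
          using z d(2) by auto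
        moreover have "p \<noteq> q" "q \<noteq> r" "r \<noteq> p"
          using or by auto
        ultimately have "orient p q z \<noteq> 0" "orient q r z \<noteq> 0" "orient r p z \<noteq> 0"
          using mem_geodesicI S1 R by blast+
        then show "z \<in> ?T"
          using nn by (simp add: ideal_triangle_orient [OF or])
      qed
      then have "?T = d \<inter> closure ?T"
        using d(1) closure_subset by blast
      then have "closedin (top_of_set d) ?T"
        using closedin_closed_Int [OF closed_closure, of d ?T] by simp
      moreover have "openin (top_of_set d) ?T"
        using d(1) by (intro open_subset open_ideal_triangle)
      ultimately show ?thesis
        using d(3) ideal_triangle_nonempty [OF or] unfolding connected_clopen by blast
    qed
    then show ?L
      unfolding regions_def in_components_maximal
      by (intro conjI allI impI sub ideal_triangle_nonempty [OF or]
          convex_connected [OF convex_ideal_triangle]) blast }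
qed

text \<open>For arcs that do not cross, covered sides are members: an arc of the family through a point of a
  side is disjoint from the triangle, hence cannot cross the side, and so equals it.\<close>

lemma triangle_region_iff:
  assumes or: "orient p q r \<noteq> 0" and S1: "p \<in> S1" "q \<in> S1" "r \<in> S1"
    and w: "w \<subseteq> arcs" "\<And>a b. \<lbrakk>a \<in> w; b \<in> w\<rbrakk> \<Longrightarrow> compat a b"
  shows "ideal_triangle p q r \<in> regions w \<longleftrightarrow>
     geodesic p q \<in> w \<and> geodesic q r \<in> w \<and> geodesic r p \<in> w"
proof -
  have pos: "ideal_triangle p q r \<in> regions w \<longleftrightarrow>
     geodesic p q \<in> w \<and> geodesic q r \<in> w \<and> geodesic r p \<in> w"
    if or: "0 < orient p q r" and S1: "p \<in> S1" "q \<in> S1" "r \<in> S1" for p q r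
  proof
    have rot: "0 < orient q r p" "0 < orient r p q"
      using or orient_cycle [of q r p] orient_cycle [of p q r] by simp_all
    have rotT: "ideal_triangle q r p = ideal_triangle p q r"
      "ideal_triangle r p q = ideal_triangle p q r"
      using ideal_triangle_perm(1) [of p q r] ideal_triangle_perm(1) [of q r p] by simp_all
    { assume "ideal_triangle p q r \<in> regions w"
      then have R: "geodesic p q \<subseteq> \<Union>w" "geodesic q r \<subseteq> \<Union>w" "geodesic r p \<subseteq> \<Union>w"
          "ideal_triangle p q r \<inter> \<Union>w = {}"
        using triangle_component_iff [OF or S1] by auto
      have side: "geodesic a b \<in> w"
        if ab: "geodesic a b \<subseteq> \<Union>w" "0 < orient a b c" "a \<in> S1" "b \<in> S1" "c \<in> S1"
          "ideal_triangle a b c \<inter> \<Union>w = {}" for a b c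
      proof -
        have "a \<noteq> b" using ab(2) by auto
        then obtain z where z: "z \<in> geodesic a b"
          by (metis all_not_in_conv open_segment_eq_empty)
        then obtain x where x: "x \<in> w" "z \<in> x"
          using ab(1) by blast
        then obtain u t where ut: "x = geodesic u t" "u \<in> S1" "t \<in> S1" "u \<noteq> t"
          using w(1) by (blast elim: arcs_S1E)
        have "compat x (geodesic a b)"
          unfolding ut(1)
        proof (rule compat_side_of_disjoint_triangle [of a b c])
          show "geodesic u t \<inter> ideal_triangle a b c = {}"
            using ab(6) x(1) unfolding ut(1) by blast
        qed (fact ab ut)+
        then show ?thesis
          using x z by (auto simp: compat_def disjnt_iff)
      qed
      show "geodesic p q \<in> w \<and> geodesic q r \<in> w \<and> geodesic r p \<in> w"
        using side [OF R(1) or] side [OF R(2) rot(1)] side [OF R(3) rot(2)] S1 R(4)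
        by (simp add: rotT)
    next
      assume sides: "geodesic p q \<in> w \<and> geodesic q r \<in> w \<and> geodesic r p \<in> w"
      have "x \<inter> ideal_triangle p q r = {}" if "x \<in> w" for x
      proof -
        obtain u t where ut: "x = geodesic u t" "u \<in> S1" "t \<in> S1" "u \<noteq> t"
          using w(1) \<open>x \<in> w\<close> by (blast elim: arcs_S1E)
        show ?thesis
          unfolding ut(1)
        proof (rule geodesic_disjnt_ideal_triangle [OF or S1 ut(2-4)])
          show "compat (geodesic u t) (geodesic p q)" "compat (geodesic u t) (geodesic q r)"
            "compat (geodesic u t) (geodesic r p)"
            using w(2) that sides unfolding ut(1) by blast+
        qed
      qed
      then show "ideal_triangle p q r \<in> regions w"
        unfolding triangle_component_iff [OF or S1] using sides by blast }
  qed
  show ?thesis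
  proof (cases "0 < orient p q r")
    case False
    then have "0 < orient q p r"
      using or orient_swap [of p q r] by simp
    from pos [OF this S1(2,1,3)] show ?thesis
      by (auto simp: ideal_triangle_perm(2) open_segment_commute)
  next
    case True
    then show ?thesis
      using pos [OF _ S1] by simp
  qed
qed


section \<open>Chords between lifted endpoints\<close>

abbreviation chord :: "real \<Rightarrow> real \<Rightarrow> complex set" where
  "chord x y \<equiv> geodesic (circ x) (circ y)"

lemma orient_inside:
  assumes "x < z" "z < x + 1" "x \<le> a" "a \<le> z"
  shows "orient (circ x) (circ z) (circ a) \<le> 0"
  using orient_circ_neg [of x a z] assms by (cases "a = x \<or> a = z") auto

lemma orient_outside:
  assumes "x < z" "z < x + 1" "z \<le> a" "a \<le> x + 1"
  shows "0 \<le> orient (circ x) (circ z) (circ a)"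
  using orient_circ_pos [of x z a] assms by (cases "a = x + 1 \<or> a = z") auto

lemma compat_inside:
  assumes "x < z" "z < x + 1" "x \<le> a" "a \<le> z" "x \<le> b" "b \<le> z"
  shows "compat (chord x z) (chord a b)"
proof (cases "circ a = circ b")
  case False
  then have "compat (chord x z) (chord a b) \<longleftrightarrow>
      0 \<le> orient (circ x) (circ z) (circ a) * orient (circ x) (circ z) (circ b)"
    using circ_neq [OF assms(1,2)] by (intro compat_iff_orient circ_in_S1)
  then show ?thesis
    using mult_nonpos_nonpos [OF orient_inside [OF assms(1-4)] orient_inside [OF assms(1,2,5,6)]]
    by blast
qed (simp add: compat_def)

lemma compat_outside:
  assumes "x < z" "z < x + 1" "z \<le> a" "a \<le> x + 1" "z \<le> b" "b \<le> x + 1"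
  shows "compat (chord x z) (chord a b)"
proof (cases "circ a = circ b")
  case False
  then have "compat (chord x z) (chord a b) \<longleftrightarrow>
      0 \<le> orient (circ x) (circ z) (circ a) * orient (circ x) (circ z) (circ b)"
    using circ_neq [OF assms(1,2)] by (intro compat_iff_orient circ_in_S1)
  then show ?thesis
    using mult_nonneg_nonneg [OF orient_outside [OF assms(1-4)] orient_outside [OF assms(1,2,5,6)]]
    by blast
qed (simp add: compat_def)

lemma not_compat_cross:
  assumes "x < a" "a < z" "z < b" "b < x + 1"
  shows "\<not> compat (chord x z) (chord a b)"
proof -
  have "orient (circ x) (circ z) (circ a) < 0" "0 < orient (circ x) (circ z) (circ b)"
    using assms by (auto intro: orient_circ_neg orient_circ_pos)
  then have "orient (circ x) (circ z) (circ a) * orient (circ x) (circ z) (circ b) < 0"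
    by (rule mult_neg_pos)
  moreover have "circ x \<noteq> circ z" "circ a \<noteq> circ b"
    by (rule circ_neq; use assms in linarith)+
  ultimately show ?thesis
    by (subst compat_iff_orient) auto
qed

text \<open>A geodesic crossing a chord can be lifted with one endpoint in each of the two open intervals that
  the chord cuts out of a period.\<close>

lemma not_compatE:
  assumes "\<not> compat (chord x z) (geodesic u t)" "x < z" "z < x + 1" "u \<in> S1" "t \<in> S1"
  obtains a b where "x < a" "a < z" "z < b" "b < x + 1"
    "u = circ a \<and> t = circ b \<or> u = circ b \<and> t = circ a"
proof -
  obtain a where a: "x \<le> a" "a < x + 1" "u = circ a"
    using assms(4) by (rule circ_lift)
  obtain b where b: "x \<le> b" "b < x + 1" "t = circ b"
    using assms(5) by (rule circ_lift)
  have "\<not> (a \<le> z \<and> b \<le> z)"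
    using assms a b compat_inside [of x z a b] by auto
  moreover have "\<not> (z \<le> a \<and> z \<le> b)"
    using assms a b compat_outside [of x z a b] by auto
  moreover have "a \<noteq> x"
    using assms a b compat_inside [of x z x b] compat_outside [of x z "x + 1" b]
    by (cases "b \<le> z") auto
  moreover have "b \<noteq> x"
    using assms a b compat_inside [of x z a x] compat_outside [of x z a "x + 1"]
    by (cases "a \<le> z") auto
  moreover have "a \<noteq> z" "b \<noteq> z"
    using calculation by linarith+
  ultimately have "a < z \<and> z < b \<and> x < a \<or> b < z \<and> z < a \<and> x < b"
    using a b by linarith
  then show thesis
    using that a b by blast
qed


section \<open>Levels and standard arcs\<close>

text \<open>Indices are arbitrary integers, not residues modulo \<open>2 ^ n\<close>, so that no case distinction is
  needed where an interval passes through the base point of the circle.\<close>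

definition grid :: "nat \<Rightarrow> int \<Rightarrow> real" where
  "grid n k = of_int k / 2 ^ n"

definition level :: "nat \<Rightarrow> complex set" where
  "level n = range (\<lambda>k. circ (grid n k))"

definition std_arc :: "nat \<Rightarrow> int \<Rightarrow> complex set" where
  "std_arc n k = chord (grid n k) (grid n (k + 1))"

lemma grid_less [simp]: "grid n j < grid n k \<longleftrightarrow> j < k"
  by (simp add: grid_def divide_less_cancel)

lemma grid_le [simp]: "grid n j \<le> grid n k \<longleftrightarrow> j \<le> k"
  by (simp add: grid_def divide_le_cancel)

lemma grid_add_1 [simp]: "grid n k + 1 = grid n (k + 2 ^ n)" "1 + grid n k = grid n (k + 2 ^ n)"
  by (simp_all add: grid_def add_divide_distrib)

lemma grid_refine: "grid (n + j) (k * 2 ^ j) = grid n k"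
  by (simp add: grid_def power_add)

lemma grid_Suc: "grid (Suc n) (2 * k) = grid n k"
  by (simp add: grid_def)

lemma circ_grid_shift: "circ (grid n (k + j * 2 ^ n)) = circ (grid n k)"
proof -
  have "grid n (k + j * 2 ^ n) = grid n k + of_int j"
    by (simp add: grid_def add_divide_distrib)
  then show ?thesis by simp
qed

lemma circ_grid_period [simp]: "circ (grid n (k + 2 ^ n)) = circ (grid n k)"
  using circ_grid_shift [of n k 1] by simp

lemma std_arc_shift: "std_arc n (k + j * 2 ^ n) = std_arc n k"
  using circ_grid_shift [of n k j] circ_grid_shift [of n "k + 1" j]
  by (simp add: std_arc_def algebra_simps)

text \<open>The start \<open>c\<close> of the window of indices is free; it is chosen next to the points under
  consideration.\<close>

lemma grid_lift:
  assumes "p \<in> level n"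
  obtains k where "c \<le> k" "k < c + 2 ^ n" "p = circ (grid n k)"
proof -
  obtain j where j: "p = circ (grid n j)"
    using assms by (auto simp: level_def)
  let ?k = "c + (j - c) mod 2 ^ n"
  have "?k = j + (- ((j - c) div 2 ^ n)) * 2 ^ n"
    using div_mult_mod_eq [of "j - c" "2 ^ n"] by (simp add: algebra_simps)
  then have "p = circ (grid n ?k)"
    unfolding j by (simp only: circ_grid_shift)
  then show thesis
    using that [of ?k] by simp
qed

lemma circ_grid_neq: "\<lbrakk>j < k; k < j + 2 ^ n\<rbrakk> \<Longrightarrow> circ (grid n j) \<noteq> circ (grid n k)"
  by (rule circ_neq) auto

lemma circ_grid_dyadic [simp]: "circ (grid n k) \<in> dyadic_points"
  by (auto simp: dyadic_points_def dyadic_def grid_def)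

lemma level_subset_dyadic: "level n \<subseteq> dyadic_points"
  by (auto simp: level_def)

lemma level_mono: "m \<le> n \<Longrightarrow> level m \<subseteq> level n"
proof
  fix p assume "m \<le> n" "p \<in> level m"
  then obtain k where "p = circ (grid m k)"
    by (auto simp: level_def)
  then have "p = circ (grid (m + (n - m)) (k * 2 ^ (n - m)))"
    by (simp only: grid_refine)
  also have "m + (n - m) = n"
    using \<open>m \<le> n\<close> by simp
  finally show "p \<in> level n"
    unfolding level_def by blast
qed

lemma dyadic_level:
  assumes "p \<in> dyadic_points"
  obtains n where "p \<in> level n"
  using assms by (auto simp: dyadic_points_def dyadic_def level_def grid_def)

lemma dyadic_level2:
  assumes "p \<in> dyadic_points" "q \<in> dyadic_points"
  obtains j where "p \<in> level (n + j)" "q \<in> level (n + j)"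
proof -
  obtain a b where "p \<in> level a" "q \<in> level b"
    using assms by (meson dyadic_level)
  moreover have "level a \<subseteq> level (n + max a b)" "level b \<subseteq> level (n + max a b)"
    by (intro level_mono; simp)+
  ultimately have "p \<in> level (n + max a b)" "q \<in> level (n + max a b)"
    by blast+
  then show thesis using that by blast
qed

lemma finite_level: "finite (level n)"
proof -
  have "level n \<subseteq> (\<lambda>k. circ (grid n k)) ` {0..<2 ^ n}"
    by (auto elim!: grid_lift [where c = 0])
  then show ?thesis
    by (rule finite_subset) simp
qed

lemma two_power_int_ge: "1 \<le> n \<Longrightarrow> (2::int) \<le> 2 ^ n"
  using power_increasing [of 1 n "2::int"] by simp

lemma std_arc_in_arcs:
  assumes "1 \<le> n"
  shows "std_arc n k \<in> arcs"
  unfolding std_arc_def using two_power_int_ge [OF assms]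
  by (intro arcsI circ_grid_dyadic circ_grid_neq) auto

lemma base_triangulation_eq: "base_triangulation = {std_arc n k | n k. 1 \<le> n}"
proof
  show "base_triangulation \<subseteq> {std_arc n k | n k. 1 \<le> n}"
  proof
    fix a assume "a \<in> base_triangulation"
    then obtain n k where nk: "1 \<le> n" "a = base_arc n k"
      by (auto simp: base_triangulation_def)
    then have "a = std_arc n (int k)"
      by (simp add: base_arc_def std_arc_def grid_def)
    then show "a \<in> {std_arc n k | n k. 1 \<le> n}"
      using nk by blast
  qed
  show "{std_arc n k | n k. 1 \<le> n} \<subseteq> base_triangulation"
  proof clarify
    fix n :: nat and k :: int assume n: "1 \<le> n"
    define j where "j = nat (k mod 2 ^ n)"
    have "int j < int (2 ^ n)"
      by (simp add: j_def)
    then have le: "j \<le> 2 ^ n - 1"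
      by linarith
    have "std_arc n k = std_arc n (k mod 2 ^ n + (k div 2 ^ n) * 2 ^ n)"
      by (simp only: mod_div_mult_eq)
    also have "\<dots> = std_arc n (int j)"
      unfolding std_arc_shift by (simp add: j_def)
    also have "\<dots> = base_arc n j"
      by (simp add: base_arc_def std_arc_def grid_def)
    finally show "std_arc n k \<in> base_triangulation"
      using n le by (auto simp: base_triangulation_def)
  qed
qed

lemma compat_std_arc_grid:
  assumes "1 \<le> m" "m \<le> n"
  shows "compat (std_arc m b) (std_arc n c)"
proof -
  define d :: int where "d = 2 ^ (n - m)"
  have d: "1 \<le> d" by (simp add: d_def)
  have dm: "d * 2 ^ m = 2 ^ n"
    using assms by (simp add: d_def flip: power_add)
  have e: "grid m k = grid n (k * d)" for k
    using grid_refine [of m "n - m" k] assms by (simp add: d_def)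
  have "circ (grid n c) \<in> level n" by (auto simp: level_def)
  define c' where "c' = b * d + (c - b * d) mod 2 ^ n"
  have c': "b * d \<le> c'" "c' < b * d + 2 ^ n"
    by (simp_all add: c'_def)
  have "c = c' + ((c - b * d) div 2 ^ n) * 2 ^ n"
    using div_mult_mod_eq [of "c - b * d" "2 ^ n"] unfolding c'_def by linarith
  then have std: "std_arc n c = chord (grid n c') (grid n (c' + 1))"
    by (metis std_arc_shift std_arc_def)
  have less: "grid n (b * d) < grid n ((b + 1) * d)" "grid n ((b + 1) * d) < grid n (b * d) + 1"
  proof -
    show "grid n (b * d) < grid n ((b + 1) * d)"
      using d unfolding grid_less by (simp add: algebra_simps)
    have "d * 2 \<le> d * 2 ^ m"
      using two_power_int_ge [OF assms(1)] d by (intro mult_left_mono) auto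
    then have "d < 2 ^ n"
      using dm d by linarith
    then show "grid n ((b + 1) * d) < grid n (b * d) + 1"
      unfolding grid_add_1(1) grid_less by (simp add: algebra_simps)
  qed
  have "compat (chord (grid n (b * d)) (grid n ((b + 1) * d))) (chord (grid n c') (grid n (c' + 1)))"
  proof (cases "c' < (b + 1) * d")
    case True
    then show ?thesis
      using c' by (intro compat_inside less) (simp_all add: algebra_simps)
  next
    case False
    then show ?thesis
      using c' by (intro compat_outside less) (simp_all add: algebra_simps)
  qed
  then show ?thesis
    by (simp only: std std_arc_def [of m b] e)
qed

lemma compat_std_arc: "\<lbrakk>1 \<le> m; 1 \<le> n\<rbrakk> \<Longrightarrow> compat (std_arc m b) (std_arc n c)"
  using compat_std_arc_grid compat_sym nat_le_linear by meson

text \<open>If all standard arcs of level at least \<open>n\<close> belong to \<open>v\<close>, an arc crossing none of them is one of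
  them or joins points of level \<open>n\<close>. The reason is that an endpoint of level \<open>n + j + 1\<close> that is
  not of level \<open>n + j\<close> is the midpoint of a standard interval of level \<open>n + j\<close>. The standard arc over
  this interval confines the arc to one of its two halves. Induction on \<open>j\<close> then lowers the level.\<close>

lemma std_arc_or_level:
  assumes std: "\<And>m k. n \<le> m \<Longrightarrow> std_arc m k \<in> v"
    and n: "1 \<le> n" and a: "geodesic p q \<in> arcs" "\<And>b. b \<in> v \<Longrightarrow> compat (geodesic p q) b"
    and pq: "p \<in> dyadic_points" "q \<in> dyadic_points" "p \<noteq> q"
  shows "(\<exists>m\<ge>n. \<exists>k. geodesic p q = std_arc m k) \<or> p \<in> level n \<and> q \<in> level n"
proof -
  obtain j where "p \<in> level (n + j)" "q \<in> level (n + j)"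
    using dyadic_level2 pq by blast
  then show ?thesis
  proof (induction j)
    case (Suc j)
    let ?M = "n + Suc j"
    have step: "\<exists>m\<ge>n. \<exists>k. geodesic p q = std_arc m k"
      if c: "\<And>b. b \<in> v \<Longrightarrow> compat (geodesic p q) b" and "p \<noteq> q" "p \<in> level ?M" "q \<in> level ?M" "p \<notin> level (n + j)" for p q
    proof -
      obtain a where a: "p = circ (grid ?M a)"
        using \<open>p \<in> level ?M\<close> unfolding level_def by blast
      \<comment> \<open>otherwise \<open>p\<close> would already have level \<open>n + j\<close>\<close>
      have "odd a"
      proof
        assume "even a"
        then obtain a' where "a = 2 * a'" by blast
        then have "p = circ (grid (n + j) a')"
          using a grid_Suc [of "n + j"] by simp
        then show False
          using \<open>p \<notin> level (n + j)\<close> by (auto simp: level_def)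
      qed
      then obtain a' where a': "a = 2 * a' + 1" by (elim oddE)
      obtain b where b: "a - 1 \<le> b" "b < a - 1 + 2 ^ ?M" "q = circ (grid ?M b)"
        using \<open>q \<in> level ?M\<close> by (rule grid_lift)
      have std_a: "std_arc (n + j) a' = chord (grid ?M (a - 1)) (grid ?M (a + 1))"
        using grid_Suc [of "n + j" a'] grid_Suc [of "n + j" "a' + 1"]
        by (simp add: std_arc_def a' algebra_simps)
      have "\<not> a + 1 < b"
      proof
        assume "a + 1 < b"
        then have "\<not> compat (std_arc (n + j) a') (geodesic p q)"
          unfolding std_a a b(3) using b(2)
          by (intro not_compat_cross) simp_all
        then show False
          using c [OF std [of "n + j" a']] compat_sym by simp
      qed
      moreover have "b \<noteq> a"
        using \<open>p \<noteq> q\<close> a b by auto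
      ultimately have "b = a - 1 \<or> b = a + 1"
        using b by linarith
      then have "geodesic p q = std_arc ?M (a - 1) \<or> geodesic p q = std_arc ?M a"
        unfolding std_arc_def a b(3) by (auto simp: open_segment_commute)
      then show ?thesis
        by (metis le_add1)
    qed
    show ?case
    proof (cases "p \<in> level (n + j) \<and> q \<in> level (n + j)")
      case True
      then show ?thesis using Suc.IH by blast
    next
      case False
      then show ?thesis
        using step [of p q] step [of q p] a(2) pq(3) Suc.prems by (auto simp: open_segment_commute)
    qed
  qed auto
qed


section \<open>Maximal systems of arcs\<close>

text \<open>The combinatorial description of the vertices of the complex, see \<open>C_vertices_eq\<close>: maximal
  families of non-crossing arcs that agree with the base triangulation near the circle.\<close>

definition arc_system :: "complex set set \<Rightarrow> bool" where
  "arc_system v \<longleftrightarrow> v \<subseteq> arcs \<and> (\<forall>a \<in> v. \<forall>b \<in> v. compat a b) \<and>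
     (\<forall>a \<in> arcs. (\<forall>b \<in> v. compat a b) \<longrightarrow> a \<in> v) \<and>
     (\<exists>n\<ge>1. \<forall>m\<ge>n. \<forall>k. std_arc m k \<in> v)"

lemma arc_systemD:
  assumes "arc_system v"
  shows "v \<subseteq> arcs" "\<And>a b. \<lbrakk>a \<in> v; b \<in> v\<rbrakk> \<Longrightarrow> compat a b"
    "\<And>a. \<lbrakk>a \<in> arcs; \<And>b. b \<in> v \<Longrightarrow> compat a b\<rbrakk> \<Longrightarrow> a \<in> v"
  using assms by (auto simp: arc_system_def)

lemma arc_system_level:
  assumes "arc_system v"
  obtains n where "1 \<le> n" "N \<le> n" "\<And>m k. n \<le> m \<Longrightarrow> std_arc m k \<in> v"
proof -
  obtain n where "1 \<le> n" "\<And>m k. n \<le> m \<Longrightarrow> std_arc m k \<in> v"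
    using assms by (auto simp: arc_system_def)
  then show thesis
    using that [of "max n N"] by simp
qed

lemma arc_system_base: "arc_system base_triangulation"
  unfolding arc_system_def
proof (intro conjI ballI impI)
  show "base_triangulation \<subseteq> arcs"
    using std_arc_in_arcs by (auto simp: base_triangulation_eq)
  show "compat a b" if "a \<in> base_triangulation" "b \<in> base_triangulation" for a b
    using that compat_std_arc by (auto simp: base_triangulation_eq)
  show "\<exists>n\<ge>1. \<forall>m\<ge>n. \<forall>k. std_arc m k \<in> base_triangulation"
    by (auto simp: base_triangulation_eq)
  fix a assume a: "a \<in> arcs" "\<forall>b \<in> base_triangulation. compat a b"
  obtain p q where pq: "a = geodesic p q" "p \<in> dyadic_points" "q \<in> dyadic_points" "p \<noteq> q"
    using a(1) by (rule arcsE)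
  have "(\<exists>m\<ge>1. \<exists>k. geodesic p q = std_arc m k) \<or> p \<in> level 1 \<and> q \<in> level 1"
    using a pq by (intro std_arc_or_level [where v = base_triangulation])
      (auto simp: base_triangulation_eq)
  then show "a \<in> base_triangulation"
  proof
    assume "p \<in> level 1 \<and> q \<in> level 1"
    moreover have "x = circ (grid 1 0) \<or> x = circ (grid 1 1)" if x: "x \<in> level 1" for x
    proof -
      obtain k where "0 \<le> k" "k < 0 + 2 ^ 1" "x = circ (grid 1 k)"
        using x by (rule grid_lift [where c = 0])
      then have "k = 0 \<or> k = 1" by auto
      then show ?thesis using \<open>x = circ (grid 1 k)\<close> by blast
    qed
    ultimately have "geodesic p q = std_arc 1 0"
      using pq(4) by (auto simp: std_arc_def open_segment_commute)
    then show ?thesis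
      using pq(1) by (auto simp: base_triangulation_eq)
  qed (use pq in \<open>auto simp: base_triangulation_eq\<close>)
qed

text \<open>Every chord between points of level \<open>M\<close> with a point of level \<open>M\<close> in between is a side of a triangle
  of the family on that side. Its third vertex is the last point \<open>m\<close> joined to \<open>k\<close>: an arc of the
  family crossing the chord from \<open>m\<close> to \<open>l\<close> would have to end at \<open>k\<close> and contradict the choice of \<open>m\<close>.
  So this chord belongs to the family by maximality.\<close>

lemma third_vertex:
  assumes v: "arc_system v" and std: "\<And>j. std_arc M j \<in> v"
    and kl: "k + 2 \<le> l" "l < k + 2 ^ M" and kl_v: "chord (grid M k) (grid M l) \<in> v"
  obtains m where "k < m" "m < l" "chord (grid M k) (grid M m) \<in> v" "chord (grid M m) (grid M l) \<in> v"
proof -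
  \<comment> \<open>nonempty since the standard arc from \<open>k\<close> to \<open>k + 1\<close> belongs to \<open>v\<close>\<close>
  define S where "S = {m. k < m \<and> m < l \<and> chord (grid M k) (grid M m) \<in> v}"
  have "finite S"
    by (rule finite_subset [of _ "{k<..<l}"]) (auto simp: S_def)
  have "k + 1 \<in> S"
    using kl std [of k] by (auto simp: S_def std_arc_def)
  define m where "m = Max S"
  have "m \<in> S"
    unfolding m_def using \<open>finite S\<close> \<open>k + 1 \<in> S\<close> by (intro Max_in) auto
  then have m: "k < m" "m < l" "chord (grid M k) (grid M m) \<in> v"
    by (auto simp: S_def)
  have max: "j \<le> m" if "j \<in> S" for j
    unfolding m_def using \<open>finite S\<close> that by simp
  have "chord (grid M m) (grid M l) \<in> v"
  proof (rule arc_systemD(3) [OF v])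
    show "chord (grid M m) (grid M l) \<in> arcs"
      using m kl by (intro arcsI circ_grid_dyadic circ_grid_neq) auto
    fix b assume b: "b \<in> v"
    then obtain u t where ut: "b = geodesic u t" "u \<in> S1" "t \<in> S1" "u \<noteq> t"
      using arc_systemD(1) [OF v] by (blast elim: arcs_S1E)
    note cb = arc_systemD(2) [OF v _ b]
    show "compat (chord (grid M m) (grid M l)) b"
    proof (rule ccontr)
      assume "\<not> compat (chord (grid M m) (grid M l)) b"
      then have "\<not> compat (chord (grid M m) (grid M l)) (geodesic u t)"
        using ut by simp
      moreover have "grid M m < grid M l" "grid M l < grid M m + 1"
        using m kl by auto
      ultimately obtain x y where xy: "grid M m < x" "x < grid M l" "grid M l < y"
          "y < grid M m + 1" "u = circ x \<and> t = circ y \<or> u = circ y \<and> t = circ x"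
        using not_compatE ut(2,3) by metis
      have b_eq: "b = chord x y"
        using xy(5) ut(1) by (auto simp: open_segment_commute)
      have mk: "grid M k < grid M m" "grid M m < grid M k + 1" "grid M l < grid M k + 1"
        using m kl by auto
      have "y \<ge> grid M k + 1"
      proof (rule ccontr)
        assume "\<not> ?thesis"
        then have "\<not> compat (chord (grid M k) (grid M l)) b"
          unfolding b_eq using xy m mk by (intro not_compat_cross) linarith+
        then show False using cb kl_v by blast
      qed
      moreover have "\<not> y > grid M k + 1"
      proof
        assume "y > grid M k + 1"
        then have "\<not> compat (chord (grid M k) (grid M m)) (chord (y - 1) x)"
          using xy m mk by (intro not_compat_cross) linarith+
        moreover have "chord (y - 1) x = b"
          using circ_diff_int [of y 1] by (simp add: b_eq open_segment_commute)
        ultimately show False using cb m(3) by simp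
      qed
      ultimately have y: "circ y = circ (grid M k)"
        by (smt (verit) circ_add_1)
      \<comment> \<open>now \<open>b\<close> joins \<open>x\<close> to the vertex \<open>k\<close>; it remains to see that \<open>x\<close> has level \<open>M\<close>\<close>
      define j where "j = \<lfloor>x * 2 ^ M\<rfloor>"
      have j: "grid M j \<le> x" "x < grid M (j + 1)"
        unfolding j_def grid_def by (simp_all add: divide_le_eq less_divide_eq)
      have "grid M m < grid M (j + 1)" "grid M j < grid M l"
        using j xy by linarith+
      then have jml: "m \<le> j" "j < l"
        by simp_all
      have "\<not> grid M j < x"
      proof
        assume less: "grid M j < x"
        have "\<not> compat (std_arc M j) (chord x (grid M k + 1))"
          unfolding std_arc_def
        proof (rule not_compat_cross [OF less j(2)])
          have "grid M (j + 1) < grid M (k + 2 ^ M)" "grid M (k + 2 ^ M) < grid M (j + 2 ^ M)"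
            using jml kl m by simp_all
          then show "grid M (j + 1) < grid M k + 1" "grid M k + 1 < grid M j + 1"
            by simp_all
        qed
        moreover have "chord x (grid M k + 1) = b"
          using y b_eq by simp
        ultimately show False
          using cb std by simp
      qed
      then have "x = grid M j"
        using j by simp
      then have "chord (grid M k) (grid M j) = b"
        using b_eq y by (simp add: open_segment_commute)
      moreover have "m < j"
        using \<open>x = grid M j\<close> xy(1) by simp
      ultimately have "j \<in> S"
        using b jml m by (auto simp: S_def)
      then show False
        using max \<open>m < j\<close> by fastforce
    qed
  qed
  then show thesis
    using that m by blast
qed

text \<open>The cap cut off by a short chord is close to the circle. This is how a bounded part of the disc is
  seen to be untouched by arcs of high level.\<close>

lemma norm_ge_cos_of_outer:
  assumes "orient (circ s) (circ t) z \<le> 0" "s < t" "t < s + 1"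
  shows "cos (pi * (t - s)) \<le> cmod z"
proof -
  have "0 < sin (pi * (t - s))"
    using assms by (intro sin_pi_pos) auto
  then have "cos (pi * (t - s)) \<le> Re (cnj (circ ((s + t) / 2)) * z)"
    using assms(1) by (simp add: orient_circ_chord mult_le_0_iff not_le)
  also have "\<dots> \<le> cmod (cnj (circ ((s + t) / 2)) * z)"
    by (rule complex_Re_le_cmod)
  also have "\<dots> = cmod z"
    by (simp add: norm_mult)
  finally show ?thesis .
qed

lemma norm_ge_cos_of_outer_grid:
  assumes "orient (circ (grid n k)) (circ (grid n (k + 1))) z \<le> 0" "1 \<le> n"
  shows "cos (pi / 2 ^ n) \<le> cmod z"
proof -
  have "cos (pi * (grid n (k + 1) - grid n k)) \<le> cmod z"
    using assms two_power_int_ge [OF assms(2)] by (intro norm_ge_cos_of_outer) auto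
  moreover have "grid n (k + 1) - grid n k = 1 / 2 ^ n"
    by (simp add: grid_def flip: diff_divide_distrib)
  ultimately show ?thesis by simp
qed

lemma cos_level_close:
  assumes "r < 1"
  obtains n where "1 \<le> n" "\<And>m. n \<le> m \<Longrightarrow> r < cos (pi / 2 ^ m)"
proof -
  have "((\<lambda>n. cos (pi * (1 / 2) ^ n)) \<longlonglongrightarrow> cos (pi * 0))"
    by (intro tendsto_intros LIMSEQ_power_zero) simp
  then have "(\<lambda>n. cos (pi / 2 ^ n)) \<longlonglongrightarrow> 1"
    by (simp add: power_divide)
  then have "\<forall>\<^sub>F n in sequentially. r < cos (pi / 2 ^ n)"
    using assms by (rule order_tendstoD(1))
  then obtain n where "\<And>m. n \<le> m \<Longrightarrow> r < cos (pi / 2 ^ m)"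
    by (auto simp: eventually_sequentially)
  then show thesis
    using that [of "max 1 n"] by simp
qed

lemma std_arc_norm_ge:
  assumes "z \<in> std_arc n k" "1 \<le> n"
  shows "cos (pi / 2 ^ n) \<le> cmod z"
  using assms orient_on_geodesic norm_ge_cos_of_outer_grid [of n k z]
  by (simp add: std_arc_def)

text \<open>Every point of the disc off the arcs lies in a triangle of the family. One starts from a chord
  with the point on its outer side and replaces it by the two other sides of the triangle adjacent
  to it. Either the point lies in that triangle, or it is on the outer side of one of them. The
  process ends because the caps over the shortest chords, which are standard arcs of level \<open>M\<close>, are
  closer to the circle than the point.\<close>

lemma arc_system_covers:
  assumes v: "arc_system v" and z: "cmod z < 1" "z \<notin> \<Union>v"
  obtains p q r where "p \<in> dyadic_points" "q \<in> dyadic_points" "r \<in> dyadic_points"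
    "0 < orient p q r" "geodesic p q \<in> v" "geodesic q r \<in> v" "geodesic r p \<in> v"
    "z \<in> ideal_triangle p q r"
proof -
  obtain n0 where n0: "1 \<le> n0" "\<And>m. n0 \<le> m \<Longrightarrow> cmod z < cos (pi / 2 ^ m)"
    using cos_level_close [OF z(1)] by blast
  obtain M where M: "1 \<le> M" "n0 \<le> M" and std': "\<And>m k. M \<le> m \<Longrightarrow> std_arc m k \<in> v"
    using arc_system_level [OF v, of n0] by blast
  then have std: "\<And>k. std_arc M k \<in> v"
    by blast
  let ?V = "\<lambda>k. circ (grid M k)"
  have nz: "orient (?V j) (?V k) z \<noteq> 0" if "geodesic (?V j) (?V k) \<in> v" "?V j \<noteq> ?V k" for j k
    using mem_geodesicI [of "?V j" "?V k" z] z that by auto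
  have key: "\<exists>p q r. p \<in> dyadic_points \<and> q \<in> dyadic_points \<and> r \<in> dyadic_points \<and>
    0 < orient p q r \<and> geodesic p q \<in> v \<and> geodesic q r \<in> v \<and> geodesic r p \<in> v \<and>
    z \<in> ideal_triangle p q r"
    if "k < l" "l < k + 2 ^ M" "chord (grid M k) (grid M l) \<in> v" "orient (?V k) (?V l) z < 0" for k l
    using that
  proof (induction "nat (l - k)" arbitrary: k l rule: less_induct)
    case less
    have "l \<noteq> k + 1"
      using norm_ge_cos_of_outer_grid [of M k z] n0(2) [OF M(2)] M(1) less.prems(4) by force
    then have "k + 2 \<le> l"
      using less.prems(1) by linarith
    then obtain m where m: "k < m" "m < l" "chord (grid M k) (grid M m) \<in> v"
        "chord (grid M m) (grid M l) \<in> v"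
      using third_vertex [OF v std _ less.prems(2,3)] by metis
    have neq: "?V k \<noteq> ?V m" "?V m \<noteq> ?V l"
      by (rule circ_grid_neq; use m less.prems in linarith)+
    show ?case
    proof (cases "orient (?V k) (?V m) z < 0")
      case True
      then show ?thesis
        using less.hyps [of m k] m less.prems by simp
    next
      case F1: False
      show ?thesis
      proof (cases "orient (?V m) (?V l) z < 0")
        case True
        then show ?thesis
          using less.hyps [of l m] m less.prems by simp
      next
        case False
        have or: "0 < orient (?V k) (?V m) (?V l)"
          using m less.prems by (intro orient_circ_pos) auto
        have "0 < orient (?V k) (?V m) z" "0 < orient (?V m) (?V l) z"
          using F1 False nz [OF m(3) neq(1)] nz [OF m(4) neq(2)] by linarith+
        moreover have "0 < orient (?V l) (?V k) z"
          using less.prems(4) orient_swap [of "?V k" "?V l" z] by simp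
        ultimately have "z \<in> ideal_triangle (?V k) (?V m) (?V l)"
          by (simp add: ideal_triangle_orient [OF or])
        then show ?thesis
          using or m less.prems(3) open_segment_commute [of "?V k" "?V l"]
          by (metis circ_grid_dyadic)
      qed
    qed
  qed
  have M2: "(2::int) \<le> 2 ^ M"
    using two_power_int_ge M(1) by blast
  have v01: "chord (grid M 0) (grid M 1) \<in> v"
    using std [of 0] by (simp add: std_arc_def)
  then have v10: "chord (grid M 1) (grid M (2 ^ M)) \<in> v"
    using circ_grid_period [of M 0] by (simp add: open_segment_commute)
  have "?V 0 \<noteq> ?V 1"
    using M2 by (intro circ_grid_neq) auto
  with v01 have "orient (?V 0) (?V 1) z \<noteq> 0"
    by (rule nz)
  then consider "orient (?V 0) (?V 1) z < 0" | "orient (?V 1) (?V (2 ^ M)) z < 0"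
    using orient_swap [of "?V 0" "?V 1" z] circ_grid_period [of M 0] by force
  then have "\<exists>p q r. p \<in> dyadic_points \<and> q \<in> dyadic_points \<and> r \<in> dyadic_points \<and>
    0 < orient p q r \<and> geodesic p q \<in> v \<and> geodesic q r \<in> v \<and> geodesic r p \<in> v \<and>
    z \<in> ideal_triangle p q r"
  proof cases
    case 1
    then show ?thesis using key [of 0 1] v01 M2 by simp
  next
    case 2
    then show ?thesis using key [of 1 "2 ^ M"] v10 M2 by simp
  qed
  then show thesis
    using that by blast
qed


section \<open>The vertices of the complex are the maximal systems\<close>

lemma arc_system_region_iff:
  assumes v: "arc_system v" and pqr: "p \<in> dyadic_points" "q \<in> dyadic_points" "r \<in> dyadic_points"
    "distinct [p, q, r]"
  shows "ideal_triangle p q r \<in> regions v \<longleftrightarrow>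
     geodesic p q \<in> v \<and> geodesic q r \<in> v \<and> geodesic r p \<in> v"
proof (rule triangle_region_iff)
  show "orient p q r \<noteq> 0"
    using orient_eq_0 [of p q r] pqr dyadic_points_S1 by auto
qed (use arc_systemD [OF v] pqr dyadic_points_S1 in blast)+

lemma arc_system_regions:
  assumes v: "arc_system v" and c: "c \<in> regions v"
  obtains p q r where "{p, q, r} \<subseteq> dyadic_points" "distinct [p, q, r]"
    "geodesic p q \<in> v" "geodesic q r \<in> v" "geodesic r p \<in> v" "c = ideal_triangle p q r"
proof -
  have comp: "c \<in> components (disc - \<Union>v)"
    using c by (simp add: regions_def)
  then obtain z where z: "z \<in> c"
    using in_components_nonempty by blast
  then have zd: "cmod z < 1" "z \<notin> \<Union>v"
    using in_components_subset [OF comp] by auto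
  obtain p q r where t: "p \<in> dyadic_points" "q \<in> dyadic_points" "r \<in> dyadic_points"
    "0 < orient p q r" "geodesic p q \<in> v" "geodesic q r \<in> v" "geodesic r p \<in> v"
    "z \<in> ideal_triangle p q r"
    using arc_system_covers [OF v zd] by metis
  have d: "distinct [p, q, r]"
    using t(4) by auto
  have "ideal_triangle p q r \<in> regions v"
    using arc_system_region_iff [OF v t(1-3) d] t by simp
  then have "c = ideal_triangle p q r"
    using components_nonoverlap [OF comp, of "ideal_triangle p q r"] z t(8)
    by (auto simp: regions_def)
  then show thesis
    using that [of p q r] t d by simp
qed

lemma arc_system_triangulation:
  assumes v: "arc_system v"
  shows "triangulation v"
  unfolding triangulation_def
proof (intro conjI ballI)
  show "v \<subseteq> arcs"
    by (rule arc_systemD(1) [OF v])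
  show "pairwise disjnt v"
    using arc_systemD(2) [OF v] by (auto simp: pairwise_def compat_def)
  fix c assume "c \<in> regions v"
  then show "\<exists>p q r. {p, q, r} \<subseteq> dyadic_points \<and> distinct [p, q, r] \<and> c = ideal_triangle p q r"
    using arc_system_regions [OF v] by metis
qed

lemma grid_between:
  assumes "q \<in> level n" "q = circ y" "grid n j \<le> y" "y \<le> grid n (j + 1)"
  shows "y = grid n j \<or> y = grid n (j + 1)"
proof -
  obtain i :: int where "circ y = circ (grid n i)"
    using assms by (auto simp: level_def)
  then obtain l :: int where "y = grid n i + of_int l"
    by (auto simp: circ_eq_iff)
  then have "y = grid n (i + l * 2 ^ n)"
    by (simp add: grid_def add_divide_distrib)
  with assms(3,4) have "j \<le> i + l * 2 ^ n" "i + l * 2 ^ n \<le> j + 1"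
    by simp_all
  then have "i + l * 2 ^ n = j \<or> i + l * 2 ^ n = j + 1"
    by linarith
  then show ?thesis
    using \<open>y = grid n (i + l * 2 ^ n)\<close> by metis
qed

text \<open>Two systems share all standard arcs from some level \<open>n\<close> on. A triangle with a vertex beyond
  level \<open>n\<close> has the two sides at this vertex in common by \<open>std_arc_or_level\<close>; if the other two
  vertices are of level \<open>n\<close>, these are the ends of the interval of level \<open>n\<close> that contains the
  vertex, so the third side is shared, too. Hence only triangles with vertices of level \<open>n\<close> can
  differ.\<close>

lemma finite_regions_diff:
  assumes u: "arc_system u" and v: "arc_system v"
  shows "finite (regions u - regions v)"
proof -
  obtain n1 n2 where n12: "\<And>m k. n1 \<le> m \<Longrightarrow> std_arc m k \<in> u" "1 \<le> n1"
     "\<And>m k. n2 \<le> m \<Longrightarrow> std_arc m k \<in> v"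
    using arc_system_level [OF u, of 1] arc_system_level [OF v, of 1] by metis
  define n where "n = max n1 n2"
  have n: "\<And>m k. n \<le> m \<Longrightarrow> std_arc m k \<in> u" "1 \<le> n" "\<And>m k. n \<le> m \<Longrightarrow> std_arc m k \<in> v"
    using n12 by (auto simp: n_def)
  have dich: "geodesic p q \<in> v \<or> p \<in> level n \<and> q \<in> level n"
    if "geodesic p q \<in> u" "p \<in> dyadic_points" "q \<in> dyadic_points" "p \<noteq> q" for p q
    using std_arc_or_level [of n u p q] n that arc_systemD(1,2) [OF u]
    by (metis subsetD)
  have other: "geodesic q r \<in> v"
    if pq: "geodesic p q \<in> u" "geodesic r p \<in> u" "{p, q, r} \<subseteq> dyadic_points" "distinct [p, q, r]"
      "p \<notin> level n" "q \<in> level n" "r \<in> level n" for p q r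
  proof -
    obtain x where x: "0 \<le> x" "x < 0 + 1" "p = circ x"
      using pq(3) dyadic_points_S1 circ_lift by (metis insert_subset)
    define j where "j = \<lfloor>x * 2 ^ n\<rfloor>"
    have j: "grid n j \<le> x" "x < grid n (j + 1)"
      unfolding j_def grid_def by (simp_all add: divide_le_eq less_divide_eq)
    moreover have "x \<noteq> grid n j"
      using pq(5) x by (auto simp: level_def)
    ultimately have jx: "grid n j < x" "x < grid n (j + 1)" by auto
    \<comment> \<open>the standard arc over the interval around \<open>p\<close> confines the neighbours of \<open>p\<close>\<close>
    have ends: "y = circ (grid n j) \<or> y = circ (grid n (j + 1))"
      if y: "geodesic p y \<in> u" "y \<in> level n" for y
    proof -
      have "y \<in> S1"
        using y(2) level_subset_dyadic dyadic_points_S1 by blast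
      then obtain b where b: "grid n j \<le> b" "b < grid n j + 1" "y = circ b"
        by (rule circ_lift)
      have "b \<le> grid n (j + 1)"
      proof (rule ccontr)
        assume "\<not> ?thesis"
        then have "\<not> compat (std_arc n j) (geodesic p y)"
          unfolding std_arc_def x(3) b(3) using jx b by (intro not_compat_cross) linarith+
        then show False
          using y(1) n(1) arc_systemD(2) [OF u] by blast
      qed
      then show ?thesis
        using grid_between [OF y(2) b(3) b(1)] b(3) by auto
    qed
    have "geodesic q r = std_arc n j"
      using ends [of q] ends [of r] pq by (auto simp: std_arc_def open_segment_commute)
    then show ?thesis
      using n(3) by simp
  qed
  have "regions u - regions v \<subseteq>
      (\<lambda>(p, q, r). ideal_triangle p q r) ` (level n \<times> level n \<times> level n)"
  proof
    fix c assume c: "c \<in> regions u - regions v"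
    then obtain p q r where t: "{p, q, r} \<subseteq> dyadic_points" "distinct [p, q, r]"
      "geodesic p q \<in> u" "geodesic q r \<in> u" "geodesic r p \<in> u" "c = ideal_triangle p q r"
      using arc_system_regions [OF u] by (metis DiffD1)
    have "\<not> (geodesic p q \<in> v \<and> geodesic q r \<in> v \<and> geodesic r p \<in> v)"
      using arc_system_region_iff [OF v, of p q r] c t by auto
    moreover note dich [of p q] dich [of q r] dich [of r p] other [of p q r] other [of q r p]
      other [of r p q]
    ultimately have "p \<in> level n \<and> q \<in> level n \<and> r \<in> level n"
      using t by auto
    then show "c \<in> (\<lambda>(p, q, r). ideal_triangle p q r) ` (level n \<times> level n \<times> level n)"
      using t(6) by force
  qed
  then show ?thesis
    by (rule finite_subset) (simp add: finite_level)
qed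

text \<open>An arc disjoint from all members would run inside one of the regions, but no geodesic that crosses
  no side enters a triangle.\<close>

lemma triangulation_maximal:
  assumes v: "triangulation v" and a: "a \<in> arcs" "\<And>b. b \<in> v \<Longrightarrow> compat a b"
  shows "a \<in> v"
proof (rule ccontr)
  assume "a \<notin> v"
  have v_arcs: "v \<subseteq> arcs" and v_compat: "\<And>a b. \<lbrakk>a \<in> v; b \<in> v\<rbrakk> \<Longrightarrow> compat a b"
    using v by (auto simp: triangulation_def compat_def pairwise_def)
  obtain u t where ut: "a = geodesic u t" "u \<in> S1" "t \<in> S1" "u \<noteq> t"
    using a(1) by (rule arcs_S1E)
  have "a \<inter> b = {}" if "b \<in> v" for b
    using a(2) [OF that] that \<open>a \<notin> v\<close> by (auto simp: compat_def disjnt_def)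
  then have "a \<subseteq> disc - \<Union>v"
    using ut geodesic_norm_less [of _ u t] by auto
  moreover obtain z where z: "z \<in> a"
    using ut by (metis all_not_in_conv open_segment_eq_empty)
  ultimately have "z \<in> disc - \<Union>v" by blast
  then obtain c where c: "c \<in> components (disc - \<Union>v)" "z \<in> c"
    using Union_components [of "disc - \<Union>v"] by blast
  then obtain p q r where t: "{p, q, r} \<subseteq> dyadic_points" "distinct [p, q, r]"
      "c = ideal_triangle p q r"
    using v unfolding triangulation_def regions_def by metis
  have S1: "p \<in> S1" "q \<in> S1" "r \<in> S1"
    using t(1) dyadic_points_S1 by auto
  have or: "orient p q r \<noteq> 0"
    using orient_eq_0 [OF S1] t(2) by auto
  have sides: "geodesic p q \<in> v" "geodesic q r \<in> v" "geodesic r p \<in> v"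
    using triangle_region_iff [OF or S1 v_arcs v_compat] c(1) t(3) by (auto simp: regions_def)
  have "a \<inter> c = {}"
  proof (cases "0 < orient p q r")
    case True
    then show ?thesis
      unfolding ut(1) t(3) using a(2) sides ut S1 by (intro geodesic_disjnt_ideal_triangle) auto
  next
    case False
    then have "0 < orient q p r"
      using or orient_swap [of p q r] by simp
    then have "geodesic u t \<inter> ideal_triangle q p r = {}"
      using a(2) sides ut S1
      by (intro geodesic_disjnt_ideal_triangle)
        (simp_all add: open_segment_commute [of q p] open_segment_commute [of p r]
          open_segment_commute [of r q])
    then show ?thesis
      by (simp add: ut(1) t(3) ideal_triangle_perm(2))
  qed
  then show False
    using z c(2) by blast
qed

text \<open>For the direction from the left to the right, finitely many triangles of the base triangulation
  are missing from \<open>v\<close>. Each contains a point of norm at most some \<open>r < 1\<close>, whereas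
  the triangle below a standard arc of high level lies in a cap of larger norm. So these triangles
  are regions of \<open>v\<close>, and their sides belong to \<open>v\<close>.\<close>

theorem C_vertices_eq: "C_vertices = Collect arc_system"
proof (intro equalityI subsetI; clarify)
  fix v assume v: "arc_system v"
  then show "v \<in> C_vertices"
    unfolding C_vertices_def
    using arc_system_triangulation finite_regions_diff arc_system_base by blast
next
  fix v assume "v \<in> C_vertices"
  then have tri: "triangulation v" and fin: "finite (regions base_triangulation - regions v)"
    by (auto simp: C_vertices_def)
  have v_arcs: "v \<subseteq> arcs" and v_compat: "\<And>a b. \<lbrakk>a \<in> v; b \<in> v\<rbrakk> \<Longrightarrow> compat a b"
    using tri by (auto simp: triangulation_def compat_def pairwise_def)
  define R where "R = regions base_triangulation - regions v"
  have "\<exists>z. z \<in> c \<and> cmod z < 1" if "c \<in> R" for c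
    using that in_components_nonempty [of c] in_components_subset [of c]
    by (fastforce simp: R_def regions_def)
  then obtain pt where pt: "\<And>c. c \<in> R \<Longrightarrow> pt c \<in> c \<and> cmod (pt c) < 1"
    by metis
  define r where "r = Max (insert 0 ((\<lambda>c. cmod (pt c)) ` R))"
  have finR: "finite (insert 0 ((\<lambda>c. cmod (pt c)) ` R))"
    using fin by (simp add: R_def)
  have "r < 1"
    unfolding r_def using finR pt by (subst Max_less_iff) auto
  have r: "cmod (pt c) \<le> r" if "c \<in> R" for c
    unfolding r_def using finR that by (intro Max_ge) auto
  obtain n where n: "1 \<le> n" "\<And>m. n \<le> m \<Longrightarrow> r < cos (pi / 2 ^ m)"
    using cos_level_close [OF \<open>r < 1\<close>] by blast
  have std: "std_arc m k \<in> v" if m: "n \<le> m" for m k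
  proof -
    let ?p = "circ (grid m k)" and ?q = "circ (grid (Suc m) (2 * k + 1))"
      and ?r = "circ (grid m (k + 1))"
    have m1: "1 \<le> m" using m n by simp
    have M: "(2::int) \<le> 2 ^ m" "(2::int) \<le> 2 ^ Suc m"
      using two_power_int_ge m1 by (blast, simp)
    have e: "grid m k = grid (Suc m) (2 * k)" "grid m (k + 1) = grid (Suc m) (2 * k + 2)"
      using grid_Suc [of m k] grid_Suc [of m "k + 1"] by simp_all
    have less: "grid m k < grid (Suc m) (2 * k + 1)" "grid (Suc m) (2 * k + 1) < grid m (k + 1)"
      unfolding e by simp_all
    have less2: "grid m (k + 1) < grid m k + 1"
      using M by simp
    have or: "0 < orient ?p ?q ?r"
      using less less2 by (rule orient_circ_pos)
    have "geodesic ?p ?q = std_arc (Suc m) (2 * k)" "geodesic ?q ?r = std_arc (Suc m) (2 * k + 1)"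
       "geodesic ?r ?p = std_arc m k"
      unfolding std_arc_def e by (simp_all only: open_segment_commute add.assoc one_add_one)
    then have sides: "geodesic ?p ?q \<in> base_triangulation" "geodesic ?q ?r \<in> base_triangulation"
       "geodesic ?r ?p \<in> base_triangulation" "geodesic ?r ?p = std_arc m k"
      using m1 le_SucI [OF m1] unfolding base_triangulation_eq by blast+
    have d: "distinct [?p, ?q, ?r]"
      using or by auto
    have c: "ideal_triangle ?p ?q ?r \<in> regions base_triangulation"
      using arc_system_region_iff [OF arc_system_base _ _ _ d] sides(1-3) by simp
    have "ideal_triangle ?p ?q ?r \<notin> R"
    proof
      assume inR: "ideal_triangle ?p ?q ?r \<in> R"
      let ?z = "pt (ideal_triangle ?p ?q ?r)"
      have "?z \<in> ideal_triangle ?p ?q ?r"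
        using pt [OF inR] by blast
      then have "0 < orient ?r ?p ?z"
        by (simp add: ideal_triangle_orient [OF or])
      then have "orient ?p ?r ?z \<le> 0"
        using orient_swap [of ?r ?p ?z] by simp
      then have "cos (pi / 2 ^ m) \<le> cmod ?z"
        using m1 by (rule norm_ge_cos_of_outer_grid)
      then show False
        using r [OF inR] n(2) [OF m] by simp
    qed
    then have "ideal_triangle ?p ?q ?r \<in> regions v"
      using c by (simp add: R_def)
    then show "std_arc m k \<in> v"
      using triangle_region_iff [of ?p ?q ?r v] or v_arcs v_compat sides(4) by auto
  qed
  show "arc_system v"
    unfolding arc_system_def
    using v_arcs v_compat triangulation_maximal [OF tri] n(1) std by blast
qed


section \<open>Flips\<close>

text \<open>An arc that crosses one diagonal of a quadrilateral and no side is the other diagonal, since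
  its endpoints cannot lie strictly inside any of the four boundary intervals.\<close>

lemma quadrilateral_diagonal:
  assumes ord: "a < d" "d < b" "b < c" "c < a + 1"
    and x: "u \<in> S1" "t \<in> S1"
    and sides: "compat (chord a d) (geodesic u t)" "compat (chord d b) (geodesic u t)"
      "compat (chord b c) (geodesic u t)" "compat (chord c a) (geodesic u t)"
    and cross: "\<not> compat (chord a b) (geodesic u t)"
  shows "geodesic u t = chord d c"
proof -
  have "a < b" "b < a + 1" using ord by auto
  then obtain y z where yz: "a < y" "y < b" "b < z" "z < a + 1"
      "u = circ y \<and> t = circ z \<or> u = circ z \<and> t = circ y"
    using not_compatE [OF cross _ _ x] by metis
  have eq: "geodesic u t = chord y z" "geodesic u t = chord z (y + 1)"
    using yz(5) by (auto simp: open_segment_commute)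
  have "\<not> y < d"
    using not_compat_cross [of a y d z] yz ord sides(1) eq(1) by auto
  moreover have "\<not> d < y"
    using not_compat_cross [of d y b z] yz ord sides(2) eq(1) by auto
  moreover have "\<not> z < c"
    using not_compat_cross [of b z c "y + 1"] yz ord sides(3) eq(2) by auto
  moreover have "\<not> c < z"
    using not_compat_cross [of c z "a + 1" "y + 1"] yz ord sides(4) eq(2) by auto
  ultimately have "y = d" "z = c" by auto
  then show ?thesis unfolding eq(1) by simp
qed

text \<open>Two triangles on the same side of \<open>p q\<close> have crossing sides, so distinct third vertices lie on
  different sides.\<close>

lemma third_vertices_lifts:
  assumes v: "\<And>a b. \<lbrakk>a \<in> v; b \<in> v\<rbrakk> \<Longrightarrow> compat a b"
    and S1: "p \<in> S1" "q \<in> S1" "r \<in> S1" "s \<in> S1" and d: "distinct [p, q, r, s]"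
    and sides: "geodesic p r \<in> v" "geodesic q r \<in> v" "geodesic p s \<in> v" "geodesic q s \<in> v"
  obtains a b c d where "p = circ a" "q = circ b" "r = circ c \<and> s = circ d \<or> r = circ d \<and> s = circ c"
    "a < d" "d < b" "b < c" "c < a + 1"
proof -
  obtain a where a: "p = circ a"
    using S1(1) by (rule circ_lift)
  obtain b where b: "a \<le> b" "b < a + 1" "q = circ b"
    using S1(2) by (rule circ_lift)
  obtain x where x: "a \<le> x" "x < a + 1" "r = circ x"
    using S1(3) by (rule circ_lift)
  obtain y where y: "a \<le> y" "y < a + 1" "s = circ y"
    using S1(4) by (rule circ_lift)
  have neq: "a \<noteq> b" "a \<noteq> x" "a \<noteq> y" "b \<noteq> x" "b \<noteq> y" "x \<noteq> y"
    using d a b x y by auto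
  have pr: "chord a x \<in> v" and qr: "chord b x \<in> v" "chord x b \<in> v"
    and ps: "chord a y \<in> v" and qs: "chord b y \<in> v" "chord y b \<in> v"
    using sides a b x y by (simp_all add: open_segment_commute)
  consider "x < b" "b < y" | "y < b" "b < x" | "b < x" "x < y" | "b < y" "y < x"
    | "x < y" "y < b" | "y < x" "x < b"
    using neq by linarith
  then show thesis
  proof cases
    case 1
    then show ?thesis using that [of a b y x] a b x y neq by simp
  next
    case 2
    then show ?thesis using that [of a b x y] a b x y neq by simp
  next
    case 3
    then show ?thesis
      using not_compat_cross [of a b x y] v [OF pr qs(1)] a b x y neq by simp
  next
    case 4
    then show ?thesis
      using not_compat_cross [of a b y x] v [OF ps qr(1)] a b x y neq by simp
  next
    case 5
    then show ?thesis
      using not_compat_cross [of a x y b] v [OF ps qr(2)] a b x y neq by simp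
  next
    case 6
    then show ?thesis
      using not_compat_cross [of a y x b] v [OF pr qs(2)] a b x y neq by simp
  qed
qed

lemma third_vertices_opposite:
  assumes v: "\<And>a b. \<lbrakk>a \<in> v; b \<in> v\<rbrakk> \<Longrightarrow> compat a b"
    and S1: "p \<in> S1" "q \<in> S1" "r \<in> S1" "s \<in> S1" and d: "distinct [p, q, r, s]"
    and sides: "geodesic p r \<in> v" "geodesic q r \<in> v" "geodesic p s \<in> v" "geodesic q s \<in> v"
  shows "orient p q r * orient p q s < 0"
proof -
  obtain a b c d where l: "p = circ a" "q = circ b"
    "r = circ c \<and> s = circ d \<or> r = circ d \<and> s = circ c" "a < d" "d < b" "b < c" "c < a + 1"
    using third_vertices_lifts [OF v S1 d sides] by metis
  then show ?thesis
    using orient_circ_neg [of a d b] orient_circ_pos [of a b c]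
    by (auto simp: mult_pos_neg mult_neg_pos)
qed

text \<open>The arc \<open>p q\<close> of \<open>v\<close> is a diagonal of the quadrilateral \<open>p r q s\<close>, whose sides belong to \<open>v\<close>.\<close>

definition quad_in :: "complex set set \<Rightarrow> complex \<Rightarrow> complex \<Rightarrow> complex \<Rightarrow> complex \<Rightarrow> bool" where
  "quad_in v p q r s \<longleftrightarrow> {p, q, r, s} \<subseteq> dyadic_points \<and> distinct [p, q, r, s] \<and>
     geodesic p q \<in> v \<and> geodesic p r \<in> v \<and> geodesic q r \<in> v \<and> geodesic p s \<in> v \<and> geodesic q s \<in> v"

lemma quad_inD:
  assumes "quad_in v p q r s"
  shows "p \<in> dyadic_points" "q \<in> dyadic_points" "r \<in> dyadic_points" "s \<in> dyadic_points"
    "p \<in> S1" "q \<in> S1" "r \<in> S1" "s \<in> S1" "distinct [p, q, r, s]"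
    "geodesic p q \<in> v" "geodesic p r \<in> v" "geodesic q r \<in> v" "geodesic p s \<in> v" "geodesic q s \<in> v"
  using assms dyadic_points_S1 by (auto simp: quad_in_def)

lemma quad_in_diagonals_cross:
  assumes v: "\<And>a b. \<lbrakk>a \<in> v; b \<in> v\<rbrakk> \<Longrightarrow> compat a b" and q: "quad_in v p q r s"
  shows "\<not> compat (geodesic p q) (geodesic r s)"
  using third_vertices_opposite [OF v quad_inD(5-9) [OF q] quad_inD(11-14) [OF q]] quad_inD(5-9) [OF q]
  by (simp add: compat_iff_orient)

lemma quad_in_cross_unique:
  assumes v: "\<And>a b. \<lbrakk>a \<in> v; b \<in> v\<rbrakk> \<Longrightarrow> compat a b" and q: "quad_in v p q r s"
    and x: "x \<in> arcs" "compat (geodesic p r) x" "compat (geodesic q r) x" "compat (geodesic p s) x"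
      "compat (geodesic q s) x"
  shows "compat (geodesic p q) x \<or> x = geodesic r s" "compat (geodesic r s) x \<or> x = geodesic p q"
proof -
  obtain u t where ut: "x = geodesic u t" "u \<in> S1" "t \<in> S1" "u \<noteq> t"
    using x(1) by (rule arcs_S1E)
  obtain a b c d where l: "p = circ a" "q = circ b"
    "r = circ c \<and> s = circ d \<or> r = circ d \<and> s = circ c" "a < d" "d < b" "b < c" "c < a + 1"
    using third_vertices_lifts [OF v quad_inD(5-9) [OF q] quad_inD(11-14) [OF q]] by metis
  have s: "compat (chord a d) (geodesic u t)" "compat (chord d b) (geodesic u t)"
      "compat (chord b c) (geodesic u t)" "compat (chord c a) (geodesic u t)"
    using l x ut(1) by (auto simp: open_segment_commute)
  have rs: "geodesic r s = chord d c"
    using l by (auto simp: open_segment_commute)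
  have pq: "geodesic p q = chord a b" "chord b (a + 1) = chord a b"
    using l(1,2) by (simp_all add: open_segment_commute)
  have "\<not> compat (chord a b) (geodesic u t) \<Longrightarrow> geodesic u t = chord d c"
    by (rule quadrilateral_diagonal [OF l(4-7) ut(2,3) s])
  then show "compat (geodesic p q) x \<or> x = geodesic r s"
    unfolding pq(1) rs ut(1) by blast
  have "chord c (a + 1) = chord c a" "chord (a + 1) d = chord a d"
    by simp_all
  then have s': "compat (chord c (a + 1)) (geodesic u t)" "compat (chord (a + 1) d) (geodesic u t)"
    using s(1,4) by simp_all
  have "d < a + 1" "a + 1 < d + 1"
    using l by auto
  then have "\<not> compat (chord d c) (geodesic u t) \<Longrightarrow> geodesic u t = chord b (a + 1)"
    using quadrilateral_diagonal [OF l(5,6,7) _ ut(2,3) s(2,3) s'] by blast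
  then show "compat (geodesic r s) x \<or> x = geodesic p q"
    unfolding pq rs ut(1) by blast
qed

text \<open>The flip of an arc stays inside the complex. An arc compatible with the new family either does not
  cross the old diagonal, so that it belongs to \<open>v\<close>, or it crosses it without crossing the sides and
  is the new diagonal. Standard arcs of high level are not removed, as they stay
  away from a chosen point of the old diagonal.\<close>

lemma exchange_arc_system:
  assumes v: "arc_system v" and q: "quad_in v p q r s"
  shows "arc_system (insert (geodesic r s) (v - {geodesic p q}))"
proof -
  note V = arc_systemD [OF v] and Q = quad_inD [OF q]
  let ?w = "insert (geodesic r s) (v - {geodesic p q})"
  have cross: "\<not> compat (geodesic p q) (geodesic r s)"
    by (rule quad_in_diagonals_cross [OF V(2) q])
  have rs_compat: "compat (geodesic r s) x" if "x \<in> v" "x \<noteq> geodesic p q" for x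
    using quad_in_cross_unique(2) [OF V(2) q, of x] that V(1,2) Q by blast
  have neq: "geodesic p q \<noteq> geodesic p r" "geodesic p q \<noteq> geodesic q r"
      "geodesic p q \<noteq> geodesic p s" "geodesic p q \<noteq> geodesic q s"
    using Q(9) by (auto dest!: geodesic_eqD)
  show ?thesis
    unfolding arc_system_def
  proof (intro conjI ballI impI)
    show "?w \<subseteq> arcs"
      using V(1) Q by (auto intro!: arcsI)
    show "compat x y" if "x \<in> ?w" "y \<in> ?w" for x y
      using that rs_compat V(2) compat_sym compat_refl
      by (metis Diff_iff insert_iff)
    show "x \<in> ?w" if x: "x \<in> arcs" "\<forall>b \<in> ?w. compat x b" for x
    proof (cases "compat (geodesic p q) x")
      case True
      then have "x \<in> v"
        using x compat_sym by (intro V(3)) auto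
      moreover have "x \<noteq> geodesic p q"
        using x(2) cross by auto
      ultimately show ?thesis by simp
    next
      case False
      have "compat y x" if "y \<in> v" "y \<noteq> geodesic p q" for y
        using x(2) that compat_sym by auto
      then show ?thesis
        using quad_in_cross_unique(1) [OF V(2) q x(1)] False Q neq by auto
    qed
    obtain z where z: "z \<in> geodesic p q"
      using Q(9) by (metis all_not_in_conv distinct_length_2_or_more open_segment_eq_empty)
    then have "cmod z < 1"
      using Q by (intro geodesic_norm_less)
    then obtain n0 where n0: "\<And>m. n0 \<le> m \<Longrightarrow> cmod z < cos (pi / 2 ^ m)"
      using cos_level_close by metis
    obtain n where n: "1 \<le> n" "n0 \<le> n" "\<And>m k. n \<le> m \<Longrightarrow> std_arc m k \<in> v"
      using arc_system_level [OF v, of n0] by blast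
    have "std_arc m k \<noteq> geodesic p q" if "n \<le> m" for m k
      using std_arc_norm_ge [of z m k] z n0 [of m] n that by fastforce
    then show "\<exists>n\<ge>1. \<forall>m\<ge>n. \<forall>k. std_arc m k \<in> ?w"
      using n by blast
  qed
qed

text \<open>At one level beyond that of both endpoints there is a point strictly between them on either side,
  so \<open>third_vertex\<close> applies twice.\<close>

lemma quad_exists:
  assumes v: "arc_system v" and pq: "geodesic p q \<in> v" "p \<in> dyadic_points" "q \<in> dyadic_points" "p \<noteq> q"
  obtains r s where "quad_in v p q r s"
proof -
  obtain n where n: "\<And>m k. n \<le> m \<Longrightarrow> std_arc m k \<in> v"
    using arc_system_level [OF v, of 1] by blast
  obtain j where j: "p \<in> level (n + j)" "q \<in> level (n + j)"
    using dyadic_level2 pq(2,3) by blast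
  define M where "M = n + j"
  obtain k where k: "p = circ (grid M k)"
    using j(1) by (auto simp: level_def M_def)
  obtain l where l: "k \<le> l" "l < k + 2 ^ M" "q = circ (grid M l)"
    using j(2) grid_lift unfolding M_def by metis
  have "k \<noteq> l" using pq(4) k l by auto
  let ?N = "Suc M"
  have p: "p = circ (grid ?N (2 * k))" "p = circ (grid ?N (2 * k + 2 ^ ?N))"
    and q: "q = circ (grid ?N (2 * l))"
    using k l(3) grid_Suc circ_grid_period [of ?N "2 * k"] by simp_all
  have std: "\<And>i. std_arc ?N i \<in> v"
    using n by (simp add: M_def)
  obtain a where a: "2 * k < a" "a < 2 * l" "chord (grid ?N (2 * k)) (grid ?N a) \<in> v"
      "chord (grid ?N a) (grid ?N (2 * l)) \<in> v"
  proof (rule third_vertex [OF v std, of "2 * k" "2 * l"])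
    show "chord (grid ?N (2 * k)) (grid ?N (2 * l)) \<in> v"
      using pq(1) p(1) q by simp
  qed (use l \<open>k \<noteq> l\<close> in auto)
  obtain b where b: "2 * l < b" "b < 2 * k + 2 ^ ?N" "chord (grid ?N (2 * l)) (grid ?N b) \<in> v"
      "chord (grid ?N b) (grid ?N (2 * k + 2 ^ ?N)) \<in> v"
  proof (rule third_vertex [OF v std, of "2 * l" "2 * k + 2 ^ ?N"])
    show "chord (grid ?N (2 * l)) (grid ?N (2 * k + 2 ^ ?N)) \<in> v"
      using pq(1) p(2) q by (simp only: open_segment_commute)
  qed (use l \<open>k \<noteq> l\<close> in auto)
  let ?r = "circ (grid ?N a)" and ?s = "circ (grid ?N b)"
  have "p \<noteq> ?r" "p \<noteq> ?s" unfolding p(1)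
    by (rule circ_grid_neq; use a b l in simp)+
  moreover have "?r \<noteq> q" "?r \<noteq> ?s" "q \<noteq> ?s" unfolding q
    by (rule circ_grid_neq; use a b l in simp)+
  moreover have "geodesic p ?r \<in> v" "geodesic q ?r \<in> v" "geodesic p ?s \<in> v" "geodesic q ?s \<in> v"
    using a(3,4) b(3,4) unfolding p(1)[symmetric] p(2)[symmetric] q[symmetric]
    by (simp_all add: open_segment_commute)
  ultimately have "quad_in v p q ?r ?s"
    using pq by (auto simp: quad_in_def)
  then show thesis by (rule that)
qed

text \<open>The third vertices are unique, because three of them could not lie pairwise on opposite sides of
  the arc.\<close>

lemma flip_quad:
  assumes v: "arc_system v" and q: "quad_in v p q r s"
  shows "flip v (geodesic p q) = insert (geodesic r s) (v - {geodesic p q})"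
proof -
  note V = arc_systemD [OF v] and Q = quad_inD [OF q]
  have third: "x = r \<or> x = s"
    if x: "x \<in> dyadic_points" "x \<noteq> p" "x \<noteq> q" "geodesic p x \<in> v" "geodesic q x \<in> v" for x
  proof (rule ccontr)
    assume neg: "\<not> ?thesis"
    have "x \<in> S1" using x dyadic_points_S1 by blast
    then have "orient p q r * orient p q x < 0" "orient p q s * orient p q x < 0"
      using neg x Q by (intro third_vertices_opposite [of v]; use V in auto)+
    moreover have "orient p q r * orient p q s < 0"
      using third_vertices_opposite [OF V(2) Q(5-9) Q(11-14)] .
    ultimately show False
      by (auto simp: mult_less_0_iff)
  qed
  let ?D = "{geodesic r' s' | r' s'. \<exists>p' q'. {p', q', r', s'} \<subseteq> dyadic_points \<and>
        distinct [p', q', r', s'] \<and> geodesic p q = geodesic p' q' \<and>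
        ideal_triangle p' q' r' \<in> regions v \<and> ideal_triangle p' q' s' \<in> regions v}"
  have reg: "ideal_triangle p' q' x \<in> regions v \<longleftrightarrow>
      geodesic p' q' \<in> v \<and> geodesic q' x \<in> v \<and> geodesic x p' \<in> v"
    if "{p', q', x} \<subseteq> dyadic_points" "distinct [p', q', x]" for p' q' x
    using that by (intro arc_system_region_iff [OF v]) auto
  have "?D = {geodesic r s}"
  proof
    have "{p, q, r, s} \<subseteq> dyadic_points \<and> distinct [p, q, r, s] \<and> geodesic p q = geodesic p q \<and>
        ideal_triangle p q r \<in> regions v \<and> ideal_triangle p q s \<in> regions v"
      using reg [of p q r] reg [of p q s] Q by (simp add: open_segment_commute)
    then show "{geodesic r s} \<subseteq> ?D" by blast
    show "?D \<subseteq> {geodesic r s}"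
    proof
      fix x assume "x \<in> ?D"
      then obtain r' s' p' q' where x: "x = geodesic r' s'"
        and D: "{p', q', r', s'} \<subseteq> dyadic_points" "distinct [p', q', r', s']"
          "geodesic p q = geodesic p' q'"
          "ideal_triangle p' q' r' \<in> regions v" "ideal_triangle p' q' s' \<in> regions v"
        by blast
      have pq': "p' = p \<and> q' = q \<or> p' = q \<and> q' = p"
        using geodesic_eqD [OF D(3)] Q(9) by auto
      have "geodesic q' r' \<in> v \<and> geodesic r' p' \<in> v" "geodesic q' s' \<in> v \<and> geodesic s' p' \<in> v"
        using reg [of p' q' r'] reg [of p' q' s'] D by simp_all
      then have "r' = r \<or> r' = s" "s' = r \<or> s' = s"
        using third [of r'] third [of s'] pq' D(1,2) by (auto simp: open_segment_commute)
      then show "x \<in> {geodesic r s}"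
        using x D(2) by (auto simp: open_segment_commute)
    qed
  qed
  then show ?thesis
    unfolding flip_def by auto
qed

lemma flip_cases:
  assumes v: "arc_system v" and a: "a \<in> v"
  obtains p q r s where "a = geodesic p q" "quad_in v p q r s"
    "flip v a = insert (geodesic r s) (v - {a})" "arc_system (flip v a)"
proof -
  obtain p q where pq: "a = geodesic p q" "p \<in> dyadic_points" "q \<in> dyadic_points" "p \<noteq> q"
    using a arc_systemD(1) [OF v] arcsE by (metis subsetD)
  then obtain r s where q: "quad_in v p q r s"
    using quad_exists [OF v] a by metis
  show thesis
    using that [OF pq(1) q] flip_quad [OF v q] exchange_arc_system [OF v q] pq(1) by simp
qed

section \<open>Lifts of Thompson maps\<close>

lemma thompson_bij:
  assumes "f \<in> thompson_maps"
  shows "bij_betw f S1 S1" "f \<in> extensional S1" "f ` dyadic_points = dyadic_points"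
    "continuous_on S1 f"
proof -
  obtain g where g: "homeomorphism S1 S1 f g"
    using assms unfolding thompson_maps_def by blast
  show "bij_betw f S1 S1"
    by (rule bij_betw_byWitness [where f' = g]) (use g in \<open>auto simp: homeomorphism_def\<close>)
  show "continuous_on S1 f"
    using g by (simp add: homeomorphism_def)
  show "f \<in> extensional S1" "f ` dyadic_points = dyadic_points"
    using assms unfolding thompson_maps_def by blast+
qed

lemma thompson_mapsI:
  assumes "f \<in> extensional S1" "homeomorphism S1 S1 f g" "f ` dyadic_points = dyadic_points"
    "continuous_on UNIV F" "strict_mono F" "\<And>x. f (circ x) = circ (F x)"
    "B \<subseteq> dyadic_points" "finite B"
    "\<And>x. circ x \<notin> B \<Longrightarrow> \<exists>(k::int) c. \<forall>\<^sub>F y in nhds x. F y = 2 powi k * y + c"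
  shows "f \<in> thompson_maps"
  unfolding thompson_maps_def mem_Collect_eq
  by (intro conjI exI [of _ g] exI [of _ F] exI [of _ B] allI impI assms)

text \<open>The lift has degree one. Its increment over a period is a positive integer, and if it were
  larger than 1 then the intermediate value theorem would give two points of the circle
  with the same image.\<close>

lemma thompson_lift:
  assumes f: "f \<in> thompson_maps"
  obtains F B where "continuous_on UNIV F" "strict_mono F" "\<And>x. f (circ x) = circ (F x)"
    "\<And>x. F (x + 1) = F x + 1" "B \<subseteq> dyadic_points" "finite B"
    "\<And>x. circ x \<notin> B \<Longrightarrow> \<exists>(k::int) c. \<forall>\<^sub>F y in nhds x. F y = 2 powi k * y + c"
proof -
  obtain F B where F: "continuous_on UNIV F" "strict_mono F" "\<And>x. f (circ x) = circ (F x)"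
    and B: "B \<subseteq> dyadic_points" "finite B"
    "\<And>x. circ x \<notin> B \<Longrightarrow> \<exists>(k::int) c. \<forall>\<^sub>F y in nhds x. F y = 2 powi k * y + c"
    using f by (auto simp: thompson_maps_def)
  have "F (x + 1) = F x + 1" for x
  proof -
    have "circ (F (x + 1)) = circ (F x)"
      using F(3) [of "x + 1"] F(3) [of x] by simp
    then obtain k :: int where k: "F (x + 1) = F x + of_int k"
      by (auto simp: circ_eq_iff)
    have "F x < F (x + 1)"
      using F(2) by (simp add: strict_monoD)
    then have "0 < k" using k by simp
    moreover have "\<not> 1 < k"
    proof
      assume "1 < k"
      then have "F x \<le> F x + 1" "F x + 1 \<le> F (x + 1)"
        using k by simp_all
      then obtain y where y: "x \<le> y" "y \<le> x + 1" "F y = F x + 1"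
        using IVT' [of F x "F x + 1" "x + 1"] continuous_on_subset [OF F(1) subset_UNIV] by auto
      then have "f (circ y) = f (circ x)"
        using F(3) by simp
      then have "circ y = circ x"
        using thompson_bij(1) [OF f] by (auto simp: bij_betw_def inj_on_def)
      then obtain j :: int where "y = x + of_int j"
        by (auto simp: circ_eq_iff)
      moreover have "y \<noteq> x" using y(3) by auto
      moreover have "y \<noteq> x + 1" using y(3) k \<open>1 < k\<close> by auto
      ultimately show False using y(1,2) by auto
    qed
    ultimately have "k = 1" by linarith
    then show ?thesis using k by simp
  qed
  then show thesis using that F B by blast
qed

lemma lift_add_int:
  fixes F :: "real \<Rightarrow> real"
  assumes "\<And>x. F (x + 1) = F x + 1"
  shows "F (x + of_int k) = F x + of_int k"
proof (induction k rule: int_induct [where k = 0])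
  case (step1 i)
  then show ?case using assms [of "x + of_int i"] by (simp add: algebra_simps)
next
  case (step2 i)
  then show ?case using assms [of "x + of_int i - 1"] by (simp add: algebra_simps)
qed simp

lemma lift_surj:
  fixes F :: "real \<Rightarrow> real"
  assumes "continuous_on UNIV F" "\<And>x. F (x + 1) = F x + 1"
  shows "surj F"
proof -
  have "\<exists>x. F x = y" for y
  proof -
    define n where "n = \<lfloor>y - F 0\<rfloor>"
    have "F (of_int n) = F 0 + of_int n" "F (of_int n + 1) = F 0 + of_int n + 1"
      using lift_add_int [of F 0 n] assms(2) by simp_all
    then have "F (of_int n) \<le> y" "y \<le> F (of_int n + 1)"
      unfolding n_def by linarith+
    then show ?thesis
      using IVT' [of F "of_int n" y "of_int n + 1"] continuous_on_subset [OF assms(1) subset_UNIV]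
      by auto
  qed
  then show ?thesis by (metis surjI)
qed

section \<open>Thompson maps preserve orientation\<close>

lemma thompson_S1: "f \<in> thompson_maps \<Longrightarrow> p \<in> S1 \<Longrightarrow> f p \<in> S1"
  using thompson_bij(1) bij_betwE by blast

lemma thompson_inj: "\<lbrakk>f \<in> thompson_maps; p \<in> S1; q \<in> S1\<rbrakk> \<Longrightarrow> f p = f q \<longleftrightarrow> p = q"
  using thompson_bij(1) [of f] by (auto simp: bij_betw_def inj_on_def)

text \<open>A strictly increasing lift of degree one preserves the cyclic order, and the sign of the
  orientation encodes the cyclic order.\<close>

lemma thompson_orient:
  assumes f: "f \<in> thompson_maps" and S1: "p \<in> S1" "q \<in> S1" "r \<in> S1"
  shows "sgn (orient (f p) (f q) (f r)) = sgn (orient p q r)"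
proof -
  obtain F where F: "strict_mono F" "\<And>x. f (circ x) = circ (F x)" "\<And>x. F (x + 1) = F x + 1"
    using thompson_lift [OF f] by metis
  have pos: "0 < orient (f p) (f q) (f r)"
    if pqr: "0 < orient p q r" "p \<in> S1" "q \<in> S1" "r \<in> S1" for p q r
  proof -
    obtain a where a: "p = circ a"
      using pqr(2) by (rule circ_lift)
    obtain b c where bc: "q = circ b" "r = circ c" "a < b" "b < c" "c < a + 1"
      using orient_pos_lifts [OF a pqr(3,4,1)] by metis
    have "F a < F b" "F b < F c" "F c < F a + 1"
      using strict_monoD [OF F(1)] bc(3-5) F(3) [of a] by metis+
    then show ?thesis
      unfolding a bc(1,2) F(2) by (rule orient_circ_pos)
  qed
  consider "orient p q r = 0" | "0 < orient p q r" | "0 < orient q p r"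
    using orient_swap [of p q r] by linarith
  then show ?thesis
  proof cases
    case 1
    then have "p = q \<or> r = p \<or> r = q"
      using orient_eq_0 S1 by blast
    then show ?thesis using 1 by auto
  next
    case 2
    then show ?thesis using pos S1 by simp
  next
    case 3
    then have "0 < orient (f q) (f p) (f r)"
      using pos S1 by simp
    then show ?thesis
      using 3 orient_swap [of q p r] orient_swap [of "f q" "f p" "f r"] by simp
  qed
qed

lemma thompson_compat:
  assumes f: "f \<in> thompson_maps" and S1: "p \<in> S1" "q \<in> S1" "r \<in> S1" "s \<in> S1" "p \<noteq> q" "r \<noteq> s"
  shows "compat (geodesic (f p) (f q)) (geodesic (f r) (f s)) \<longleftrightarrow>
     compat (geodesic p q) (geodesic r s)"
proof -
  have "sgn (orient (f p) (f q) (f r) * orient (f p) (f q) (f s)) =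
      sgn (orient p q r * orient p q s)"
    using thompson_orient [OF f] S1 by (simp add: sgn_mult)
  then have "0 \<le> orient (f p) (f q) (f r) * orient (f p) (f q) (f s) \<longleftrightarrow>
      0 \<le> orient p q r * orient p q s"
    by (metis sgn_less not_less zero_le_sgn_iff)
  then show ?thesis
    using S1 thompson_S1 [OF f] thompson_inj [OF f] by (simp add: compat_iff_orient)
qed


section \<open>Thompson maps form a group\<close>

lemma thompson_compose:
  assumes f: "f \<in> thompson_maps" and g: "g \<in> thompson_maps"
  shows "compose S1 f g \<in> thompson_maps"
proof -
  obtain F B where F: "continuous_on UNIV F" "strict_mono F" "\<And>x. f (circ x) = circ (F x)"
    "B \<subseteq> dyadic_points" "finite B"
    "\<And>x. circ x \<notin> B \<Longrightarrow> \<exists>(k::int) c. \<forall>\<^sub>F y in nhds x. F y = 2 powi k * y + c"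
    using thompson_lift [OF f] by metis
  obtain G A where G: "continuous_on UNIV G" "strict_mono G" "\<And>x. g (circ x) = circ (G x)"
    "A \<subseteq> dyadic_points" "finite A"
    "\<And>x. circ x \<notin> A \<Longrightarrow> \<exists>(k::int) c. \<forall>\<^sub>F y in nhds x. G y = 2 powi k * y + c"
    using thompson_lift [OF g] by metis
  obtain f' where f': "homeomorphism S1 S1 f f'"
    using f by (auto simp: thompson_maps_def)
  obtain g' where g': "homeomorphism S1 S1 g g'"
    using g by (auto simp: thompson_maps_def)
  have eq: "compose S1 f g p = f (g p)" if "p \<in> S1" for p
    using that by (simp add: compose_eq)
  have inv_g: "inv_into S1 g (g p) = p" if "p \<in> S1" for p
    using thompson_bij(1) [OF g] that by (simp add: bij_betw_def inv_into_f_f)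
  \<comment> \<open>break points of \<open>g\<close>, and points sent by \<open>g\<close> to break points of \<open>f\<close>\<close>
  define C where "C = A \<union> inv_into S1 g ` B"
  show ?thesis
  proof (rule thompson_mapsI [where F = "F \<circ> G" and B = C and g = "g' \<circ> f'"])
    show "compose S1 f g \<in> extensional S1"
      by (rule compose_extensional)
    show "homeomorphism S1 S1 (compose S1 f g) (g' \<circ> f')"
      by (rule homeomorphism_cong [OF homeomorphism_compose [OF g' f']]) (simp_all add: eq)
    show "compose S1 f g ` dyadic_points = dyadic_points"
    proof -
      have "compose S1 f g ` dyadic_points = f ` (g ` dyadic_points)"
        using eq dyadic_points_S1 by force
      then show ?thesis
        using thompson_bij(3) f g by simp
    qed
    show "continuous_on UNIV (F \<circ> G)"
      by (rule continuous_on_compose [OF G(1) continuous_on_subset [OF F(1) subset_UNIV]])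
    show "strict_mono (F \<circ> G)"
      using F(2) G(2) by (simp add: strict_mono_def)
    show "compose S1 f g (circ x) = circ ((F \<circ> G) x)" for x
      using F(3) G(3) by (simp add: eq)
    have "inv_into S1 g ` B \<subseteq> dyadic_points"
    proof
      fix p assume "p \<in> inv_into S1 g ` B"
      then obtain b where b: "b \<in> B" "p = inv_into S1 g b" by blast
      then obtain d where "d \<in> dyadic_points" "b = g d"
        using F(4) thompson_bij(3) [OF g] by blast
      then show "p \<in> dyadic_points"
        using b inv_g dyadic_points_S1 by simp
    qed
    then show "C \<subseteq> dyadic_points" "finite C"
      using F(5) G(4,5) by (auto simp: C_def)
    show "\<exists>(k::int) c. \<forall>\<^sub>F y in nhds x. (F \<circ> G) y = 2 powi k * y + c"
      if x: "circ x \<notin> C" for x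
    proof -
      have "circ (G x) \<notin> B"
        using x inv_g [of "circ x"] G(3) [of x] unfolding C_def by (metis UnI2 circ_in_S1 image_eqI)
      then obtain k :: int and c where k: "\<forall>\<^sub>F y in nhds (G x). F y = 2 powi k * y + c"
        using F(6) by blast
      obtain l :: int and d where l: "\<forall>\<^sub>F y in nhds x. G y = 2 powi l * y + d"
        using G(6) x unfolding C_def by blast
      have "(G \<longlongrightarrow> G x) (nhds x)"
        using G(1) by (simp add: continuous_on_eq_continuous_at continuous_at tendsto_at_iff_tendsto_nhds)
      then have "\<forall>\<^sub>F y in nhds x. F (G y) = 2 powi k * G y + c"
        by (rule eventually_compose_filterlim [OF k])
      with l have "\<forall>\<^sub>F y in nhds x. (F \<circ> G) y = 2 powi (k + l) * y + (2 powi k * d + c)"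
        by eventually_elim (simp add: power_int_add algebra_simps)
      then show ?thesis by blast
    qed
  qed
qed

lemma thompson_inverse:
  assumes f: "f \<in> thompson_maps"
  shows "restrict (inv_into S1 f) S1 \<in> thompson_maps"
proof -
  obtain F B where F: "continuous_on UNIV F" "strict_mono F" "\<And>x. f (circ x) = circ (F x)"
    "\<And>x. F (x + 1) = F x + 1" "B \<subseteq> dyadic_points" "finite B"
    "\<And>x. circ x \<notin> B \<Longrightarrow> \<exists>(k::int) c. \<forall>\<^sub>F y in nhds x. F y = 2 powi k * y + c"
    by (rule thompson_lift [OF f]) (rule that)
  let ?g = "restrict (inv_into S1 f) S1"
  have inv_f: "inv_into S1 f (f p) = p" if "p \<in> S1" for p
    using thompson_bij(1) [OF f] that by (simp add: bij_betw_def inv_into_f_f)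
  obtain f' where f': "homeomorphism S1 S1 f f'"
    using f by (auto simp: thompson_maps_def)
  have "?g y = f' y" if y: "y \<in> S1" for y
  proof -
    have "f' y \<in> S1" "f (f' y) = y"
      using f' y by (auto simp: homeomorphism_def)
    then show ?thesis using inv_f [of "f' y"] y by simp
  qed
  note g_eq = this
  define G where "G = inv_into UNIV F"
  have "surj F" "inj F"
    using lift_surj F strict_mono_imp_inj_on by blast+
  then have FG: "F (G y) = y" and GF: "G (F x) = x" for x y
    by (simp_all add: G_def surj_f_inv_f)
  have mono: "strict_mono G"
    by (rule strict_monoI) (use F(2) FG in \<open>metis not_less strict_mono_less_eq\<close>)
  have cont: "continuous_on UNIV G"
  proof (rule continuous_onI_mono)
    have "range G = UNIV"
      using GF by (metis surjI)
    then show "open (range G)" by simp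
    show "G x \<le> G y" if "x \<le> y" for x y
      using that mono by (simp add: strict_mono_less_eq)
  qed
  show ?thesis
  proof (rule thompson_mapsI [where F = G and B = "f ` B" and g = f])
    show "homeomorphism S1 S1 ?g f"
      by (rule homeomorphism_cong [OF homeomorphism_symD [OF f']]) (simp_all add: g_eq del: restrict_apply)
    show "?g \<in> extensional S1" by simp
    show "continuous_on UNIV G" "strict_mono G" by (fact cont mono)+
    show "?g ` dyadic_points = dyadic_points"
    proof -
      have "?g ` dyadic_points = inv_into S1 f ` dyadic_points"
        using dyadic_points_S1 by force
      also have "\<dots> = inv_into S1 f ` f ` dyadic_points"
        using thompson_bij(3) [OF f] by simp
      also have "\<dots> = dyadic_points"
        using inv_f dyadic_points_S1 by force
      finally show ?thesis .
    qed
    show "?g (circ y) = circ (G y)" for y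
      using inv_f [of "circ (G y)"] F(3) [of "G y"] by (simp add: FG)
    show "f ` B \<subseteq> dyadic_points" "finite (f ` B)"
      using thompson_bij(3) [OF f] F(5,6) by auto
    show "\<exists>(k::int) c. \<forall>\<^sub>F y in nhds x. G y = 2 powi k * y + c"
      if x: "circ x \<notin> f ` B" for x
    proof -
      have "circ (G x) \<notin> B"
        using x F(3) [of "G x"] by (metis FG image_eqI)
      then obtain k :: int and c where k: "\<forall>\<^sub>F y in nhds (G x). F y = 2 powi k * y + c"
        using F(7) by blast
      have "(G \<longlongrightarrow> G x) (nhds x)"
        using cont
        by (simp add: continuous_on_eq_continuous_at continuous_at tendsto_at_iff_tendsto_nhds)
      then have "\<forall>\<^sub>F y in nhds x. F (G y) = 2 powi k * G y + c"
        by (rule eventually_compose_filterlim [OF k])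
      then have "\<forall>\<^sub>F y in nhds x. G y = 2 powi (- k) * y + (- c) * 2 powi (- k)"
      proof eventually_elim
        case (elim y)
        then have "y = 2 powi k * G y + c" by (simp add: FG)
        then have "2 powi (- k) * (y - c) = 2 powi (- k) * 2 powi k * G y"
          by simp
        also have "2 powi (- k) * 2 powi k = (1::real)"
          by (simp flip: power_int_add)
        finally show ?case by (simp add: algebra_simps)
      qed
      then show ?thesis by blast
    qed
  qed
qed

lemma thompson_id: "(\<lambda>x\<in>S1. x) \<in> thompson_maps"
proof (rule thompson_mapsI [where F = "\<lambda>x. x" and B = "{}" and g = "\<lambda>x. x"])
  show "homeomorphism S1 S1 (\<lambda>x\<in>S1. x) (\<lambda>x. x)"
    by (rule homeomorphism_cong [OF homeomorphism_ident]) auto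
  show "(\<lambda>x\<in>S1. x) ` dyadic_points = dyadic_points"
    using dyadic_points_S1 by force
  have "\<forall>\<^sub>F y in nhds x. y = 2 powi 0 * y + 0" for x :: real
    by simp
  then show "\<exists>(k::int) c. \<forall>\<^sub>F y in nhds x. y = 2 powi k * y + c" for x :: real
    by blast
qed (simp_all add: strict_mono_def)

lemma thompson_subgroup: "subgroup thompson_maps (BijGroup S1)"
proof (rule group.subgroupI [OF group_BijGroup])
  have Bij: "f \<in> Bij S1" if "f \<in> thompson_maps" for f
    using thompson_bij [OF that] by (simp add: Bij_def)
  show "thompson_maps \<subseteq> carrier (BijGroup S1)"
    using Bij by (auto simp: BijGroup_def)
  show "thompson_maps \<noteq> {}"
    using thompson_id by blast
  show "inv\<^bsub>BijGroup S1\<^esub> f \<in> thompson_maps" if "f \<in> thompson_maps" for f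
    using that Bij thompson_inverse by (simp add: inv_BijGroup)
  show "f \<otimes>\<^bsub>BijGroup S1\<^esub> g \<in> thompson_maps" if "f \<in> thompson_maps" "g \<in> thompson_maps" for f g
    using that Bij thompson_compose by (simp add: BijGroup_def)
qed

lemma thompson_group: "group thompson_T"
  unfolding thompson_T_def
  by (rule group.subgroup_imp_group [OF group_BijGroup thompson_subgroup])

lemma thompson_T_mult: "\<lbrakk>f \<in> thompson_maps; g \<in> thompson_maps\<rbrakk>
    \<Longrightarrow> f \<otimes>\<^bsub>thompson_T\<^esub> g = compose S1 f g"
  using thompson_bij [of f] thompson_bij [of g]
  by (simp add: thompson_T_def BijGroup_def Bij_def)

section \<open>The action on arcs\<close>

text \<open>An arc is a set of points of the disc, on which \<open>f\<close> does not act; it is carried along by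
  its endpoints. The union ranges over the two ways to order them, which give the same geodesic.\<close>

definition arc_image :: "(complex \<Rightarrow> complex) \<Rightarrow> complex set \<Rightarrow> complex set" where
  "arc_image f a = (\<Union>(p, q) \<in> {(p, q). p \<noteq> q \<and> a = geodesic p q}. geodesic (f p) (f q))"

lemma arc_image_geodesic [simp]:
  assumes "p \<noteq> q"
  shows "arc_image f (geodesic p q) = geodesic (f p) (f q)"
proof
  show "geodesic (f p) (f q) \<subseteq> arc_image f (geodesic p q)"
    using assms unfolding arc_image_def by blast
  show "arc_image f (geodesic p q) \<subseteq> geodesic (f p) (f q)"
  proof
    fix z assume "z \<in> arc_image f (geodesic p q)"
    then obtain p' q' where "geodesic p q = geodesic p' q'" "z \<in> geodesic (f p') (f q')"
      unfolding arc_image_def by blast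
    then show "z \<in> geodesic (f p) (f q)"
      using geodesic_eqD [OF _ assms] open_segment_commute by metis
  qed
qed

lemma thompson_dyadic_iff:
  assumes "f \<in> thompson_maps" "p \<in> S1"
  shows "f p \<in> dyadic_points \<longleftrightarrow> p \<in> dyadic_points"
proof
  assume "f p \<in> dyadic_points"
  then obtain q where "q \<in> dyadic_points" "f p = f q"
    using thompson_bij(3) [OF assms(1)] by blast
  then show "p \<in> dyadic_points"
    using thompson_inj assms dyadic_points_S1 by metis
qed (use thompson_bij(3) [OF assms(1)] in blast)

lemma arc_image_arc:
  assumes "f \<in> thompson_maps" "a \<in> arcs"
  shows "arc_image f a \<in> arcs"
proof -
  obtain p q where pq: "a = geodesic p q" "p \<in> dyadic_points" "q \<in> dyadic_points" "p \<noteq> q"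
    using assms(2) by (rule arcsE)
  then show ?thesis
    using assms(1) thompson_dyadic_iff thompson_inj dyadic_points_S1
    by (simp add: arcsI)
qed

lemma inj_on_arc_image:
  assumes f: "f \<in> thompson_maps"
  shows "inj_on (arc_image f) arcs"
proof
  fix a b assume ab: "a \<in> arcs" "b \<in> arcs" "arc_image f a = arc_image f b"
  obtain p q where pq: "a = geodesic p q" "p \<in> S1" "q \<in> S1" "p \<noteq> q"
    using ab(1) by (rule arcs_S1E)
  obtain r s where rs: "b = geodesic r s" "r \<in> S1" "s \<in> S1" "r \<noteq> s"
    using ab(2) by (rule arcs_S1E)
  have "f p \<noteq> f q" "geodesic (f p) (f q) = geodesic (f r) (f s)"
    using pq rs ab(3) thompson_inj [OF f] by simp_all
  then have "f p = f r \<and> f q = f s \<or> f p = f s \<and> f q = f r"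
    using geodesic_eqD by blast
  then show "a = b"
    using thompson_inj [OF f] pq rs open_segment_commute by metis
qed

lemma act_eq_image:
  assumes f: "f \<in> thompson_maps" and v: "v \<subseteq> arcs"
  shows "act f v = arc_image f ` v"
proof
  have inv: "inv_into S1 f (f p) = p" if "p \<in> S1" for p
    using thompson_bij(1) [OF f] that by (simp add: bij_betw_def inv_into_f_f)
  show "arc_image f ` v \<subseteq> act f v"
  proof
    fix b assume "b \<in> arc_image f ` v"
    then obtain a where a: "a \<in> v" "b = arc_image f a" by blast
    then obtain p q where pq: "a = geodesic p q" "p \<in> dyadic_points" "q \<in> dyadic_points" "p \<noteq> q"
      using v by (blast elim: arcsE)
    then have S1: "p \<in> S1" "q \<in> S1"
      using dyadic_points_S1 by blast+
    have "b = geodesic (f p) (f q)" "f p \<in> dyadic_points" "f q \<in> dyadic_points" "f p \<noteq> f q"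
      using a(2) pq S1 thompson_dyadic_iff [OF f] thompson_inj [OF f] by simp_all
    moreover have "geodesic (inv_into S1 f (f p)) (inv_into S1 f (f q)) \<in> v"
      using a(1) pq(1) inv S1 by simp
    ultimately show "b \<in> act f v"
      unfolding act_def by blast
  qed
  show "act f v \<subseteq> arc_image f ` v"
  proof
    fix b assume "b \<in> act f v"
    then obtain p q where b: "b = geodesic p q" "p \<in> dyadic_points" "q \<in> dyadic_points" "p \<noteq> q"
      "geodesic (inv_into S1 f p) (inv_into S1 f q) \<in> v"
      unfolding act_def by blast
    obtain p' q' where pq': "p = f p'" "q = f q'" "p' \<in> dyadic_points" "q' \<in> dyadic_points"
      using b(2,3) thompson_bij(3) [OF f] by blast
    have "geodesic p' q' \<in> v"
      using b(5) pq' inv dyadic_points_S1 by simp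
    moreover have "b = arc_image f (geodesic p' q')"
      using b(1,4) pq' arc_image_geodesic [of p' q' f] by metis
    ultimately show "b \<in> arc_image f ` v" by blast
  qed
qed

lemma arc_image_compose:
  assumes "f \<in> thompson_maps" "g \<in> thompson_maps" "a \<in> arcs"
  shows "arc_image (compose S1 f g) a = arc_image f (arc_image g a)"
proof -
  obtain p q where pq: "a = geodesic p q" "p \<in> S1" "q \<in> S1" "p \<noteq> q"
    using assms(3) by (rule arcs_S1E)
  then show ?thesis
    using thompson_inj [OF assms(2)] by (simp add: compose_eq)
qed

lemma arc_image_id:
  assumes "a \<in> arcs"
  shows "arc_image (\<lambda>x\<in>S1. x) a = a"
proof -
  obtain p q where pq: "a = geodesic p q" "p \<in> S1" "q \<in> S1" "p \<noteq> q"
    using assms by (rule arcs_S1E)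
  then show ?thesis by simp
qed

lemma thompson_inverse_compose:
  assumes "f \<in> thompson_maps"
  shows "compose S1 (restrict (inv_into S1 f) S1) f = (\<lambda>x\<in>S1. x)"
    "compose S1 f (restrict (inv_into S1 f) S1) = (\<lambda>x\<in>S1. x)"
proof -
  have b: "bij_betw f S1 S1" by (rule thompson_bij(1) [OF assms])
  show "compose S1 (restrict (inv_into S1 f) S1) f = (\<lambda>x\<in>S1. x)"
    using b by (intro compose_inv_into_id) auto
  show "compose S1 f (restrict (inv_into S1 f) S1) = (\<lambda>x\<in>S1. x)"
    using b by (auto simp: compose_def bij_betw_def f_inv_into_f fun_eq_iff restrict_def)
qed

lemma arc_image_inverse:
  assumes "f \<in> thompson_maps" "a \<in> arcs"
  shows "arc_image (restrict (inv_into S1 f) S1) (arc_image f a) = a"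
    "arc_image f (arc_image (restrict (inv_into S1 f) S1) a) = a"
  using assms arc_image_compose arc_image_id thompson_inverse thompson_inverse_compose
  by metis+

lemma arc_image_compat:
  assumes f: "f \<in> thompson_maps" and "a \<in> arcs" "b \<in> arcs"
  shows "compat (arc_image f a) (arc_image f b) \<longleftrightarrow> compat a b"
proof -
  obtain p q where pq: "a = geodesic p q" "p \<in> S1" "q \<in> S1" "p \<noteq> q"
    using assms(2) by (rule arcs_S1E)
  obtain r s where rs: "b = geodesic r s" "r \<in> S1" "s \<in> S1" "r \<noteq> s"
    using assms(3) by (rule arcs_S1E)
  show ?thesis
    using thompson_compat [OF f] pq rs by simp
qed


section \<open>Thompson maps send small standard arcs to standard arcs\<close>

text \<open>Slope and offset are locally constant, hence constant on a connected interval without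
  break points, and continuity extends the formula to the ends.\<close>

lemma locally_affine_on_interval:
  fixes F :: "real \<Rightarrow> real"
  assumes cont: "continuous_on UNIV F" and ab: "a < b"
    and loc: "\<And>x. a < x \<Longrightarrow> x < b \<Longrightarrow> \<exists>(k::int) c. \<forall>\<^sub>F y in nhds x. F y = 2 powi k * y + c"
  obtains k :: int and c where "\<And>x. a \<le> x \<Longrightarrow> x \<le> b \<Longrightarrow> F x = 2 powi k * x + c"
proof -
  obtain K C where KC: "\<And>x. a < x \<Longrightarrow> x < b \<Longrightarrow> \<forall>\<^sub>F y in nhds x. F y = 2 powi (K x :: int) * y + C x"
    using loc by metis
  have eq: "\<forall>\<^sub>F y in at x within {a<..<b}. (K x, C x) = (K y, C y)" if x: "x \<in> {a<..<b}" for x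
  proof -
    have "\<forall>\<^sub>F y in nhds x. F y = 2 powi (K x) * y + C x"
      using KC x by simp
    then have "\<forall>\<^sub>F y in nhds x. \<forall>\<^sub>F z in nhds y. F z = 2 powi (K x) * z + C x"
      by (simp add: eventually_eventually)
    then have "\<forall>\<^sub>F y in at x within {a<..<b}. \<forall>\<^sub>F z in nhds y. F z = 2 powi (K x) * z + C x"
      by (auto simp: eventually_at_filter elim: eventually_mono)
    moreover have "\<forall>\<^sub>F y in at x within {a<..<b}. y \<in> {a<..<b}"
      by (simp add: eventually_at_filter)
    ultimately show ?thesis
    proof eventually_elim
      case (elim y)
      have "\<forall>\<^sub>F z in nhds y. F z = 2 powi (K y) * z + C y"
        using KC elim(2) by simp
      with elim(1) have ev: "\<forall>\<^sub>F z in nhds y. 2 powi (K x) * z + C x = 2 powi (K y) * z + C y"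
        by eventually_elim simp
      then have y: "2 powi (K x) * y + C x = 2 powi (K y) * y + C y"
        by (rule eventually_nhds_x_imp_x)
      have "\<forall>\<^sub>F z in at y. 2 powi (K x) * z + C x = 2 powi (K y) * z + C y \<and> z \<noteq> y"
        using ev by (simp add: eventually_at_filter eventually_mono)
      then obtain z where z: "2 powi (K x) * z + C x = 2 powi (K y) * z + C y" "z \<noteq> y"
        using eventually_happens' [OF at_neq_bot] by blast
      have "(2 powi (K x) - 2 powi (K y)) * (z - y) = 0"
        using y z(1) by (simp add: algebra_simps)
      then have "(2::real) powi (K x) = 2 powi (K y)"
        using z(2) by simp
      moreover from this have "K x = K y"
        by (smt (verit) power_int_strict_increasing)
      ultimately show ?case using y by simp
    qed
  qed
  define m where "m = (a + b) / 2"
  have m: "m \<in> {a<..<b}" using ab by (simp add: m_def)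
  have "(\<lambda>x. (K x, C x)) constant_on {a<..<b}"
  proof -
    have "\<exists>A. \<forall>x\<in>{a<..<b}. (K x, C x) = A"
      using connected_local_const [of "{a<..<b}" _ _ "\<lambda>x. (K x, C x)"] eq m
      by (metis connected_Ioo)
    then show ?thesis by (simp add: constant_on_def)
  qed
  then have const: "K x = K m \<and> C x = C m" if "x \<in> {a<..<b}" for x
    using that m unfolding constant_on_def by (metis Pair_inject)
  have inner: "F x = 2 powi (K m) * x + C m" if x: "x \<in> {a<..<b}" for x
    using eventually_nhds_x_imp_x [OF KC [of x]] const [OF x] x by simp
  have "F x = 2 powi (K m) * x + C m" if x: "a \<le> x" "x \<le> b" for x
  proof -
    have "closed {x. F x = 2 powi (K m) * x + C m}"
      by (intro closed_Collect_eq continuous_intros cont)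
    moreover have "{a<..<b} \<subseteq> {x. F x = 2 powi (K m) * x + C m}"
      using inner by blast
    ultimately have "closure {a<..<b} \<subseteq> {x. F x = 2 powi (K m) * x + C m}"
      by (rule closure_minimal [rotated])
    then show ?thesis using x ab by auto
  qed
  then show thesis by (rule that)
qed

lemma dyadic_add: "\<lbrakk>x \<in> dyadic; y \<in> dyadic\<rbrakk> \<Longrightarrow> x + y \<in> dyadic"
proof -
  assume "x \<in> dyadic" "y \<in> dyadic"
  then obtain a b :: int and m n :: nat where "x = a / 2 ^ m" "y = b / 2 ^ n"
    by (auto simp: dyadic_def)
  then have "x + y = of_int (a * 2 ^ n + b * 2 ^ m) / 2 ^ (m + n)"
    by (simp add: power_add add_divide_distrib)
  then show ?thesis unfolding dyadic_def by blast
qed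

lemma dyadic_mult: "\<lbrakk>x \<in> dyadic; y \<in> dyadic\<rbrakk> \<Longrightarrow> x * y \<in> dyadic"
proof -
  assume "x \<in> dyadic" "y \<in> dyadic"
  then obtain a b :: int and m n :: nat where "x = a / 2 ^ m" "y = b / 2 ^ n"
    by (auto simp: dyadic_def)
  then have "x * y = of_int (a * b) / 2 ^ (m + n)"
    by (simp add: power_add)
  then show ?thesis unfolding dyadic_def by blast
qed

lemma dyadic_int [simp]: "of_int k \<in> dyadic"
  unfolding dyadic_def by (rule CollectI, rule exI [of _ k], rule exI [of _ 0]) simp

lemma dyadic_minus: "x \<in> dyadic \<Longrightarrow> - x \<in> dyadic"
  using dyadic_mult [of "of_int (- 1)" x] by (simp del: of_int_minus add: dyadic_int) simp

lemma dyadic_diff: "\<lbrakk>x \<in> dyadic; y \<in> dyadic\<rbrakk> \<Longrightarrow> x - y \<in> dyadic"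
  using dyadic_add [of x "- y"] dyadic_minus by simp

lemma dyadic_powi: "2 powi k \<in> dyadic"
proof (cases "0 \<le> k")
  case True
  then have "(2::real) powi k = of_int (2 ^ nat k)"
    by (simp add: power_int_def)
  then show ?thesis by (simp only: dyadic_int)
next
  case False
  then have "(2::real) powi k = of_int 1 / 2 ^ nat (- k)"
    by (simp add: power_int_def field_simps)
  then show ?thesis unfolding dyadic_def by blast
qed

lemma dyadic_grid [simp]: "grid n k \<in> dyadic"
  unfolding grid_def dyadic_def by blast

lemma circ_dyadic_iff: "circ x \<in> dyadic_points \<longleftrightarrow> x \<in> dyadic"
proof
  assume "circ x \<in> dyadic_points"
  then obtain y where y: "y \<in> dyadic" "circ x = circ y"
    by (auto simp: dyadic_points_def)
  then obtain k :: int where "x = y + of_int k"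
    by (auto simp: circ_eq_iff)
  then show "x \<in> dyadic"
    using y(1) dyadic_add by simp
qed (auto simp: dyadic_points_def)

lemma finite_dyadic_level:
  assumes "finite B" "B \<subseteq> dyadic_points"
  obtains N where "B \<subseteq> level N"
proof -
  have "\<exists>N. B \<subseteq> level N"
    using assms
  proof (induction B rule: finite_induct)
    case (insert p B)
    then obtain N where "B \<subseteq> level N" by auto
    moreover obtain n where "p \<in> level n"
      using insert.prems by (auto elim: dyadic_level)
    ultimately have "insert p B \<subseteq> level (max n N)"
      using level_mono [of n "max n N"] level_mono [of N "max n N"] by auto
    then show ?case by blast
  qed auto
  then show thesis using that by blast
qed

text \<open>An affine map with slope \<open>2 powi k\<close> and dyadic offset sends a standard dyadic interval of
  high level \<open>m\<close> to one of level \<open>m - k\<close>; the bound on the level makes the offset an integer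
  multiple of the new mesh.\<close>

lemma affine_grid:
  assumes c: "c \<in> dyadic"
  obtains m0 where "\<And>m. m0 \<le> m \<Longrightarrow> \<exists>n'\<ge>n. \<forall>j. \<exists>i. 
    2 powi k * grid m j + c = grid n' i \<and> 2 powi k * grid m (j + 1) + c = grid n' (i + 1)"
proof -
  obtain b :: int and l :: nat where bl: "c = b / 2 ^ l"
    using c by (auto simp: dyadic_def)
  define m0 where "m0 = n + l + nat \<bar>k\<bar>"
  have "\<exists>n'\<ge>n. \<forall>j. \<exists>i. 
    2 powi k * grid m j + c = grid n' i \<and> 2 powi k * grid m (j + 1) + c = grid n' (i + 1)"
    if m: "m0 \<le> m" for m
  proof -
    \<comment> \<open>the slope \<open>2 powi k\<close> lowers the level by \<open>k\<close>\<close>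
    define n' where "n' = nat (int m - k)"
    have n': "int n' = int m - k" "n \<le> n'" "l \<le> n'"
      using m by (auto simp: n'_def m0_def)
    have pw: "(2::real) powi k / 2 ^ m = 1 / 2 ^ n'"
    proof -
      have "(2::real) ^ m = 2 powi (int m)" by simp
      also have "int m = k + int n'" using n' by simp
      also have "(2::real) powi (k + int n') = 2 powi k * 2 ^ n'"
        by (simp add: power_int_add)
      finally show ?thesis by simp
    qed
    have c': "c = of_int (b * 2 ^ (n' - l)) / 2 ^ n'"
      using n'(3) by (simp add: bl field_simps flip: power_add)
    have "2 powi k * grid m j + c = grid n' (j + b * 2 ^ (n' - l))" for j
    proof -
      have "2 powi k * grid m j = of_int j * (2 powi k / 2 ^ m)"
        by (simp add: grid_def)
      also have "\<dots> = of_int j / 2 ^ n'"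
        by (simp add: pw)
      finally show ?thesis
        by (simp add: c' grid_def add_divide_distrib)
    qed
    then have "2 powi k * grid m j + c = grid n' (j + b * 2 ^ (n' - l)) \<and>
       2 powi k * grid m (j + 1) + c = grid n' (j + b * 2 ^ (n' - l) + 1)" for j
      by (metis add.assoc add.commute)
    then show ?thesis using n'(2) by blast
  qed
  then show thesis by (rule that)
qed

text \<open>This carries the condition on standard arcs of high level over to the image of a system. The break
  points have some level \<open>N\<close>, and \<open>affine_grid\<close> applies on each of the \<open>2 ^ N\<close> intervals of this
  level, with a bound on the level that can be taken to be the same for all of them.\<close>

lemma thompson_std_arc:
  assumes f: "f \<in> thompson_maps"
  obtains m0 where "\<And>m j. m0 \<le> m \<Longrightarrow> \<exists>n'\<ge>n. \<exists>i. arc_image f (std_arc m j) = std_arc n' i"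
proof -
  obtain F B where F: "continuous_on UNIV F" "\<And>x. f (circ x) = circ (F x)"
    and B: "B \<subseteq> dyadic_points" "finite B"
    "\<And>x. circ x \<notin> B \<Longrightarrow> \<exists>(k::int) c. \<forall>\<^sub>F y in nhds x. F y = 2 powi k * y + c"
    using thompson_lift [OF f] by metis
  obtain N where N: "B \<subseteq> level N"
    using finite_dyadic_level [OF B(2,1)] .
  have "\<exists>m0. \<forall>m\<ge>m0. \<exists>n'\<ge>n. \<forall>j. grid N l \<le> grid m j \<longrightarrow> grid m (j + 1) \<le> grid N (l + 1) \<longrightarrow>
       (\<exists>i. F (grid m j) = grid n' i \<and> F (grid m (j + 1)) = grid n' (i + 1))" for l
  proof -
    have "\<exists>(k::int) c. \<forall>\<^sub>F y in nhds x. F y = 2 powi k * y + c"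
      if x: "grid N l < x" "x < grid N (l + 1)" for x
      using grid_between [of "circ x" N x l] B(3) [of x] N x by force
    then obtain k :: int and c where kc: "\<And>x. grid N l \<le> x \<Longrightarrow> x \<le> grid N (l + 1) \<Longrightarrow>
        F x = 2 powi k * x + c"
      using locally_affine_on_interval [OF F(1), of "grid N l" "grid N (l + 1)"] by auto
    have "F (grid N l) \<in> dyadic"
      using F(2) [of "grid N l"] thompson_dyadic_iff [OF f] by (metis circ_dyadic_iff circ_in_S1 dyadic_grid)
    then have "c \<in> dyadic"
      using kc [of "grid N l"] dyadic_diff [of "F (grid N l)" "2 powi k * grid N l"]
        dyadic_mult [OF dyadic_powi dyadic_grid] by simp
    then obtain m0 where m0: "\<And>m. m0 \<le> m \<Longrightarrow> \<exists>n'\<ge>n. \<forall>j. \<exists>i. 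
        2 powi k * grid m j + c = grid n' i \<and> 2 powi k * grid m (j + 1) + c = grid n' (i + 1)"
      using affine_grid [of c n k] by blast
    have "\<forall>j. grid N l \<le> grid m j \<longrightarrow> grid m (j + 1) \<le> grid N (l + 1) \<longrightarrow>
       (\<exists>i. F (grid m j) = grid n' i \<and> F (grid m (j + 1)) = grid n' (i + 1))"
      if n': "\<forall>j. \<exists>i. 2 powi k * grid m j + c = grid n' i \<and> 2 powi k * grid m (j + 1) + c = grid n' (i + 1)"
      for m n'
    proof (intro allI impI)
      fix j assume le: "grid N l \<le> grid m j" "grid m (j + 1) \<le> grid N (l + 1)"
      moreover have "grid m j \<le> grid m (j + 1)" by simp
      ultimately have "grid m j \<le> grid N (l + 1)" "grid N l \<le> grid m (j + 1)"
        by linarith+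
      then have "F (grid m j) = 2 powi k * grid m j + c"
          "F (grid m (j + 1)) = 2 powi k * grid m (j + 1) + c"
        using le kc by blast+
      then show "\<exists>i. F (grid m j) = grid n' i \<and> F (grid m (j + 1)) = grid n' (i + 1)"
        using n' by simp
    qed
    then show ?thesis using m0 by meson
  qed
  then obtain M where M: "\<And>l m. M l \<le> m \<Longrightarrow> \<exists>n'\<ge>n. \<forall>j. grid N l \<le> grid m j \<longrightarrow> grid m (j + 1) \<le> grid N (l + 1) \<longrightarrow>
       (\<exists>i. F (grid m j) = grid n' i \<and> F (grid m (j + 1)) = grid n' (i + 1))"
    by metis
  define m0 where "m0 = Max (insert (N + 1) (M ` {0..<2 ^ N}))"
  have m0: "M l \<le> m0" if "0 \<le> l" "l < 2 ^ N" for l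
    unfolding m0_def using that by (intro Max_ge) auto
  have "N + 1 \<le> m0"
    unfolding m0_def by (intro Max_ge) auto
  have "\<exists>n'\<ge>n. \<exists>i. arc_image f (std_arc m j) = std_arc n' i" if m: "m0 \<le> m" for m j
  proof -
    define j' where "j' = j mod 2 ^ m"
    have std: "std_arc m j = std_arc m j'"
      using std_arc_shift [of m j' "j div 2 ^ m"] by (simp only: j'_def mod_div_mult_eq)
    have j': "0 \<le> j'" "j' < 2 ^ m" by (simp_all add: j'_def)
    have mN: "N \<le> m" "1 \<le> m" using \<open>N + 1 \<le> m0\<close> m by auto
    define e :: int where "e = 2 ^ (m - N)"
    have e: "0 < e" "e * 2 ^ N = 2 ^ m"
      using mN by (simp_all add: e_def flip: power_add)
    define l where "l = j' div e"
    have "l * e \<le> j'" "j' < (l + 1) * e"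
      using div_mult_mod_eq [of j' e] pos_mod_sign [OF e(1), of j'] pos_mod_bound [OF e(1), of j']
      unfolding l_def distrib_right by linarith+
    then have le: "l * e \<le> j'" "j' + 1 \<le> (l + 1) * e" by simp_all
    have l: "0 \<le> l" "l < 2 ^ N"
    proof -
      show "0 \<le> l" using e j' by (simp add: l_def pos_imp_zdiv_nonneg_iff)
      have "l * e < 2 ^ N * e"
        using le j' e(2) by (simp add: mult.commute)
      then show "l < 2 ^ N" using e by simp
    qed
    have g: "grid N i = grid m (i * e)" for i
      using grid_refine [of N "m - N" i] mN by (simp add: e_def)
    obtain n' where n': "n \<le> n'" "\<forall>j. grid N l \<le> grid m j \<longrightarrow> grid m (j + 1) \<le> grid N (l + 1) \<longrightarrow>
       (\<exists>i. F (grid m j) = grid n' i \<and> F (grid m (j + 1)) = grid n' (i + 1))"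
      using M [of l m] m0 [OF l] m by auto
    have "grid N l \<le> grid m j'" "grid m (j' + 1) \<le> grid N (l + 1)"
      unfolding g using le by simp_all
    then obtain i where i: "F (grid m j') = grid n' i" "F (grid m (j' + 1)) = grid n' (i + 1)"
      using n'(2) by blast
    have "circ (grid m j') \<noteq> circ (grid m (j' + 1))"
      using two_power_int_ge [OF mN(2)] by (intro circ_grid_neq) auto
    then have "arc_image f (std_arc m j) = std_arc n' i"
      using i F(2) unfolding std by (simp add: std_arc_def)
    then show ?thesis using n'(1) by blast
  qed
  then show thesis by (rule that)
qed

text \<open>Maximality and the standard arcs of the image are obtained by pulling back along the inverse
  of \<open>f\<close>, which is again a Thompson map.\<close>

lemma arc_system_image:
  assumes f: "f \<in> thompson_maps" and v: "arc_system v"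
  shows "arc_system (arc_image f ` v)"
proof -
  let ?g = "restrict (inv_into S1 f) S1"
  note g = thompson_inverse [OF f] and V = arc_systemD [OF v]
  note fg = arc_image_inverse [OF f]
  have pull: "arc_image f a \<in> arc_image f ` v" if "a \<in> v" for a using that by blast
  show ?thesis
    unfolding arc_system_def
  proof (intro conjI ballI impI)
    show "arc_image f ` v \<subseteq> arcs"
      using arc_image_arc [OF f] V(1) by auto
    show "compat a b" if "a \<in> arc_image f ` v" "b \<in> arc_image f ` v" for a b
      using that arc_image_compat [OF f] V(1,2) by (auto simp: subset_iff)
    show "a \<in> arc_image f ` v" if a: "a \<in> arcs" "\<forall>b\<in>arc_image f ` v. compat a b" for a
    proof -
      have "arc_image ?g a \<in> v"
      proof (rule V(3))
        show "arc_image ?g a \<in> arcs"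
          by (rule arc_image_arc [OF g a(1)])
        then show "compat (arc_image ?g a) b" if "b \<in> v" for b
          using that a fg arc_image_compat [OF f, of "arc_image ?g a" b] V(1) by auto
      qed
      then show ?thesis using fg(2) [OF a(1)] by (metis imageI)
    qed
    obtain n where n: "1 \<le> n" "\<And>m k. n \<le> m \<Longrightarrow> std_arc m k \<in> v"
      using arc_system_level [OF v, of 1] by metis
    obtain m0 where m0: "\<And>m j. m0 \<le> m \<Longrightarrow> \<exists>n'\<ge>n. \<exists>i. arc_image ?g (std_arc m j) = std_arc n' i"
      using thompson_std_arc [OF g] by metis
    have "std_arc m k \<in> arc_image f ` v" if m: "max 1 m0 \<le> m" for m k
    proof -
      have "arc_image ?g (std_arc m k) \<in> v"
        using m0 [of m k] n(2) m by auto
      moreover have "std_arc m k \<in> arcs"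
        using m by (intro std_arc_in_arcs) auto
      ultimately show ?thesis using fg(2) by (metis imageI)
    qed
    then show "\<exists>n\<ge>1. \<forall>m\<ge>n. \<forall>k. std_arc m k \<in> arc_image f ` v"
      by (metis max.cobounded1)
  qed
qed

section \<open>The action on the complex\<close>

lemma act_image:
  assumes "f \<in> thompson_maps" "arc_system v"
  shows "act f v = arc_image f ` v"
  using act_eq_image [OF assms(1) arc_systemD(1) [OF assms(2)]] .

lemma act_arc_system:
  assumes "f \<in> thompson_maps" "arc_system v"
  shows "arc_system (act f v)"
  using arc_system_image [OF assms] by (simp add: act_image [OF assms])

lemma act_compose:
  assumes "f \<in> thompson_maps" "g \<in> thompson_maps" "arc_system v"
  shows "act (compose S1 f g) v = act f (act g v)"
proof -
  have "arc_image (compose S1 f g) ` v = arc_image f ` arc_image g ` v"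
    unfolding image_image
    using arc_image_compose [OF assms(1,2)] arc_systemD(1) [OF assms(3)] by (intro image_cong) auto
  then show ?thesis
    using act_image [OF thompson_compose [OF assms(1,2)] assms(3)] act_image [OF assms(2,3)]
      act_image [OF assms(1) act_arc_system [OF assms(2,3)]] by simp
qed

lemma act_id: "arc_system v \<Longrightarrow> act (\<lambda>x\<in>S1. x) v = v"
  using arc_image_id arc_systemD(1) by (simp add: act_image thompson_id subset_iff)

lemma act_inverse:
  assumes "f \<in> thompson_maps" "arc_system v"
  shows "act (restrict (inv_into S1 f) S1) (act f v) = v"
    "act f (act (restrict (inv_into S1 f) S1) v) = v"
  using assms act_compose act_id thompson_inverse thompson_inverse_compose by metis+

lemma quad_in_act:
  assumes f: "f \<in> thompson_maps" and v: "arc_system v" and q: "quad_in v p q r s"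
  shows "quad_in (act f v) (f p) (f q) (f r) (f s)"
proof -
  note Q = quad_inD [OF q]
  have "geodesic (f x) (f y) \<in> act f v" if "geodesic x y \<in> v" "x \<noteq> y" for x y
    unfolding act_image [OF f v] using that by (metis arc_image_geodesic imageI)
  then show ?thesis
    using Q thompson_dyadic_iff [OF f] thompson_inj [OF f] by (simp add: quad_in_def)
qed

lemma act_flip:
  assumes f: "f \<in> thompson_maps" and v: "arc_system v" and a: "a \<in> v"
  shows "act f (flip v a) = flip (act f v) (arc_image f a)"
proof -
  obtain p q r s where a_eq: "a = geodesic p q" and q: "quad_in v p q r s"
    and fl: "flip v a = insert (geodesic r s) (v - {a})" "arc_system (flip v a)"
    using flip_cases [OF v a] by metis
  have "p \<noteq> q" "r \<noteq> s" using quad_inD(9) [OF q] by auto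
  have "act f (flip v a) = insert (geodesic (f r) (f s)) (act f v - {arc_image f a})"
  proof -
    have "arc_image f ` (v - {a}) = arc_image f ` v - arc_image f ` {a}"
      by (rule inj_on_image_set_diff [OF inj_on_arc_image [OF f]])
        (use a arc_systemD(1) [OF v] in auto)
    then show ?thesis
      using act_image [OF f fl(2)] act_image [OF f v] fl(1) \<open>r \<noteq> s\<close> by simp
  qed
  also have "\<dots> = flip (act f v) (geodesic (f p) (f q))"
    using flip_quad [OF act_arc_system [OF f v] quad_in_act [OF f v q]] a_eq \<open>p \<noteq> q\<close> by simp
  finally show ?thesis using a_eq \<open>p \<noteq> q\<close> by simp
qed

lemma arc_image_in_act: "\<lbrakk>f \<in> thompson_maps; arc_system v; a \<in> v\<rbrakk> \<Longrightarrow> arc_image f a \<in> act f v"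
  by (simp add: act_image)

lemma region_act:
  assumes f: "f \<in> thompson_maps" and v: "arc_system v"
    and t: "{p, q, r} \<subseteq> dyadic_points" "distinct [p, q, r]" "ideal_triangle p q r \<in> regions v"
  shows "{f p, f q, f r} \<subseteq> dyadic_points" "distinct [f p, f q, f r]"
    "ideal_triangle (f p) (f q) (f r) \<in> regions (act f v)"
proof -
  show fd: "{f p, f q, f r} \<subseteq> dyadic_points" "distinct [f p, f q, f r]"
    using t thompson_dyadic_iff [OF f] thompson_inj [OF f] dyadic_points_S1 by auto
  have "geodesic p q \<in> v" "geodesic q r \<in> v" "geodesic r p \<in> v"
    using arc_system_region_iff [OF v] t by auto
  then have "geodesic (f p) (f q) \<in> act f v" "geodesic (f q) (f r) \<in> act f v"
      "geodesic (f r) (f p) \<in> act f v"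
    using arc_image_in_act [OF f v] t(2) arc_image_geodesic
    by (metis distinct_length_2_or_more)+
  then show "ideal_triangle (f p) (f q) (f r) \<in> regions (act f v)"
    using arc_system_region_iff [OF act_arc_system [OF f v]] fd by simp
qed

lemma common_triangle_act:
  assumes f: "f \<in> thompson_maps" and v: "arc_system v" and "common_triangle v a b"
  shows "common_triangle (act f v) (arc_image f a) (arc_image f b)"
proof -
  obtain p q r where t: "{p, q, r} \<subseteq> dyadic_points" "distinct [p, q, r]"
      "ideal_triangle p q r \<in> regions v" "a = geodesic p q" "b = geodesic p r"
    using assms(3) unfolding common_triangle_def by blast
  have "arc_image f a = geodesic (f p) (f q)" "arc_image f b = geodesic (f p) (f r)"
    using t(2,4,5) by simp_all
  then show ?thesis
    using region_act [OF f v t(1-3)] unfolding common_triangle_def by blast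
qed

lemma common_triangle_act_iff:
  assumes f: "f \<in> thompson_maps" and v: "arc_system v" and ab: "a \<in> v" "b \<in> v"
  shows "common_triangle (act f v) (arc_image f a) (arc_image f b) \<longleftrightarrow> common_triangle v a b"
proof
  assume "common_triangle (act f v) (arc_image f a) (arc_image f b)"
  from common_triangle_act [OF thompson_inverse [OF f] act_arc_system [OF f v] this]
  show "common_triangle v a b"
    using ab arc_systemD(1) [OF v] by (simp add: act_inverse [OF f v] arc_image_inverse [OF f] subset_iff)
qed (rule common_triangle_act [OF f v])

text \<open>Lets the second flip of a square act on an arc of the flipped vertex.\<close>

lemma mem_flip: "b \<in> v \<Longrightarrow> b \<noteq> a \<Longrightarrow> b \<in> flip v a"
  by (simp add: flip_def)

lemma flip_arc_system: "arc_system v \<Longrightarrow> a \<in> v \<Longrightarrow> arc_system (flip v a)"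
  by (rule flip_cases)

lemma square_cycle_act:
  assumes f: "f \<in> thompson_maps" and v: "arc_system v" and ab: "a \<in> v" "b \<in> v" "a \<noteq> b"
  shows "(`) (act f) ` square_cycle v a b =
     square_cycle (act f v) (arc_image f a) (arc_image f b)"
  using ab
  by (simp add: square_cycle_def act_flip [OF f] v flip_arc_system mem_flip)

text \<open>The side condition of \<open>C_pentagons\<close>: the pentagon \<open>p s q r t\<close> consists of three triangles of \<open>v\<close>, and
  \<open>p q\<close> and \<open>p r\<close> are its diagonals in \<open>v\<close>.\<close>

definition pentagon_in ::
  "complex set set \<Rightarrow> complex \<Rightarrow> complex \<Rightarrow> complex \<Rightarrow> complex \<Rightarrow> complex \<Rightarrow> bool" where
  "pentagon_in v p q r s t \<longleftrightarrow> {p, q, r, s, t} \<subseteq> dyadic_points \<and> distinct [p, q, r, s, t] \<and>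
     geodesic p q \<in> v \<and> geodesic p r \<in> v \<and>
     ideal_triangle p q r \<in> regions v \<and>
     ideal_triangle p q s \<in> regions v \<and>
     ideal_triangle p r t \<in> regions v"

lemma C_pentagons_eq:
  "C_pentagons = {pentagon_cycle v p q r s t | v p q r s t. arc_system v \<and> pentagon_in v p q r s t}"
  unfolding C_pentagons_def pentagon_in_def C_vertices_eq mem_Collect_eq ..

lemma pentagon_in_act:
  assumes f: "f \<in> thompson_maps" and v: "arc_system v" and p: "pentagon_in v p q r s t"
  shows "pentagon_in (act f v) (f p) (f q) (f r) (f s) (f t)"
proof -
  have P: "{p, q, r, s, t} \<subseteq> dyadic_points" "distinct [p, q, r, s, t]"
     "geodesic p q \<in> v" "geodesic p r \<in> v" "ideal_triangle p q r \<in> regions v"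
     "ideal_triangle p q s \<in> regions v" "ideal_triangle p r t \<in> regions v"
    using p unfolding pentagon_in_def by blast+
  have "{f p, f q, f r, f s, f t} \<subseteq> dyadic_points" "distinct [f p, f q, f r, f s, f t]"
    using P(1,2) thompson_dyadic_iff [OF f] thompson_inj [OF f] dyadic_points_S1 by auto
  moreover have "geodesic (f p) (f q) \<in> act f v" "geodesic (f p) (f r) \<in> act f v"
    using arc_image_in_act [OF f v P(3)] arc_image_in_act [OF f v P(4)] P(2) by simp_all
  ultimately show ?thesis
    using region_act(3) [OF f v] P unfolding pentagon_in_def by simp
qed

text \<open>Starting from \<open>v\<close>, flips at \<open>p q\<close> and at \<open>p r\<close> give the two neighbours on the cycle, and one more
  flip from each of them gives the other two.\<close>

lemma pentagon_vertices:
  assumes v: "arc_system v" and p: "pentagon_in v p q r s t"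
  defines "R \<equiv> v - {geodesic p q, geodesic p r}"
  shows "arc_system (R \<union> {geodesic p q, geodesic p r})"
    "arc_system (R \<union> {geodesic p r, geodesic r s})"
    "arc_system (R \<union> {geodesic r s, geodesic s t})"
    "arc_system (R \<union> {geodesic s t, geodesic t q})"
    "arc_system (R \<union> {geodesic t q, geodesic q p})"
proof -
  have P: "{p, q, r, s, t} \<subseteq> dyadic_points" "distinct [p, q, r, s, t]"
     "geodesic p q \<in> v" "geodesic p r \<in> v" "ideal_triangle p q r \<in> regions v"
     "ideal_triangle p q s \<in> regions v" "ideal_triangle p r t \<in> regions v"
    using p unfolding pentagon_in_def by blast+
  have sides: "geodesic q r \<in> v" "geodesic q s \<in> v" "geodesic p s \<in> v" "geodesic r t \<in> v" "geodesic p t \<in> v"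
    using arc_system_region_iff [OF v, of p q r] arc_system_region_iff [OF v, of p q s]
      arc_system_region_iff [OF v, of p r t] P by (auto simp: open_segment_commute)
  have neq: "geodesic a b \<noteq> geodesic c d" if "a \<noteq> b" "{a, b} \<noteq> {c, d}" for a b c d :: complex
    using that geodesic_eqD by blast
  have "R \<union> {geodesic p q, geodesic p r} = v"
    using P(3,4) unfolding R_def by blast
  then show "arc_system (R \<union> {geodesic p q, geodesic p r})"
    using v by simp
  \<comment> \<open>the flips of \<open>v\<close> at \<open>p q\<close> and at \<open>p r\<close>\<close>
  define w1 where "w1 = R \<union> {geodesic p r, geodesic r s}"
  define w4 where "w4 = R \<union> {geodesic t q, geodesic q p}"
  have d: "p \<noteq> q" "p \<noteq> r" "p \<noteq> s" "p \<noteq> t" "q \<noteq> r" "q \<noteq> s" "q \<noteq> t" "r \<noteq> s" "r \<noteq> t" "s \<noteq> t"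
    using P(2) by auto
  have inR: "geodesic a b \<in> R"
    if "geodesic a b \<in> v" "a \<noteq> b" "{a, b} \<noteq> {p, q}" "{a, b} \<noteq> {p, r}" for a b
    using that neq [of a b] by (simp add: R_def)
  have R: "geodesic p s \<in> R" "geodesic q s \<in> R" "geodesic p t \<in> R" "geodesic r t \<in> R"
    using d sides by (intro inR; auto simp: doubleton_eq_iff)+
  have quads: "quad_in v p q r s" "quad_in v p r q t"
    using P sides by (auto simp: quad_in_def open_segment_commute)
  have ne: "geodesic p q \<noteq> geodesic p r" "geodesic r s \<noteq> geodesic p r" "geodesic t q \<noteq> geodesic q p"
    using d by (intro neq; auto simp: doubleton_eq_iff)+
  have "w1 = insert (geodesic r s) (v - {geodesic p q})"
    unfolding w1_def R_def using ne(1) P(4) by blast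
  then show w1: "arc_system w1"
    using exchange_arc_system [OF v quads(1)] by simp
  have "w4 = insert (geodesic t q) (v - {geodesic p r})"
    unfolding w4_def R_def open_segment_commute [of q p] using ne(1) P(3) by blast
  then show w4: "arc_system w4"
    using exchange_arc_system [OF v quads(2)] by (simp add: open_segment_commute)
  have "geodesic p r \<in> w1" "geodesic p s \<in> w1" "geodesic r s \<in> w1" "geodesic p t \<in> w1" "geodesic r t \<in> w1"
    using R by (simp_all add: w1_def)
  then have "quad_in w1 p r s t"
    using P(1) d by (simp add: quad_in_def)
  moreover have "R \<union> {geodesic r s, geodesic s t} = insert (geodesic s t) (w1 - {geodesic p r})"
    unfolding w1_def R_def using ne(2) by blast
  ultimately show "arc_system (R \<union> {geodesic r s, geodesic s t})"
    using exchange_arc_system [OF w1] by simp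
  have "geodesic q p \<in> w4" "geodesic p s \<in> w4" "geodesic q s \<in> w4" "geodesic p t \<in> w4" "geodesic t q \<in> w4"
    using R by (simp_all add: w4_def)
  then have "quad_in w4 p q s t"
    using P(1) d by (simp add: quad_in_def open_segment_commute)
  moreover have "R \<union> {geodesic s t, geodesic t q} = insert (geodesic s t) (w4 - {geodesic p q})"
    unfolding w4_def R_def open_segment_commute [of p q] using ne(3) by blast
  ultimately show "arc_system (R \<union> {geodesic s t, geodesic t q})"
    using exchange_arc_system [OF w4] by simp
qed

lemma pentagon_cycle_act:
  assumes f: "f \<in> thompson_maps" and v: "arc_system v" and p: "pentagon_in v p q r s t"
  shows "(`) (act f) ` pentagon_cycle v p q r s t =
     pentagon_cycle (act f v) (f p) (f q) (f r) (f s) (f t)"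
proof -
  let ?R = "v - {geodesic p q, geodesic p r}"
  have d: "distinct [p, q, r, s, t]" and pqr: "geodesic p q \<in> v" "geodesic p r \<in> v"
    using p unfolding pentagon_in_def by blast+
  have R: "arc_image f ` ?R = act f v - {geodesic (f p) (f q), geodesic (f p) (f r)}"
  proof -
    have "arc_image f ` ?R = arc_image f ` v - arc_image f ` {geodesic p q, geodesic p r}"
      by (rule inj_on_image_set_diff [OF inj_on_arc_image [OF f]])
        (use arc_systemD(1) [OF v] pqr in auto)
    then show ?thesis using d by (simp add: act_image [OF f v])
  qed
  have w: "act f (?R \<union> {geodesic a b, geodesic c e}) =
      arc_image f ` ?R \<union> {geodesic (f a) (f b), geodesic (f c) (f e)}"
    if "arc_system (?R \<union> {geodesic a b, geodesic c e})" "a \<noteq> b" "c \<noteq> e" for a b c e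
    using act_image [OF f that(1)] that(2,3) by (simp add: image_Un del: Un_insert_right)
  note W = pentagon_vertices [OF v p]
  have "p \<noteq> q" "p \<noteq> r" "r \<noteq> s" "s \<noteq> t" "t \<noteq> q" "q \<noteq> p"
    using d by auto
  then show ?thesis
    using w [OF W(1)] w [OF W(2)] w [OF W(3)] w [OF W(4)] w [OF W(5)]
    unfolding R pentagon_cycle_def Let_def by simp
qed

lemma C_edgesI: "\<lbrakk>arc_system v; a \<in> v\<rbrakk> \<Longrightarrow> {v, flip v a} \<in> C_edges"
  unfolding C_edges_def C_vertices_eq mem_Collect_eq
  by (rule exI [of _ v], rule exI [of _ "flip v a"]) (auto simp: flip_arc_system)

lemma C_squaresI:
  "\<lbrakk>arc_system v; a \<in> v; b \<in> v; a \<noteq> b; \<not> common_triangle v a b\<rbrakk> \<Longrightarrow> square_cycle v a b \<in> C_squares"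
  unfolding C_squares_def C_vertices_eq mem_Collect_eq
  by (rule exI [of _ v], rule exI [of _ a], rule exI [of _ b]) simp

lemma C_pentagonsI:
  "\<lbrakk>arc_system v; pentagon_in v p q r s t\<rbrakk> \<Longrightarrow> pentagon_cycle v p q r s t \<in> C_pentagons"
  unfolding C_pentagons_eq mem_Collect_eq
  by (rule exI [of _ v], rule exI [of _ p], rule exI [of _ q], rule exI [of _ r], rule exI [of _ s],
      rule exI [of _ t]) simp

lemma C_edges_vertices: "e \<in> C_edges \<Longrightarrow> e \<subseteq> C_vertices"
  by (auto simp: C_edges_def)

lemma C_cells_vertices: "c \<in> C_cells \<Longrightarrow> e \<in> c \<Longrightarrow> e \<subseteq> C_vertices"
proof -
  assume c: "c \<in> C_cells" and e: "e \<in> c"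
  show ?thesis
  proof (cases "c \<in> C_squares")
    case True
    then obtain v a b where "arc_system v" "a \<in> v" "b \<in> v" "a \<noteq> b" "c = square_cycle v a b"
      by (auto simp: C_squares_def C_vertices_eq)
    then have "{v, flip v a, flip v b, flip (flip v a) b} \<subseteq> C_vertices"
      using flip_arc_system mem_flip [of b v a] by (simp add: C_vertices_eq)
    then show ?thesis
      using e \<open>c = square_cycle v a b\<close> unfolding square_cycle_def by blast
  next
    case False
    then obtain v p q r s t where "arc_system v" "pentagon_in v p q r s t"
      "c = pentagon_cycle v p q r s t"
      using c by (auto simp: C_cells_def C_pentagons_eq)
    then show ?thesis
      using e pentagon_vertices [of v p q r s t] unfolding C_vertices_eq pentagon_cycle_def Let_def
      by blast
  qed
qed

text \<open>Edges and cells consist of vertices, so only the values at vertices count. This is how the default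
  values of \<open>restrict\<close>, \<open>compose\<close> and \<open>inv_into\<close> outside the complex are dealt with.\<close>

lemma cellular_cong:
  assumes "cellular \<phi>" "\<And>v. v \<in> C_vertices \<Longrightarrow> \<psi> v = \<phi> v"
  shows "cellular \<psi>"
proof -
  have e: "\<psi> ` e = \<phi> ` e" if "e \<subseteq> C_vertices" for e
    using that assms(2) by (intro image_cong) auto
  have "(\<lambda>e. \<psi> ` e) ` c = (\<lambda>e. \<phi> ` e) ` c" if "c \<in> C_cells" for c
    using C_cells_vertices [OF that] e by (intro image_cong refl) blast
  then show ?thesis
    using assms(1) e C_edges_vertices unfolding cellular_def by simp
qed

lemma cellular_act:
  assumes f: "f \<in> thompson_maps"
  shows "cellular (act f)"
  unfolding cellular_def
proof (intro conjI ballI)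
  fix e assume "e \<in> C_edges"
  then obtain v a where e: "e = {v, flip v a}" "arc_system v" "a \<in> v"
    by (auto simp: C_edges_def C_vertices_eq)
  have "act f ` e = {act f v, flip (act f v) (arc_image f a)}" "arc_image f a \<in> act f v"
    using e act_flip [OF f] arc_image_in_act [OF f] by simp_all
  then show "act f ` e \<in> C_edges"
    using C_edgesI [OF act_arc_system [OF f e(2)], of "arc_image f a"] by simp
next
  fix c assume c: "c \<in> C_cells"
  show "(`) (act f) ` c \<in> C_cells"
  proof (cases "c \<in> C_squares")
    case True
    then obtain v a b where s: "arc_system v" "a \<in> v" "b \<in> v" "a \<noteq> b" "c = square_cycle v a b"
        "\<not> common_triangle v a b"
      by (auto simp: C_squares_def C_vertices_eq)
    have "arc_image f a \<noteq> arc_image f b"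
      using inj_on_eq_iff [OF inj_on_arc_image [OF f], of a b] s(2-4) arc_systemD(1) [OF s(1)] by blast
    then have "square_cycle (act f v) (arc_image f a) (arc_image f b) \<in> C_squares"
      using common_triangle_act_iff [OF f s(1-3)] s(2,3,6)
      by (intro C_squaresI act_arc_system arc_image_in_act f s(1)) simp_all
    then have "(`) (act f) ` c \<in> C_squares"
      using square_cycle_act [OF f s(1-4)] s(5) by simp
    then show ?thesis by (simp add: C_cells_def)
  next
    case False
    then obtain v p q r s t where p: "arc_system v" "pentagon_in v p q r s t"
      "c = pentagon_cycle v p q r s t"
      using c by (auto simp: C_cells_def C_pentagons_eq)
    have "(`) (act f) ` c \<in> C_pentagons"
      unfolding p(3) pentagon_cycle_act [OF f p(1,2)]
      by (intro C_pentagonsI act_arc_system pentagon_in_act f p(1,2))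
    then show ?thesis by (simp add: C_cells_def)
  qed
qed


section \<open>The homomorphism into the automorphism group\<close>

lemma Aut_C_subgroup:
  "subgroup {\<phi> \<in> Bij C_vertices. cellular \<phi> \<and> cellular (inv_into C_vertices \<phi>)} (BijGroup C_vertices)"
    (is "subgroup ?A _")
proof (rule group.subgroupI [OF group_BijGroup])
  have cellular_comp: "cellular (compose C_vertices \<phi> \<psi>)" if "cellular \<phi>" "cellular \<psi>" for \<phi> \<psi>
  proof (rule cellular_cong)
    have "(\<phi> \<circ> \<psi>) ` e = \<phi> ` \<psi> ` e" "(`) (\<phi> \<circ> \<psi>) ` c = (`) \<phi> ` (`) \<psi> ` c" for e c
      by (auto simp: image_comp)
    then show "cellular (\<phi> \<circ> \<psi>)"
      using that unfolding cellular_def by simp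
  qed (simp add: compose_eq)
  show "?A \<subseteq> carrier (BijGroup C_vertices)"
    by (auto simp: BijGroup_def)
  have id: "cellular (\<lambda>v\<in>C_vertices. v)"
    by (rule cellular_cong [of "\<lambda>v. v"]) (simp_all add: cellular_def)
  have inv_id: "inv_into C_vertices (\<lambda>v\<in>C_vertices. v) v = v" if "v \<in> C_vertices" for v
    using inv_into_f_f [of "\<lambda>v\<in>C_vertices. v" C_vertices v] that by (simp add: inj_on_def)
  then have "(\<lambda>v\<in>C_vertices. v) \<in> ?A"
    using id cellular_cong [OF id, of "inv_into C_vertices (\<lambda>v\<in>C_vertices. v)"] id_Bij by simp
  then show "?A \<noteq> {}" by blast
  fix \<phi> assume "\<phi> \<in> ?A"
  then have \<phi>: "\<phi> \<in> Bij C_vertices" "cellular \<phi>" "cellular (inv_into C_vertices \<phi>)" by auto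
  let ?i = "restrict (inv_into C_vertices \<phi>) C_vertices"
  have bij: "bij_betw \<phi> C_vertices C_vertices" using \<phi>(1) by (simp add: Bij_def)
  have i: "?i \<in> Bij C_vertices" using \<phi>(1) by (rule restrict_inv_into_Bij)
  have "inv_into C_vertices ?i v = \<phi> v" if "v \<in> C_vertices" for v
  proof (rule inv_into_f_eq)
    show "inj_on ?i C_vertices" using i by (simp add: Bij_def bij_betw_def)
    show "\<phi> v \<in> C_vertices" using bij that bij_betwE by blast
    then show "?i (\<phi> v) = v" using bij that by (simp add: bij_betw_def inv_into_f_f)
  qed
  then show "inv\<^bsub>BijGroup C_vertices\<^esub> \<phi> \<in> ?A"
    using i \<phi> cellular_cong [OF \<phi>(2)] cellular_cong [OF \<phi>(3), of ?i] by (simp add: inv_BijGroup)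
  fix \<psi> assume "\<psi> \<in> ?A"
  then have \<psi>: "\<psi> \<in> Bij C_vertices" "cellular \<psi>" "cellular (inv_into C_vertices \<psi>)" by auto
  have bij': "bij_betw \<psi> C_vertices C_vertices" using \<psi>(1) by (simp add: Bij_def)
  have "cellular (inv_into C_vertices (compose C_vertices \<phi> \<psi>))"
  proof (rule cellular_cong [OF cellular_comp [OF \<psi>(3) \<phi>(3)]])
    fix v assume v: "v \<in> C_vertices"
    then have "compose C_vertices (inv_into C_vertices \<psi>) (inv_into C_vertices \<phi>) v
       = inv_into C_vertices \<psi> (inv_into C_vertices \<phi> v)"
      by (simp add: compose_eq)
    moreover have "inv_into C_vertices (compose C_vertices \<phi> \<psi>) v = \<dots>"
    proof (rule inv_into_f_eq)
      show "inj_on (compose C_vertices \<phi> \<psi>) C_vertices"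
        using compose_Bij [OF \<phi>(1) \<psi>(1)] by (simp add: Bij_def bij_betw_def)
      have m: "inv_into C_vertices \<phi> v \<in> C_vertices"
        using v bij by (simp add: bij_betw_def inv_into_into)
      then show "inv_into C_vertices \<psi> (inv_into C_vertices \<phi> v) \<in> C_vertices"
        using bij' by (simp add: bij_betw_def inv_into_into)
      then show "compose C_vertices \<phi> \<psi> (inv_into C_vertices \<psi> (inv_into C_vertices \<phi> v)) = v"
        using m v bij bij' by (simp add: compose_eq bij_betw_def f_inv_into_f)
    qed
    ultimately show "inv_into C_vertices (compose C_vertices \<phi> \<psi>) v =
        compose C_vertices (inv_into C_vertices \<psi>) (inv_into C_vertices \<phi>) v" by simp
  qed
  then show "\<phi> \<otimes>\<^bsub>BijGroup C_vertices\<^esub> \<psi> \<in> ?A"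
    using \<phi> \<psi> cellular_comp compose_Bij by (simp add: BijGroup_def)
qed

lemma Aut_C_group: "group Aut_C"
  unfolding Aut_C_def by (rule group.subgroup_imp_group [OF group_BijGroup Aut_C_subgroup])

lemma Psi_Bij:
  assumes f: "f \<in> thompson_maps"
  shows "Psi f \<in> Bij C_vertices"
    "v \<in> C_vertices \<Longrightarrow> inv_into C_vertices (Psi f) v = act (restrict (inv_into S1 f) S1) v"
proof -
  let ?g = "restrict (inv_into S1 f) S1"
  note g = thompson_inverse [OF f]
  have bij: "bij_betw (Psi f) C_vertices C_vertices"
    by (rule bij_betw_byWitness [where f' = "act ?g"])
      (auto simp: Psi_def C_vertices_eq act_inverse [OF f] act_arc_system f g)
  then show "Psi f \<in> Bij C_vertices"
    by (simp add: Bij_def Psi_def)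
  assume v: "v \<in> C_vertices"
  show "inv_into C_vertices (Psi f) v = act ?g v"
  proof (rule inv_into_f_eq)
    show "inj_on (Psi f) C_vertices" using bij by (simp add: bij_betw_def)
    show "act ?g v \<in> C_vertices" "Psi f (act ?g v) = v"
      using v act_arc_system [OF g] by (simp_all add: C_vertices_eq Psi_def act_inverse [OF f])
  qed
qed

lemma Psi_Aut:
  assumes f: "f \<in> thompson_maps"
  shows "Psi f \<in> carrier Aut_C"
  using Psi_Bij [OF f] cellular_cong [OF cellular_act [OF f], of "Psi f"]
    cellular_cong [OF cellular_act [OF thompson_inverse [OF f]], of "inv_into C_vertices (Psi f)"]
  by (simp add: Aut_C_def Psi_def)

lemma Psi_compose:
  assumes "f \<in> thompson_maps" "g \<in> thompson_maps"
  shows "Psi (compose S1 f g) = compose C_vertices (Psi f) (Psi g)"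
proof
  show "Psi (compose S1 f g) v = compose C_vertices (Psi f) (Psi g) v" for v
    using act_compose [OF assms] act_arc_system [OF assms(2)]
    by (simp add: Psi_def compose_def C_vertices_eq)
qed

lemma carrier_thompson_T: "carrier thompson_T = thompson_maps"
  by (simp add: thompson_T_def)

lemma Psi_hom: "group_hom thompson_T Aut_C Psi"
proof (intro group_hom.intro group_hom_axioms.intro homI)
  show "group thompson_T" "group Aut_C"
    by (fact thompson_group Aut_C_group)+
  show "Psi f \<in> carrier Aut_C" if "f \<in> carrier thompson_T" for f
    using that Psi_Aut by (simp add: carrier_thompson_T)
  show "Psi (f \<otimes>\<^bsub>thompson_T\<^esub> g) = Psi f \<otimes>\<^bsub>Aut_C\<^esub> Psi g"
    if "f \<in> carrier thompson_T" "g \<in> carrier thompson_T" for f g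
    using that Psi_Bij(1) by (simp add: carrier_thompson_T thompson_T_mult Psi_compose Aut_C_def BijGroup_def)
qed

lemma Psi_action: "group_action thompson_T C_vertices Psi"
proof (intro group_action.intro group_hom.intro group_hom_axioms.intro homI)
  show "group thompson_T" "group (BijGroup C_vertices)"
    by (fact thompson_group group_BijGroup)+
  show "Psi f \<in> carrier (BijGroup C_vertices)" if "f \<in> carrier thompson_T" for f
    using that Psi_Bij(1) by (simp add: carrier_thompson_T BijGroup_def)
  show "Psi (f \<otimes>\<^bsub>thompson_T\<^esub> g) = Psi f \<otimes>\<^bsub>BijGroup C_vertices\<^esub> Psi g"
    if "f \<in> carrier thompson_T" "g \<in> carrier thompson_T" for f g
    using that Psi_Bij(1) by (simp add: carrier_thompson_T thompson_T_mult Psi_compose BijGroup_def)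
qed

section \<open>Faithfulness\<close>

lemma continuous_on_circ [continuous_intros]:
  assumes "continuous_on A g"
  shows "continuous_on A (\<lambda>x. circ (g x))"
  unfolding circ_def using assms by (intro continuous_intros)

lemma grid_floor_LIMSEQ: "(\<lambda>n. grid n \<lfloor>x * 2 ^ n\<rfloor>) \<longlonglongrightarrow> x"
proof -
  have b: "grid n \<lfloor>x * 2 ^ n\<rfloor> \<le> x" "x \<le> grid n \<lfloor>x * 2 ^ n\<rfloor> + (1 / 2) ^ n" for n
  proof -
    show "grid n \<lfloor>x * 2 ^ n\<rfloor> \<le> x"
      unfolding grid_def by (simp add: divide_le_eq)
    have "x * 2 ^ n \<le> of_int \<lfloor>x * 2 ^ n\<rfloor> + 1" by linarith
    then have "x \<le> (of_int \<lfloor>x * 2 ^ n\<rfloor> + 1) / 2 ^ n"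
      by (simp add: le_divide_eq)
    then show "x \<le> grid n \<lfloor>x * 2 ^ n\<rfloor> + (1 / 2) ^ n"
      unfolding grid_def by (simp add: add_divide_distrib power_divide)
  qed
  have lim: "(\<lambda>n. x - (1 / 2) ^ n) \<longlonglongrightarrow> x - 0"
    by (intro tendsto_intros LIMSEQ_power_zero) simp
  have le: "x - (1 / 2) ^ n \<le> grid n \<lfloor>x * 2 ^ n\<rfloor>" for n
    using b(2) [of n] by linarith
  show ?thesis
    using tendsto_sandwich [OF always_eventually always_eventually lim, of "\<lambda>n. grid n \<lfloor>x * 2 ^ n\<rfloor>" "\<lambda>n. x"]
      le b(1) by simp
qed

lemma thompson_eqI:
  assumes f: "f \<in> thompson_maps" and g: "g \<in> thompson_maps"
    and eq: "\<And>p. p \<in> dyadic_points \<Longrightarrow> f p = g p"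
  shows "f = g"
proof (rule extensionalityI [of _ S1])
  show "f \<in> extensional S1" "g \<in> extensional S1"
    using thompson_bij(2) f g by blast+
  fix p assume "p \<in> S1"
  then obtain x where x: "p = circ x" by (rule circ_lift)
  have c: "continuous_on UNIV (\<lambda>x. h (circ x))" if "h \<in> thompson_maps" for h
    by (rule continuous_on_compose2 [OF thompson_bij(4) [OF that] continuous_on_circ [OF continuous_on_id]])
      (use circ_in_S1 in blast)
  have cl: "closed {x. f (circ x) = g (circ x)}"
    by (intro closed_Collect_eq c f g)
  have mem: "grid n \<lfloor>x * 2 ^ n\<rfloor> \<in> {x. f (circ x) = g (circ x)}" for n
    using eq by simp
  have "x \<in> {x. f (circ x) = g (circ x)}"
    by (rule closed_sequentially [OF cl _ grid_floor_LIMSEQ]) (use mem in blast)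
  then show "f p = g p" using x by simp
qed

text \<open>A single arc is the difference of two vertices, \<open>v\<close> and its flip, and images under an injective
  map commute with differences.\<close>

lemma arc_image_eq_of_act_eq:
  assumes f: "f \<in> thompson_maps" and g: "g \<in> thompson_maps"
    and eq: "\<And>v. arc_system v \<Longrightarrow> arc_image f ` v = arc_image g ` v"
    and v: "arc_system v" and a: "a \<in> v"
  shows "arc_image f a = arc_image g a"
proof -
  obtain p q r s where a_eq: "a = geodesic p q" and q: "quad_in v p q r s"
    and fl: "flip v a = insert (geodesic r s) (v - {a})" "arc_system (flip v a)"
    using flip_cases [OF v a] by metis
  note V = arc_systemD [OF v]
  have "\<not> compat a (geodesic r s)"
    using quad_in_diagonals_cross [OF V(2) q] a_eq by simp
  then have single: "v - flip v a = {a}"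
    using a fl(1) V(2) by auto
  have "{arc_image h a} = arc_image h ` v - arc_image h ` flip v a" if "h \<in> thompson_maps" for h
    using inj_on_image_set_diff [OF inj_on_arc_image [OF that], of v "flip v a"] V(1)
      arc_systemD(1) [OF fl(2)] single by auto
  then show ?thesis
    using eq [OF v] eq [OF fl(2)] f g by (metis singleton_inject)
qed

text \<open>A dyadic point is the only common endpoint of the two standard arcs next to it on a level that is
  at least 2, where these arcs are distinct.\<close>

lemma thompson_eq_of_arc_image_eq:
  assumes f: "f \<in> thompson_maps" and g: "g \<in> thompson_maps"
    and eq: "\<And>a. a \<in> base_triangulation \<Longrightarrow> arc_image f a = arc_image g a"
  shows "f = g"
proof (rule thompson_eqI [OF f g])
  fix p assume "p \<in> dyadic_points"
  then obtain j where "p \<in> level j" by (rule dyadic_level)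
  then have "p \<in> level (j + 2)" using level_mono [of j "j + 2"] by auto
  then obtain k where k: "p = circ (grid (j + 2) k)" by (auto simp: level_def)
  let ?n = "j + 2"
  let ?q = "circ (grid ?n (k + 1))" and ?r = "circ (grid ?n (k - 1))"
  have M: "(4::int) \<le> 2 ^ ?n" by (simp add: power_add)
  have neq: "p \<noteq> ?q" "?r \<noteq> p" "?r \<noteq> ?q"
    unfolding k by (rule circ_grid_neq; use M in linarith)+
  have "geodesic p ?q = std_arc ?n k" "geodesic p ?r = std_arc ?n (k - 1)"
    by (simp_all add: k std_arc_def open_segment_commute)
  then have base: "geodesic p ?q \<in> base_triangulation" "geodesic p ?r \<in> base_triangulation"
    unfolding base_triangulation_eq by fastforce+
  have "geodesic (f p) (f ?q) = geodesic (g p) (g ?q)" "geodesic (f p) (f ?r) = geodesic (g p) (g ?r)"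
    using eq [OF base(1)] eq [OF base(2)] neq by simp_all
  moreover have "f p \<noteq> f ?q" "f p \<noteq> f ?r" "g ?q \<noteq> g ?r"
    using neq thompson_inj [OF f] thompson_inj [OF g] k by auto
  ultimately show "f p = g p"
    using geodesic_eqD by metis
qed

lemma Psi_inj: "inj_on Psi (carrier thompson_T)"
proof
  fix f g assume fg: "f \<in> carrier thompson_T" "g \<in> carrier thompson_T" "Psi f = Psi g"
  then have T: "f \<in> thompson_maps" "g \<in> thompson_maps"
    by (simp_all add: thompson_T_def)
  have "arc_image f ` v = arc_image g ` v" if v: "arc_system v" for v
  proof -
    have "act f v = act g v"
      using fun_cong [OF fg(3), of v] v by (simp add: Psi_def C_vertices_eq)
    then show ?thesis
      using act_eq_image [OF T(1) arc_systemD(1) [OF v]] act_eq_image [OF T(2) arc_systemD(1) [OF v]]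
      by simp
  qed
  then show "f = g"
    using thompson_eq_of_arc_image_eq [OF T] arc_image_eq_of_act_eq [OF T _ arc_system_base] by blast
qed

section \<open>Piecewise linear maps between dyadic subdivisions\<close>

text \<open>The sequence \<open>G\<close> lists the end points of a periodic subdivision of the line into \<open>2 ^ M\<close> standard
  dyadic intervals per period. The map \<open>F\<close> below sends the regular subdivision of level \<open>M\<close> to it and
  is affine in between; \<open>f\<close> is the induced map of the circle.\<close>

locale subdivision =
  fixes M :: nat and G :: "int \<Rightarrow> real"
  assumes period: "G (j + 2 ^ M) = G j + 1"
    and std: "\<exists>n\<ge>1. \<exists>i. G j = grid n i \<and> G (j + 1) = grid n (i + 1)"
begin

definition F :: "real \<Rightarrow> real" where
  "F x = (let k = \<lfloor>x * 2 ^ M\<rfloor> in G k + (x * 2 ^ M - of_int k) * (G (k + 1) - G k))"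

lemma G_less_Suc: "G j < G (j + 1)"
  using std [of j] by auto

lemma G_mono: "j \<le> k \<Longrightarrow> G j \<le> G k"
proof (induction k rule: int_ge_induct)
  case (step i)
  then show ?case using G_less_Suc [of i] by linarith
qed simp

lemma G_period: "G (j + i * 2 ^ M) = G j + of_int i"
proof (induction i rule: int_induct [where k = 0])
  case (step1 i)
  then show ?case using period [of "j + i * 2 ^ M"] by (simp add: algebra_simps)
next
  case (step2 i)
  then show ?case using period [of "j + (i - 1) * 2 ^ M"] by (simp add: algebra_simps)
qed simp

lemma F_eq:
  assumes "grid M k \<le> x" "x \<le> grid M (k + 1)"
  shows "F x = G k + (x * 2 ^ M - of_int k) * (G (k + 1) - G k)"
proof (cases "x = grid M (k + 1)")
  case True
  then have x: "x * 2 ^ M = of_int (k + 1)" by (simp add: grid_def)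
  show ?thesis unfolding F_def Let_def x floor_of_int by simp
next
  case False
  then have "x < grid M (k + 1)" using assms(2) by simp
  then have "of_int k \<le> x * 2 ^ M" "x * 2 ^ M < of_int k + 1"
    using assms(1) by (simp_all add: grid_def divide_le_eq less_divide_eq)
  then have "\<lfloor>x * 2 ^ M\<rfloor> = k" by linarith
  then show ?thesis by (simp add: F_def)
qed

lemma F_grid: "F (grid M k) = G k"
proof -
  have "grid M k \<le> grid M (k + 1)" by simp
  then have "F (grid M k) = G k + (grid M k * 2 ^ M - of_int k) * (G (k + 1) - G k)"
    by (intro F_eq order_refl)
  then show ?thesis by (simp add: grid_def)
qed

text \<open>Both the interval of level \<open>M\<close> and its image have length a power of two and dyadic ends, which is
  where the conditions on slopes and dyadic points come from.\<close>

lemma F_affine: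
  obtains k :: int and c where "c \<in> dyadic" "\<And>x. grid M j \<le> x \<Longrightarrow> x \<le> grid M (j + 1) \<Longrightarrow> F x = 2 powi k * x + c"
proof -
  obtain n i where n: "G j = grid n i" "G (j + 1) = grid n (i + 1)"
    using std [of j] by blast
  have d: "G (j + 1) - G j = 1 / 2 ^ n"
    by (simp add: n grid_def add_divide_distrib)
  have p: "(2::real) powi (int M - int n) = 2 ^ M / 2 ^ n"
    by (simp add: power_int_diff)
  show thesis
  proof
    show "grid n (i - j) \<in> dyadic" by simp
    show "F x = 2 powi (int M - int n) * x + grid n (i - j)"
      if "grid M j \<le> x" "x \<le> grid M (j + 1)" for x
      unfolding F_eq [OF that] d p n by (simp add: grid_def field_simps)
  qed
qed

lemma grid_locate:
  obtains k where "grid M k \<le> x" "x < grid M (k + 1)"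
proof
  show "grid M \<lfloor>x * 2 ^ M\<rfloor> \<le> x" "x < grid M (\<lfloor>x * 2 ^ M\<rfloor> + 1)"
    unfolding grid_def by (simp_all add: divide_le_eq less_divide_eq)
qed

lemma F_strict_mono: "strict_mono F"
proof (rule strict_monoI)
  fix x y :: real assume xy: "x < y"
  have piece: "F x < F y" if "grid M k \<le> x" "x < y" "y \<le> grid M (k + 1)" for k x y
  proof -
    obtain s :: int and c where "\<And>x. grid M k \<le> x \<Longrightarrow> x \<le> grid M (k + 1) \<Longrightarrow> F x = 2 powi s * x + c"
      using F_affine by blast
    then have "F x = 2 powi s * x + c" "F y = 2 powi s * y + c"
      using that by auto
    then show ?thesis using that(2) by simp
  qed
  obtain k where k: "grid M k \<le> x" "x < grid M (k + 1)" by (rule grid_locate)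
  obtain l where l: "grid M l \<le> y" "y < grid M (l + 1)" by (rule grid_locate)
  show "F x < F y"
  proof (cases "y \<le> grid M (k + 1)")
    case True
    then show ?thesis using piece k xy by blast
  next
    case False
    then have "grid M (k + 1) < grid M (l + 1)" using l by linarith
    then have "k + 1 \<le> l" by simp
    have "F x < F (grid M (k + 1))" using piece [of k] k by simp
    also have "\<dots> \<le> F (grid M l)" using G_mono [OF \<open>k + 1 \<le> l\<close>] by (simp add: F_grid)
    also have "\<dots> \<le> F y" using piece [of l "grid M l" y] l by (cases "grid M l = y") auto
    finally show ?thesis .
  qed
qed

lemma F_add_1: "F (x + 1) = F x + 1"
proof -
  define k where "k = \<lfloor>x * 2 ^ M\<rfloor>"
  have "(x + 1) * 2 ^ M = x * 2 ^ M + of_int (2 ^ M)" by (simp add: algebra_simps)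
  then have "\<lfloor>(x + 1) * 2 ^ M\<rfloor> = k + 2 ^ M"
    by (simp only: floor_add_int k_def)
  then have "F (x + 1) = G (k + 2 ^ M) +
      ((x + 1) * 2 ^ M - of_int (k + 2 ^ M)) * (G (k + 2 ^ M + 1) - G (k + 2 ^ M))"
    unfolding F_def Let_def by simp
  also have "k + 2 ^ M + 1 = (k + 1) + 2 ^ M" by simp
  also have "(x + 1) * 2 ^ M - of_int (k + 2 ^ M) = x * 2 ^ M - of_int k"
    by (simp add: algebra_simps)
  finally show ?thesis
    unfolding period F_def Let_def k_def by simp
qed

lemma F_surj: "surj F"
proof -
  have "\<exists>x. F x = y" for y
  proof -
    define j where "j = \<lfloor>y - G 0\<rfloor>"
    have "G (j * 2 ^ M) \<le> y" "y < G ((j + 1) * 2 ^ M)"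
      using G_period [of 0 j] G_period [of 0 "j + 1"] unfolding j_def by simp_all linarith+
    note j = this
    define S where "S = {k. j * 2 ^ M \<le> k \<and> k \<le> (j + 1) * 2 ^ M \<and> G k \<le> y}"
    have "finite S" by (rule finite_subset [of _ "{j * 2 ^ M..(j + 1) * 2 ^ M}"]) (auto simp: S_def)
    have "j * 2 ^ M \<in> S" using j by (simp add: S_def mult_right_mono)
    define k where "k = Max S"
    have "k \<in> S" unfolding k_def using \<open>finite S\<close> \<open>j * 2 ^ M \<in> S\<close> by (intro Max_in) auto
    then have k: "j * 2 ^ M \<le> k" "k \<le> (j + 1) * 2 ^ M" "G k \<le> y" by (auto simp: S_def)
    have "k \<noteq> (j + 1) * 2 ^ M" using k(3) j(2) by auto
    then have "k + 1 \<notin> S \<Longrightarrow> y < G (k + 1)" using k by (auto simp: S_def)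
    moreover have "k + 1 \<notin> S"
      using Max_ge [OF \<open>finite S\<close>, of "k + 1"] by (auto simp: k_def)
    ultimately have y: "G k \<le> y" "y < G (k + 1)" using k by auto
    define t where "t = (y - G k) / (G (k + 1) - G k)"
    have t: "0 \<le> t" "t < 1" using y by (simp_all add: t_def)
    define x where "x = (of_int k + t) / 2 ^ M"
    have "F x = G k + (x * 2 ^ M - of_int k) * (G (k + 1) - G k)"
      by (rule F_eq) (use t in \<open>simp_all add: x_def grid_def divide_le_cancel\<close>)
    also have "\<dots> = y"
      using G_less_Suc [of k] by (simp add: x_def t_def)
    finally show ?thesis by blast
  qed
  then show ?thesis by (metis surjI)
qed

text \<open>A monotone surjection of the line has no jumps.\<close>

lemma F_continuous: "continuous_on UNIV F"
proof (rule continuous_onI_mono)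
  show "open (range F)" using F_surj by simp
  show "F x \<le> F y" if "x \<le> y" for x y
    using that F_strict_mono by (simp add: strict_mono_less_eq)
qed

lemma F_dyadic: "F x \<in> dyadic \<longleftrightarrow> x \<in> dyadic"
proof -
  obtain j where j: "grid M j \<le> x" "x < grid M (j + 1)" by (rule grid_locate)
  obtain k :: int and c where c: "c \<in> dyadic"
    "\<And>x. grid M j \<le> x \<Longrightarrow> x \<le> grid M (j + 1) \<Longrightarrow> F x = 2 powi k * x + c"
    using F_affine by blast
  have Fx: "F x = 2 powi k * x + c" using c(2) j by simp
  then have x: "x = 2 powi (- k) * (F x - c)"
    by (simp add: power_int_minus)
  show ?thesis
  proof
    assume "F x \<in> dyadic"
    then have "2 powi (- k) * (F x - c) \<in> dyadic"
      using c(1) by (intro dyadic_mult dyadic_powi dyadic_diff)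
    then show "x \<in> dyadic" using x by simp
  next
    assume "x \<in> dyadic"
    then show "F x \<in> dyadic"
      unfolding Fx using c(1) by (intro dyadic_add dyadic_mult dyadic_powi)
  qed
qed

lemma F_locally_affine:
  assumes "circ x \<notin> level M"
  shows "\<exists>(k::int) c. \<forall>\<^sub>F y in nhds x. F y = 2 powi k * y + c"
proof -
  obtain j where j: "grid M j \<le> x" "x < grid M (j + 1)" by (rule grid_locate)
  have "x \<noteq> grid M j" using assms by (auto simp: level_def)
  then have x: "x \<in> {grid M j<..<grid M (j + 1)}" using j by auto
  obtain k :: int and c where c:
    "\<And>x. grid M j \<le> x \<Longrightarrow> x \<le> grid M (j + 1) \<Longrightarrow> F x = 2 powi k * x + c"
    using F_affine by blast
  have "\<forall>\<^sub>F y in nhds x. y \<in> {grid M j<..<grid M (j + 1)}"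
    by (rule eventually_nhds_in_open [OF open_greaterThanLessThan x])
  then have "\<forall>\<^sub>F y in nhds x. F y = 2 powi k * y + c"
    by eventually_elim (use c in simp)
  then show ?thesis by blast
qed

text \<open>An affine bijection between standard dyadic intervals respects their repeated halvings.\<close>

lemma F_subgrid:
  assumes "M \<le> m"
  shows "\<exists>n\<ge>1. \<exists>i. F (grid m j) = grid n i \<and> F (grid m (j + 1)) = grid n (i + 1)"
proof -
  define e where "e = m - M"
  have m: "m = M + e" using assms by (simp add: e_def)
  define k where "k = j div 2 ^ e"
  have k: "k * 2 ^ e \<le> j" "j + 1 \<le> (k + 1) * 2 ^ e"
  proof -
    have "(0::int) < 2 ^ e" by simp
    then show "k * 2 ^ e \<le> j" "j + 1 \<le> (k + 1) * 2 ^ e"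
      using div_mult_mod_eq [of j "2 ^ e"] pos_mod_sign [of "2 ^ e" j] pos_mod_bound [of "2 ^ e" j]
      unfolding k_def distrib_right by linarith+
  qed
  obtain n i where n: "1 \<le> n" "G k = grid n i" "G (k + 1) = grid n (i + 1)"
    using std [of k] by blast
  have d: "G (k + 1) - G k = 1 / 2 ^ n"
    by (simp add: n grid_def add_divide_distrib)
  have F: "F (grid m l) = grid (n + e) (i * 2 ^ e + l - k * 2 ^ e)"
    if l: "k * 2 ^ e \<le> l" "l \<le> (k + 1) * 2 ^ e" for l
  proof -
    have g: "grid M i = grid m (i * 2 ^ e)" for i
      unfolding m by (simp only: grid_refine)
    have "F (grid m l) = G k + (grid m l * 2 ^ M - of_int k) * (1 / 2 ^ n)"
      using F_eq [of k "grid m l"] l by (simp only: g grid_le d)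
    also have "\<dots> = grid (n + e) (i * 2 ^ e + l - k * 2 ^ e)"
      by (simp add: n(2) m grid_def field_simps power_add)
    finally show ?thesis .
  qed
  have "F (grid m j) = grid (n + e) (i * 2 ^ e + j - k * 2 ^ e)"
    "F (grid m (j + 1)) = grid (n + e) (i * 2 ^ e + j - k * 2 ^ e + 1)"
    using F [of j] F [of "j + 1"] k by (simp_all add: algebra_simps)
  then show ?thesis using n(1) by (metis trans_le_add1)
qed

definition f :: "complex \<Rightarrow> complex" where
  "f = (\<lambda>p\<in>S1. circ (F (SOME x. p = circ x)))"

lemma f_circ: "f (circ x) = circ (F x)"
proof -
  have "circ x = circ (SOME y. circ x = circ y)"
    by (rule someI) (rule refl)
  then obtain k :: int where "(SOME y. circ x = circ y) = x + of_int k"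
    by (metis circ_eq_iff)
  then show ?thesis
    using lift_add_int [of F x k] F_add_1 by (simp add: f_def)
qed

lemma f_bij: "bij_betw f S1 S1"
  unfolding bij_betw_def
proof
  show "inj_on f S1"
  proof
    fix p q assume "p \<in> S1" "q \<in> S1" and eq: "f p = f q"
    then obtain x y where xy: "p = circ x" "q = circ y" by (metis circ_lift)
    then obtain k :: int where "F x = F y + of_int k"
      using eq by (auto simp: f_circ circ_eq_iff)
    then have "F x = F (y + of_int k)" using lift_add_int [of F y k] F_add_1 by simp
    then have "x = y + of_int k" using F_strict_mono by (simp add: strict_mono_eq)
    then show "p = q" using xy by simp
  qed
  show "f ` S1 = S1"
  proof
    show "f ` S1 \<subseteq> S1" by (auto simp: f_def)
    show "S1 \<subseteq> f ` S1"
    proof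
      fix p assume "p \<in> S1"
      then obtain y where y: "p = circ y" by (rule circ_lift)
      obtain x where "y = F x" using F_surj by (metis surjD)
      then have "p = f (circ x)" using y f_circ by simp
      then show "p \<in> f ` S1" using circ_in_S1 by blast
    qed
  qed
qed

text \<open>The circle is a quotient of the compact interval \<open>{0..1}\<close>, so continuity can be checked on the
  lift.\<close>

lemma f_continuous: "continuous_on S1 f"
proof -
  have img: "circ ` {0..1} = S1"
  proof
    show "S1 \<subseteq> circ ` {0..1}"
    proof
      fix p assume "p \<in> S1"
      then obtain x where "0 \<le> x" "x < 0 + 1" "p = circ x" by (rule circ_lift)
      then show "p \<in> circ ` {0..1}" by auto
    qed
  qed (use circ_in_S1 in blast)
  have "quotient_map (top_of_set {0..1}) (top_of_set S1) circ"
  proof (rule T1_Spaces.continuous_imp_quotient_map)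
    show "continuous_map (top_of_set {0..1}) (top_of_set S1) circ"
      using img continuous_on_subset [OF continuous_on_circ [OF continuous_on_id], of "{0..1}"] by auto
    show "compact_space (top_of_set {0..1::real})"
      by (simp add: compact_space_subtopology)
    show "Hausdorff_space (top_of_set S1)"
      by (simp add: Hausdorff_space_subtopology)
    show "circ ` topspace (top_of_set {0..1}) = topspace (top_of_set S1)"
      using img by simp
  qed
  moreover have "continuous_map (top_of_set {0..1}) euclidean (f \<circ> circ)"
  proof -
    have "f \<circ> circ = (\<lambda>x. circ (F x))" by (auto simp: f_circ)
    then show ?thesis
      using continuous_on_circ [OF continuous_on_subset [OF F_continuous, of "{0..1}"]] by simp
  qed
  ultimately have "continuous_map (top_of_set S1) euclidean f"
    using continuous_compose_quotient_map_eq by blast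
  then show ?thesis by simp
qed

lemma f_thompson: "f \<in> thompson_maps"
proof -
  obtain g where g: "homeomorphism S1 S1 f g"
    using homeomorphism_compact [of S1 f S1] f_continuous f_bij by (auto simp: bij_betw_def)
  show ?thesis
  proof (rule thompson_mapsI [OF _ g _ F_continuous F_strict_mono f_circ level_subset_dyadic finite_level F_locally_affine])
    show "f \<in> extensional S1" by (simp add: f_def)
    show "f ` dyadic_points = dyadic_points"
    proof
      show "f ` dyadic_points \<subseteq> dyadic_points"
      proof
        fix q assume "q \<in> f ` dyadic_points"
        then obtain x where "x \<in> dyadic" "q = f (circ x)" by (auto simp: dyadic_points_def)
        then show "q \<in> dyadic_points" by (simp add: f_circ circ_dyadic_iff F_dyadic)
      qed
      show "dyadic_points \<subseteq> f ` dyadic_points"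
      proof
        fix q assume "q \<in> dyadic_points"
        then obtain y where y: "y \<in> dyadic" "q = circ y" by (auto simp: dyadic_points_def)
        obtain x where x: "y = F x" using F_surj by (metis surjD)
        then have "circ x \<in> dyadic_points" using y F_dyadic by (simp add: circ_dyadic_iff)
        moreover have "q = f (circ x)" using x y f_circ by simp
        ultimately show "q \<in> f ` dyadic_points" by blast
      qed
    qed
  qed
qed

lemma f_std_arc:
  assumes "M \<le> m" "1 \<le> m"
  shows "\<exists>n\<ge>1. \<exists>i. arc_image f (std_arc m j) = std_arc n i"
proof -
  obtain n i where n: "1 \<le> n" "F (grid m j) = grid n i" "F (grid m (j + 1)) = grid n (i + 1)"
    using F_subgrid [OF assms(1)] by metis
  have "circ (grid m j) \<noteq> circ (grid m (j + 1))"
    using two_power_int_ge [OF assms(2)] by (intro circ_grid_neq) auto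
  then have "arc_image f (std_arc m j) = std_arc n i"
    using n(2,3) by (simp add: std_arc_def f_circ)
  then show ?thesis using n(1) by blast
qed

end


section \<open>Transitivity\<close>

text \<open>The part of \<open>v\<close> cut off by the chord from \<open>k\<close> to \<open>l\<close> is a triangulated polygon. The triangle at
  this chord has a third vertex \<open>m\<close>, sent to the midpoint of the standard interval assigned to the
  chord; the two halves are then assigned to the other sides of the triangle, and so on. Thus every
  arc of \<open>v\<close> in the polygon spans a standard interval.\<close>

lemma polygon_subdivision:
  assumes v: "arc_system v" and std: "\<And>j. std_arc M j \<in> v"
    and "k < l" "l < k + 2 ^ M" "chord (grid M k) (grid M l) \<in> v" and "1 \<le> n"
  shows "\<exists>G. G k = grid n i \<and> G l = grid n (i + 1) \<and>
    (\<forall>a b. k \<le> a \<longrightarrow> a < b \<longrightarrow> b \<le> l \<longrightarrow> chord (grid M a) (grid M b) \<in> v \<longrightarrow>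
       (\<exists>n'\<ge>1. \<exists>i'. G a = grid n' i' \<and> G b = grid n' (i' + 1)))"
  using assms(3-6)
proof (induction "nat (l - k)" arbitrary: k l n i rule: less_induct)
  case less
  show ?case
  proof (cases "l = k + 1")
    case True
    define G where "G x = (if x = k then grid n i else grid n (i + 1))" for x
    have "G a = grid n i \<and> G b = grid n (i + 1)" if "k \<le> a" "a < b" "b \<le> l" for a b
    proof -
      have "a = k" "b = k + 1" using that True by linarith+
      then show ?thesis by (simp add: G_def)
    qed
    moreover have "G k = grid n i" "G l = grid n (i + 1)"
      using True by (simp_all add: G_def)
    ultimately show ?thesis using less.prems(4) by blast
  next
    case False
    then have "k + 2 \<le> l" using less.prems(1) by linarith
    then obtain m where m: "k < m" "m < l" "chord (grid M k) (grid M m) \<in> v"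
        "chord (grid M m) (grid M l) \<in> v"
      using third_vertex [OF v std _ less.prems(2,3)] by metis
    obtain G1 where G1: "G1 k = grid (Suc n) (2 * i)" "G1 m = grid (Suc n) (2 * i + 1)"
      "\<And>a b. k \<le> a \<Longrightarrow> a < b \<Longrightarrow> b \<le> m \<Longrightarrow> chord (grid M a) (grid M b) \<in> v \<Longrightarrow>
       \<exists>n'\<ge>1. \<exists>i'. G1 a = grid n' i' \<and> G1 b = grid n' (i' + 1)"
      using less.hyps [of m k "Suc n" "2 * i"] m less.prems by auto
    obtain G2 where G2: "G2 m = grid (Suc n) (2 * i + 1)" "G2 l = grid (Suc n) (2 * i + 1 + 1)"
      "\<And>a b. m \<le> a \<Longrightarrow> a < b \<Longrightarrow> b \<le> l \<Longrightarrow> chord (grid M a) (grid M b) \<in> v \<Longrightarrow>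
       \<exists>n'\<ge>1. \<exists>i'. G2 a = grid n' i' \<and> G2 b = grid n' (i' + 1)"
      using less.hyps [of l m "Suc n" "2 * i + 1"] m less.prems by auto
    define G where "G x = (if x \<le> m then G1 x else G2 x)" for x
    have G2': "G x = G2 x" if "m \<le> x" for x
      using that G1(2) G2(1) by (auto simp: G_def)
    have ends: "G k = grid n i" "G l = grid n (i + 1)"
    proof -
      show "G k = grid n i" using m G1(1) by (simp add: G_def grid_Suc)
      have "2 * i + 1 + 1 = 2 * (i + 1)" by simp
      then show "G l = grid n (i + 1)"
        using m G2(2) G2' [of l] grid_Suc [of n "i + 1"] by (simp only: less_imp_le)
    qed
    have "\<exists>n'\<ge>1. \<exists>i'. G a = grid n' i' \<and> G b = grid n' (i' + 1)"
      if ab: "k \<le> a" "a < b" "b \<le> l" "chord (grid M a) (grid M b) \<in> v" for a b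
    proof -
      consider "b \<le> m" | "m \<le> a" | "a < m" "m < b" by linarith
      then show ?thesis
      proof cases
        case 1
        then show ?thesis using G1(3) [OF ab(1,2) _ ab(4)] ab(2) by (simp add: G_def)
      next
        case 2
        then show ?thesis using G2(3) [OF _ ab(2,3,4)] ab(2) G2' by simp
      next
        case 3
        have "a = k"
        proof (rule ccontr)
          assume "a \<noteq> k"
          then have "\<not> compat (chord (grid M k) (grid M m)) (chord (grid M a) (grid M b))"
            using ab 3 less.prems(2) by (intro not_compat_cross) auto
          then show False using arc_systemD(2) [OF v m(3) ab(4)] by blast
        qed
        moreover have "b = l"
        proof (rule ccontr)
          assume "b \<noteq> l"
          then have "\<not> compat (chord (grid M a) (grid M b)) (chord (grid M m) (grid M l))"
            using ab 3 less.prems(2) by (intro not_compat_cross) auto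
          then show False using arc_systemD(2) [OF v ab(4) m(4)] by blast
        qed
        ultimately show ?thesis using ends less.prems(4) by blast
      qed
    qed
    then show ?thesis using ends by blast
  qed
qed

lemma grid_add_int: "grid n i + of_int d = grid n (i + d * 2 ^ n)"
  by (simp add: grid_def add_divide_distrib)

text \<open>The polygon with all points of level \<open>M\<close> as vertices is treated as the part of \<open>v\<close> beyond its side
  from 0 to 1. This side is sent to the interval from 0 to 1/2 and the remaining \<open>2 ^ M - 1\<close> sides
  subdivide the interval from 1/2 to 1.\<close>

lemma transport_to_base:
  assumes v: "arc_system v"
  obtains f where "f \<in> thompson_maps" "act f v = base_triangulation"
proof -
  obtain M where M: "1 \<le> M" "\<And>m k. M \<le> m \<Longrightarrow> std_arc m k \<in> v"
    using arc_system_level [OF v, of 1] by metis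
  let ?N = "2 ^ M :: int"
  have N: "2 \<le> ?N" using two_power_int_ge [OF M(1)] .
  have "chord (grid M 0) (grid M 1) \<in> v"
    using M(2) [of M 0] by (simp add: std_arc_def)
  then have "chord (grid M 1) (grid M ?N) \<in> v"
    using circ_grid_period [of M 0] by (simp add: open_segment_commute)
  then obtain G0 where G0: "G0 1 = grid 1 1" "G0 ?N = grid 1 (1 + 1)"
    "\<And>a b. 1 \<le> a \<Longrightarrow> a < b \<Longrightarrow> b \<le> ?N \<Longrightarrow> chord (grid M a) (grid M b) \<in> v \<Longrightarrow>
       \<exists>n'\<ge>1. \<exists>i'. G0 a = grid n' i' \<and> G0 b = grid n' (i' + 1)"
    using polygon_subdivision [OF v M(2) [OF order_refl], of 1 ?N 1 1] N by auto
  \<comment> \<open>periodic extension; the shift by one takes residues from 1 to \<open>2 ^ M\<close>, where \<open>G0\<close> is controlled\<close>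
  define G where "G j = G0 ((j - 1) mod ?N + 1) + of_int ((j - 1) div ?N)" for j
  have G_eq: "G j = G0 j" if "1 \<le> j" "j \<le> ?N" for j
    using that by (simp add: G_def)
  have G_period: "G (j + d * ?N) = G j + of_int d" for j d
  proof -
    have e: "j + d * ?N - 1 = j - 1 + d * ?N" by simp
    show ?thesis unfolding G_def e by simp
  qed
  interpret subdivision M G
  proof
    show "G (j + ?N) = G j + 1" for j
      using G_period [of j 1] by simp
    show "\<exists>n\<ge>1. \<exists>i. G j = grid n i \<and> G (j + 1) = grid n (i + 1)" for j
    proof -
      define r d where "r = (j - 1) mod ?N + 1" and "d = (j - 1) div ?N"
      have r: "1 \<le> r" "r \<le> ?N" using pos_mod_bound [of ?N "j - 1"] pos_mod_sign [of ?N "j - 1"] by (simp_all add: r_def del: pos_mod_bound pos_mod_sign)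
      have j: "j = r + d * ?N" using mod_div_mult_eq [of "j - 1" ?N] by (simp add: r_def d_def)
      have "\<exists>n\<ge>1. \<exists>i. G r = grid n i \<and> G (r + 1) = grid n (i + 1)"
      \<comment> \<open>the interval following the last one is the next translate of the side from 0 to 1\<close>
      proof (cases "r = ?N")
        case True
        have "G (r + 1) = grid 1 1 + of_int 1"
          using G_period [of 1 1] G_eq [of 1] G0(1) N True by (simp add: add.commute)
        then have "G r = grid 1 2 \<and> G (r + 1) = grid 1 (2 + 1)"
          using G_eq [of r] G0(2) N True unfolding grid_add_int by simp
        then show ?thesis by blast
      next
        case False
        then show ?thesis
          using G0(3) [of r "r + 1"] r M(2) [of M r] G_eq [of r] G_eq [of "r + 1"]
          by (simp add: std_arc_def)
      qed
      then obtain n i where n: "1 \<le> n" "G r = grid n i" "G (r + 1) = grid n (i + 1)" by blast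
      have "G j = grid n (i + d * 2 ^ n)"
        using n(2) G_period [of r d] by (simp add: j grid_add_int)
      moreover have "G (j + 1) = grid n (i + d * 2 ^ n + 1)"
        using n(3) G_period [of "r + 1" d] grid_add_int [of n "i + 1" d]
        by (simp add: j algebra_simps)
      ultimately show ?thesis using n(1) by blast
    qed
  qed
  have sub: "arc_image f a \<in> base_triangulation" if a: "a \<in> v" for a
  proof -
    obtain p q where pq: "a = geodesic p q" "p \<in> dyadic_points" "q \<in> dyadic_points" "p \<noteq> q"
      using a arc_systemD(1) [OF v] by (blast elim: arcsE)
    have level: "arc_image f (geodesic p q) \<in> base_triangulation"
      if pq: "p = circ (grid M a)" "q = circ (grid M b)" "1 \<le> a" "a < b" "b \<le> ?N" "geodesic p q \<in> v"
      for p q a b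
    proof -
      have "p \<noteq> q" unfolding pq(1,2) by (rule circ_grid_neq) (use pq in auto)
      then have "arc_image f (geodesic p q) = chord (G0 a) (G0 b)"
        using pq G_eq [of a] G_eq [of b] by (simp add: f_circ F_grid)
      moreover obtain n' i' where "1 \<le> n'" "G0 a = grid n' i'" "G0 b = grid n' (i' + 1)"
        using G0(3) [OF pq(3-5)] pq by blast
      ultimately show ?thesis
        unfolding base_triangulation_eq std_arc_def by auto
    qed
    have "(\<exists>m\<ge>M. \<exists>k. geodesic p q = std_arc m k) \<or> p \<in> level M \<and> q \<in> level M"
      using std_arc_or_level [OF M(2) M(1), of p q] pq a arc_systemD(1,2) [OF v] by blast
    then show ?thesis
    proof
      assume "\<exists>m\<ge>M. \<exists>k. geodesic p q = std_arc m k"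
      then show ?thesis
        using f_std_arc M(1) unfolding pq(1) base_triangulation_eq by fastforce
    next
      assume L: "p \<in> level M \<and> q \<in> level M"
      obtain x where x: "1 \<le> x" "x < 1 + ?N" "p = circ (grid M x)"
        using L grid_lift by blast
      obtain y where y: "1 \<le> y" "y < 1 + ?N" "q = circ (grid M y)"
        using L grid_lift by blast
      have "x \<noteq> y" using x y pq(4) by auto
      then consider "x < y" | "y < x" by linarith
      then show ?thesis
      proof cases
        case 1
        then show ?thesis using level [of p x q y] x y pq(1) a by simp
      next
        case 2
        then show ?thesis using level [of q y p x] x y pq(1) a by (simp add: open_segment_commute)
      qed
    qed
  qed
  have fv: "act f v = arc_image f ` v"
    using act_eq_image [OF f_thompson arc_systemD(1) [OF v]] .
  have sys: "arc_system (act f v)"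
    using arc_system_image [OF f_thompson v] by (simp add: fv)
  have sub': "act f v \<subseteq> base_triangulation" using sub by (auto simp: fv)
  have "base_triangulation \<subseteq> act f v"
    using arc_systemD(3) [OF sys] arc_systemD(1,2) [OF arc_system_base] sub' by blast
  with sub' show thesis using that [OF f_thompson] by blast
qed

lemma Psi_transitive: "transitive_action thompson_T C_vertices Psi"
proof (intro transitive_action.intro Psi_action transitive_action_axioms.intro)
  fix v w assume "v \<in> C_vertices" "w \<in> C_vertices"
  then have vw: "arc_system v" "arc_system w" by (simp_all add: C_vertices_eq)
  obtain f where f: "f \<in> thompson_maps" "act f v = base_triangulation"
    using transport_to_base [OF vw(1)] .
  obtain g where g: "g \<in> thompson_maps" "act g w = base_triangulation"
    using transport_to_base [OF vw(2)] .
  let ?g' = "restrict (inv_into S1 g) S1"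
  note g' = thompson_inverse [OF g(1)]
  have "act (compose S1 ?g' f) v = act ?g' (act g w)"
    using act_compose [OF g' f(1) vw(1)] f(2) g(2) by simp
  then have "Psi (compose S1 ?g' f) v = w"
    using vw act_inverse(1) [OF g(1) vw(2)] by (simp add: Psi_def C_vertices_eq)
  then show "\<exists>h\<in>carrier thompson_T. Psi h v = w"
    using thompson_compose [OF g' f(1)] carrier_thompson_T by blast
qed

theorem proposition4:
  shows "group_hom thompson_T Aut_C Psi
    \<and> transitive_action thompson_T C_vertices Psi
    \<and> inj_on Psi (carrier thompson_T)"
  using Psi_hom Psi_transitive Psi_inj by blast

end
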